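(* Let $n$ be a positive integer, let $\Omega\subset\mathbb{R}^n$ be open and connected, and let $g \in C^2(\mathbb{R})$ satisfy $g''(t) > 0$ for all $t\in\mathbb{R}$ and $g(0) = g'(0) = 0$. Let $u : \Omega\to\mathbb{R}^n$ be a Lipschitz map with $u\in W^{2,1}(\Omega,\mathbb{R}^n)$ which is a critical point of the energy $\int_\Omega g(\det(Du))\,dx$, i.e. $u$ solves in the weak sense in $\Omega$ $$\operatorname{div}\big(g'(\det(Du))\operatorname{cof}^T(Du)\big) = 0.$$ Then $x\mapsto\det(Du)(x)$ is constant (i.e. equal to a constant a.e. in $\Omega$).
   Context: $(Du)_{ij} = \partial_j u_i$. For $X \in \mathbb{R}^{n\times n}$, $\operatorname{cof}(X)$ is the matrix with entries $\operatorname{cof}(X)_{ij} = (-1)^{i+j}\det(M_{ji}(X))$, where $M_{ji}(X)$ is obtained from $X$ by deleting the $j$-th row and $i$-th column (so $X\operatorname{cof}(X) = \operatorname{cof}(X)X = \det(X)\,\mathrm{id}$; the empty determinant is $1$), and $\operatorname{cof}^T(X)$ is its transpose. Divergences of matrix fields are taken row-wise; the equation in the weak sense means $\int_\Omega g'(\det(Du))\langle \operatorname{cof}^T(Du), D\eta\rangle\,dx = 0$ for all $\eta \in C_c^\infty(\Omega,\mathbb{R}^n)$, where $\langle\cdot,\cdot\rangle$ is the Hilbert-Schmidt scalar product. *)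

theory Defs
  imports "HOL-Analysis.Analysis" "Jordan_Normal_Form.Determinant"
begin

no_notation vec_index (infixl \<open>$\<close> 100)
no_notation scalar_prod (infix \<open>\<bullet>\<close> 70)

text \<open>
  A minor of an n x n matrix has a different size, so minors are taken in the type of
  Jordan_Normal_Form matrices, whose dimensions are natural numbers. The coordinates of
  \<open>real ^ 'n\<close> are numbered 0, ..., n - 1 in increasing order; starting at 0 instead
  of 1 does not affect the sign \<open>(-1) ^ (i + j)\<close>.
\<close>

definition index_pos :: "'n::{finite,wellorder} \<Rightarrow> nat" where
  "index_pos i = card {k. k < i}"

definition jnf_mat :: "real ^ 'n::{finite,wellorder} ^ 'n::_ \<Rightarrow> real mat" where
  "jnf_mat X = Matrix.mat CARD('n) CARD('n)
     (\<lambda>(r, c). X $ (inv_into UNIV index_pos r) $ (inv_into UNIV index_pos c))"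

definition cof :: "real ^ 'n::{finite,wellorder} ^ 'n::_ \<Rightarrow> real ^ 'n::_ ^ 'n::_" where
  "cof X = (\<chi> i j. (-1) ^ (index_pos i + index_pos j) *
     Determinant.det (mat_delete (jnf_mat X) (index_pos j) (index_pos i)))"

primrec C_k :: "nat \<Rightarrow> ('a::euclidean_space \<Rightarrow> 'b::real_normed_vector) \<Rightarrow> bool" where
  "C_k 0 f \<longleftrightarrow> continuous_on UNIV f"
| "C_k (Suc k) f \<longleftrightarrow> (\<forall>x. f differentiable (at x)) \<and>
     (\<forall>v. C_k k (\<lambda>x. frechet_derivative f (at x) v))"

text \<open>Elements of \<open>C_c^\<infinity>(\<Omega>)\<close> are identified with their extensions by zero.\<close>

definition test_functions ::
  "'a::euclidean_space set \<Rightarrow> ('a \<Rightarrow> 'b::real_normed_vector) set" where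
  "test_functions \<Omega> = {\<phi>. (\<forall>k. C_k k \<phi>) \<and>
     compact (closure {x. \<phi> x \<noteq> 0}) \<and> closure {x. \<phi> x \<noteq> 0} \<subseteq> \<Omega>}"

definition locally_integrable_on ::
  "('a::euclidean_space \<Rightarrow> real) \<Rightarrow> 'a set \<Rightarrow> bool" where
  "locally_integrable_on f \<Omega> \<longleftrightarrow>
     (\<forall>K. compact K \<and> K \<subseteq> \<Omega> \<longrightarrow> set_integrable lebesgue K f)"

text \<open>\<open>h\<close> is (a representative of) the weak partial derivative of \<open>f\<close> in direction \<open>j\<close>.\<close>

definition weak_partial ::
  "(real ^ 'n) set \<Rightarrow> 'n \<Rightarrow> (real ^ 'n \<Rightarrow> real) \<Rightarrow> (real ^ 'n \<Rightarrow> real) \<Rightarrow> bool" where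
  "weak_partial \<Omega> j f h \<longleftrightarrow>
     locally_integrable_on f \<Omega> \<and> locally_integrable_on h \<Omega> \<and>
     (\<forall>\<phi> \<in> test_functions \<Omega>.
        (LINT x:\<Omega>|lebesgue. f x * frechet_derivative \<phi> (at x) (axis j 1)) =
        - (LINT x:\<Omega>|lebesgue. h x * \<phi> x))"

text \<open>The Sobolev spaces \<open>W^{k,1}(\<Omega>)\<close>; values outside \<open>\<Omega>\<close> are irrelevant.\<close>

primrec sobolev_1 :: "nat \<Rightarrow> (real ^ 'n) set \<Rightarrow> (real ^ 'n \<Rightarrow> real) set" where
  "sobolev_1 0 \<Omega> = {f. set_integrable lebesgue \<Omega> f}"
| "sobolev_1 (Suc k) \<Omega> = {f. set_integrable lebesgue \<Omega> f \<and>
     (\<forall>j. \<exists>h \<in> sobolev_1 k \<Omega>. weak_partial \<Omega> j f h)}"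

definition weak_jacobian ::
  "(real ^ 'n) set \<Rightarrow> (real ^ 'n \<Rightarrow> real ^ 'm) \<Rightarrow> (real ^ 'n \<Rightarrow> real ^ 'n ^ 'm) \<Rightarrow> bool" where
  "weak_jacobian \<Omega> u Du \<longleftrightarrow>
     (\<forall>i j. weak_partial \<Omega> j (\<lambda>x. u x $ i) (\<lambda>x. Du x $ i $ j))"

end

theory Submission
  imports Defs
begin

text \<open>
  Writing \<open>d = det (Du)\<close>, the equation in divergence form and the Piola identity
  \<open>div (cof\<^sup>T (Du)) = 0\<close> (symmetry of second derivatives against antisymmetry of the
  determinant) give \<open>g''(d) cof\<^sup>T (Du) \<nabla>d = 0\<close>. As \<open>g'' > 0\<close>, the gradient of \<open>d\<close> vanishes
  wherever \<open>cof\<^sup>T (Du)\<close> is invertible, that is, wherever \<open>d \<noteq> 0\<close>. Hence \<open>\<nabla>(d\<^sup>2) = 2 d \<nabla>d = 0\<close>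
  and \<open>d\<^sup>2\<close> is constant; if the constant is not zero, then \<open>\<nabla>d = 0\<close> almost everywhere.

  The chain rule for bounded \<open>W\<^sup>1\<^sup>,\<^sup>1\<close> functions comes from a characterisation of weak derivatives
  as local \<open>L\<^sup>1\<close> limits of difference quotients. It rests on the identity
  \<open>f (x + T v) - f x = \<integral>\<^sub>0\<^sup>T h (x + s v) ds\<close> for almost every \<open>x\<close>, obtained by Fubini's theorem
  from the definition tested with translates, and on the continuity of translations in \<open>L\<^sup>1\<close>.
\<close>

section \<open>Smooth functions\<close>

text \<open>Where d = 0 the cofactor matrix may be singular, and the equation then leaves the
  gradient of d undetermined. The square is chosen because its gradient carries the factor d, which
  disposes of this set whatever its size. That d^2 is constant still allows d to jump between two
  opposite values; the second use of connectedness, for d itself, rules this out.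

  The Lipschitz hypothesis makes the nonlinear expressions legitimate: it bounds Du, so that
  g'(det(Du)) cof^T(Du) is a C^1 function of a bounded field with integrable derivatives. As
  \<Omega> may have infinite measure, such functions of the field are kept integrable by asking that
  they vanish at the zero matrix; for the flux this is g'(0) = 0.

  The analysis takes place with Borel functions on the whole space. There Fubini's theorem and
  translation invariance apply without regard to the domain, and \<Omega> enters only through the
  supports of test functions and through its compact subsets.\<close>

lemma C_k_cong_derivative:
  assumes "\<And>x. (f has_derivative f' x) (at x)" and "\<And>v. C_k k (\<lambda>x. f' x v)"
  shows "C_k (Suc k) f"
proof -
  have "frechet_derivative f (at x) = f' x" for x
    using frechet_derivative_at[OF assms(1)[of x]] by simp
  then show ?thesis using assms by (auto simp: differentiable_def)
qed

lemma C_k_SucD: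
  assumes "C_k (Suc k) f"
  shows "(f has_derivative frechet_derivative f (at x)) (at x)"
    and "C_k k (\<lambda>x. frechet_derivative f (at x) v)"
  using assms by (auto simp: frechet_derivative_works)

lemma C_k_const: "C_k k (\<lambda>x. c)"
  by (induction k arbitrary: c) auto

lemma C_k_add: "C_k k f \<Longrightarrow> C_k k g \<Longrightarrow> C_k k (\<lambda>x. f x + g x)"
proof (induction k arbitrary: f g)
  case 0 then show ?case by (auto intro: continuous_intros)
next
  case (Suc k)
  show ?case
    by (rule C_k_cong_derivative[OF has_derivative_add[OF C_k_SucD(1)[OF Suc.prems(1)] C_k_SucD(1)[OF Suc.prems(2)]]])
      (intro Suc.IH C_k_SucD(2) Suc.prems)
qed

lemma C_k_Suc_imp: "C_k (Suc k) f \<Longrightarrow> C_k k f"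
proof (induction k arbitrary: f)
  case 0 then show ?case
    by (auto intro!: differentiable_imp_continuous_on simp: differentiable_on_def intro: differentiable_at_withinI)
next
  case (Suc k)
  have "C_k k (\<lambda>x. frechet_derivative f (at x) v)" for v
    using Suc.IH[OF C_k_SucD(2)[OF Suc.prems]] .
  with Suc.prems show ?case by auto
qed

lemma C_k_linear_image:
  assumes "bounded_linear L"
  shows "C_k k f \<Longrightarrow> C_k k (\<lambda>x. L (f x))"
proof (induction k arbitrary: f)
  case 0 then show ?case using bounded_linear.continuous_on[OF assms] by auto
next
  case (Suc k)
  show ?case
    by (rule C_k_cong_derivative[OF bounded_linear.has_derivative[OF assms C_k_SucD(1)[OF Suc.prems]]])
      (intro Suc.IH C_k_SucD(2) Suc.prems)
qed

lemma C_k_mult: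
  fixes f g :: "'a::euclidean_space \<Rightarrow> real"
  shows "C_k k f \<Longrightarrow> C_k k g \<Longrightarrow> C_k k (\<lambda>x. f x * g x)"
proof (induction k arbitrary: f g)
  case 0 then show ?case by (auto intro: continuous_intros)
next
  case (Suc k)
  show ?case
    by (rule C_k_cong_derivative[OF has_derivative_mult[OF C_k_SucD(1)[OF Suc.prems(1)] C_k_SucD(1)[OF Suc.prems(2)]]])
      (intro Suc.IH C_k_SucD(2) Suc.prems C_k_add C_k_Suc_imp)
qed

lemma C_k_compose_affine:
  assumes "bounded_linear L"
  shows "C_k k f \<Longrightarrow> C_k k (\<lambda>x. f (L x + c))"
proof (induction k arbitrary: f)
  case 0
  have "continuous_on UNIV (\<lambda>x. L x + c)"
    using bounded_linear.continuous_on[OF assms continuous_on_id] by (auto intro: continuous_intros)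
  from continuous_on_compose2[OF _ this, of UNIV f] 0 show ?case by auto
next
  case (Suc k)
  have "((\<lambda>x. L x + c) has_derivative L) (at x)" for x
    using bounded_linear_imp_has_derivative[OF assms] by (auto intro!: derivative_eq_intros)
  from has_derivative_compose[OF this C_k_SucD(1)[OF Suc.prems]]
  show ?case by (rule C_k_cong_derivative) (intro Suc.IH C_k_SucD(2) Suc.prems)
qed

lemma C_k_prod:
  fixes f :: "'i \<Rightarrow> 'a::euclidean_space \<Rightarrow> real"
  assumes "finite I" "\<And>i. i \<in> I \<Longrightarrow> C_k k (f i)"
  shows "C_k k (\<lambda>x. \<Prod>i\<in>I. f i x)"
  using assms by (induction rule: finite_induct) (auto intro!: C_k_const C_k_mult)

lemma C_k_power:
  fixes f :: "'a::euclidean_space \<Rightarrow> real"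
  shows "C_k k f \<Longrightarrow> C_k k (\<lambda>x. f x ^ m)"
  by (induction m) (auto intro: C_k_const C_k_mult)

section \<open>A smooth bump function on a box\<close>

text \<open>The powers of t in the denominator make the family closed under differentiation up to
  linear combinations, so that one induction, with m arbitrary, proves that all members are
  smooth.\<close>

definition flat_exp :: "nat \<Rightarrow> real \<Rightarrow> real" where
  "flat_exp m t = (if t > 0 then exp (- (1 / t)) / t ^ m else 0)"

text \<open>The substitution s = 1 / t turns the claim into the decay of
  \<open>s ^ m / exp s\<close> at infinity.\<close>

lemma flat_exp_at_right_0: "(flat_exp m \<longlongrightarrow> 0) (at_right 0)"
proof -
  have "((\<lambda>s::real. s ^ m / exp s) \<longlongrightarrow> 0) at_top"
    by (rule tendsto_power_div_exp_0)
  then have "((\<lambda>t::real. (1 / t) ^ m / exp (1 / t)) \<longlongrightarrow> 0) (at_right 0)"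
    by (rule filterlim_compose) (use filterlim_inverse_at_top_right in \<open>simp add: inverse_eq_divide\<close>)
  then show ?thesis
    by (rule Lim_transform_eventually)
      (auto simp: eventually_at_filter flat_exp_def exp_minus field_simps)
qed

lemma flat_exp_tendsto_0: "(flat_exp m \<longlongrightarrow> 0) (at 0)"
  unfolding filterlim_at_split
  by (auto intro!: flat_exp_at_right_0 Lim_transform_eventually[OF tendsto_const]
      simp: eventually_at_filter flat_exp_def)

lemma flat_exp_has_derivative:
  "(flat_exp m has_real_derivative (flat_exp (m + 2) t - m * flat_exp (m + 1) t)) (at t)"
proof -
  consider "t > 0" | "t = 0" | "t < 0" by linarith
  then show ?thesis
  proof cases
    case 1
    have pw: "((\<lambda>t. t ^ m) has_real_derivative m * t ^ m / t) (at t)"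
    proof -
      have "real m * t ^ (m - Suc 0) = m * t ^ m / t" using 1 by (cases m) auto
      then show ?thesis using DERIV_pow[of m t UNIV] by simp
    qed
    have "((\<lambda>t. exp (- (1 / t)) / t ^ m) has_real_derivative (flat_exp (m + 2) t - m * flat_exp (m + 1) t)) (at t)"
    proof -
      have "((\<lambda>t. exp (- (1 / t))) has_real_derivative exp (- (1 / t)) / t\<^sup>2) (at t)"
        using 1 by (auto intro!: derivative_eq_intros simp: power2_eq_square)
      from DERIV_divide[OF this pw] 1 show ?thesis
        by (auto elim!: DERIV_cong simp: flat_exp_def field_simps power2_eq_square)
    qed
    then show ?thesis
      by (rule has_field_derivative_transform_within_open[where S = "{0<..}"])
        (use 1 in \<open>auto simp: flat_exp_def\<close>)
  next
    case 2
    \<comment> \<open>The difference quotient of \<open>flat_exp m\<close> at 0 is again a member of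
      the family, namely \<open>flat_exp (Suc m)\<close>.\<close>
    have "(flat_exp m has_real_derivative 0) (at 0)"
      unfolding has_field_derivative_iff
      by (rule Lim_transform_eventually[OF flat_exp_tendsto_0[of "Suc m"]])
        (auto simp: flat_exp_def eventually_at field_simps intro!: exI[of _ 1])
    then show ?thesis using 2 by (simp add: flat_exp_def)
  next
    case 3
    have "((\<lambda>t. 0) has_real_derivative (flat_exp (m + 2) t - m * flat_exp (m + 1) t)) (at t)"
      using 3 by (simp add: flat_exp_def)
    then show ?thesis
      by (rule has_field_derivative_transform_within_open[where S = "{..<0}"])
        (use 3 in \<open>auto simp: flat_exp_def\<close>)
  qed
qed

lemma C_k_flat_exp: "C_k k (flat_exp m)"
proof (induction k arbitrary: m)
  case 0
  show ?case using DERIV_isCont[OF flat_exp_has_derivative] by (auto simp: continuous_at_imp_continuous_on)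
next
  case (Suc k)
  have lin: "bounded_linear (\<lambda>y::real. c * y)" for c by (rule bounded_linear_mult_right)
  show ?case
  proof (rule C_k_cong_derivative[OF has_field_derivative_imp_has_derivative[OF flat_exp_has_derivative]])
    fix v :: real
    have "C_k k (\<lambda>t. v * flat_exp (m + 2) t + (- (real m * v)) * flat_exp (m + 1) t)"
      by (intro C_k_add C_k_linear_image[OF lin] Suc.IH)
    then show "C_k k (\<lambda>t. (flat_exp (m + 2) t - real m * flat_exp (m + 1) t) * v)"
      by (simp add: algebra_simps)
  qed
qed

definition box_bump :: "'a::euclidean_space \<Rightarrow> 'a \<Rightarrow> 'a \<Rightarrow> real" where
  "box_bump a b x = (\<Prod>i\<in>Basis. flat_exp 0 (x \<bullet> i - a \<bullet> i) * flat_exp 0 (b \<bullet> i - x \<bullet> i))"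

lemma C_k_box_bump: "C_k k (box_bump a b)"
proof -
  have "C_k k (\<lambda>x. flat_exp 0 (x \<bullet> i + (- (a \<bullet> i))))" "C_k k (\<lambda>x. flat_exp 0 (x \<bullet> (- i) + b \<bullet> i))" for i :: 'a
    by (intro C_k_compose_affine C_k_flat_exp bounded_linear_inner_left)+
  then show ?thesis
    unfolding box_bump_def[abs_def] by (intro C_k_prod C_k_mult) (auto simp: algebra_simps)
qed

lemma flat_exp_0_bounds: "0 \<le> flat_exp 0 t" "flat_exp 0 t \<le> 1" "flat_exp 0 t = 0 \<longleftrightarrow> t \<le> 0"
  by (auto simp: flat_exp_def)

lemma box_bump_bounds: "0 \<le> box_bump a b x" "box_bump a b x \<le> 1" "box_bump a b x = 0 \<longleftrightarrow> x \<notin> box a b"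
  unfolding box_bump_def
  by (auto intro!: prod_nonneg prod_le_1 mult_nonneg_nonneg mult_le_one simp: flat_exp_0_bounds mem_box not_less)
    (force simp: not_less)?

section \<open>Translations and test functions\<close>

lemma lborel_translation:
  fixes f :: "'a::euclidean_space \<Rightarrow> 'b::{banach, second_countable_topology}"
  shows integrable_translation: "integrable lborel f \<Longrightarrow> integrable lborel (\<lambda>x. f (x + c))"
    and integral_translation: "f \<in> borel_measurable borel \<Longrightarrow> (\<integral>x. f (x + c) \<partial>lborel) = (\<integral>x. f x \<partial>lborel)"
proof -
  have d: "distr lborel lborel (\<lambda>x. x + c) = (lborel :: 'a measure)"
    using lborel_distr_plus[of c] by (simp add: add.commute cong: distr_cong)
  have m: "(\<lambda>x. x + c) \<in> measurable lborel (lborel :: 'a measure)" by simp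
  show "integrable lborel (\<lambda>x. f (x + c))" if "integrable lborel f"
    using integrable_distr[OF m, of f] that by (simp add: d)
  show "(\<integral>x. f (x + c) \<partial>lborel) = (\<integral>x. f x \<partial>lborel)" if "f \<in> borel_measurable borel"
    using integral_distr[OF m, of f] that by (simp add: d)
qed

lemma AE_translation:
  fixes c :: "'a::euclidean_space"
  assumes "AE x in lborel. P x"
  shows "AE x in lborel. P (x + c)"
proof -
  have d: "distr lborel lborel (\<lambda>x. x + c) = (lborel :: 'a measure)"
    using lborel_distr_plus[of c] by (simp add: add.commute cong: distr_cong)
  have m: "(\<lambda>x. x + c) \<in> measurable lborel (lborel :: 'a measure)" by simp
  obtain N where N: "N \<in> null_sets lborel" "{x. \<not> P x} \<subseteq> N"
    using assms by (auto simp: eventually_ae_filter)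
  then have "AE x in distr lborel lborel (\<lambda>x. x + c). x \<notin> N"
    unfolding d by (auto intro: AE_not_in)
  then have "AE x in lborel. x + c \<notin> N"
    by (subst (asm) AE_distr_iff[OF m]) (use N in \<open>auto simp: null_sets_def\<close>)
  then show ?thesis by eventually_elim (use N in auto)
qed

section \<open>Continuity of translations in mean\<close>

text \<open>Sequences of shifts are used because dominated convergence is a sequential statement;
  the form with a radius is recovered in \<open>L1_translation_bound\<close>.\<close>

definition L1_continuous :: "('a::euclidean_space \<Rightarrow> real) \<Rightarrow> bool" where
  "L1_continuous f \<longleftrightarrow> (\<forall>w :: nat \<Rightarrow> 'a. w \<longlonglongrightarrow> 0 \<longrightarrow>
     (\<lambda>n. \<integral>x. \<bar>f (x + w n) - f x\<bar> \<partial>lborel) \<longlonglongrightarrow> 0)"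

text \<open>Splitting into three terms: by translation invariance, replacing the shifted f by the
  shifted g costs the same as replacing f by g.\<close>

lemma L1_continuous_approx:
  assumes f: "integrable lborel f"
    and approx: "\<And>e. e > 0 \<Longrightarrow> \<exists>g. integrable lborel g \<and> L1_continuous g \<and> (\<integral>x. \<bar>f x - g x\<bar> \<partial>lborel) < e"
  shows "L1_continuous f"
  unfolding L1_continuous_def
proof (intro allI impI)
  fix w :: "nat \<Rightarrow> 'a" assume w: "w \<longlonglongrightarrow> 0"
  show "(\<lambda>n. \<integral>x. \<bar>f (x + w n) - f x\<bar> \<partial>lborel) \<longlonglongrightarrow> 0"
  proof (rule LIMSEQ_I)
    fix e :: real assume "e > 0"
    then obtain g where g: "integrable lborel g" "L1_continuous g" "(\<integral>x. \<bar>f x - g x\<bar> \<partial>lborel) < e / 3"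
      using approx[of "e / 3"] by auto
    have [measurable]: "f \<in> borel_measurable borel" "g \<in> borel_measurable borel"
      using f g by auto
    from g(2) w have "(\<lambda>n. \<integral>x. \<bar>g (x + w n) - g x\<bar> \<partial>lborel) \<longlonglongrightarrow> 0"
      by (auto simp: L1_continuous_def)
    from LIMSEQ_D[OF this, of "e / 3"] \<open>e > 0\<close> obtain N
      where N: "\<And>n. n \<ge> N \<Longrightarrow> (\<integral>x. \<bar>g (x + w n) - g x\<bar> \<partial>lborel) < e / 3" by auto
    have "(\<integral>x. \<bar>f (x + w n) - f x\<bar> \<partial>lborel) < e" if "n \<ge> N" for n
    proof -
      have "(\<integral>x. \<bar>f (x + w n) - f x\<bar> \<partial>lborel) \<le>
          (\<integral>x. \<bar>f (x + w n) - g (x + w n)\<bar> + \<bar>g (x + w n) - g x\<bar> + \<bar>f x - g x\<bar> \<partial>lborel)"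
        by (rule integral_mono)
          (auto intro!: Bochner_Integration.integrable_add Bochner_Integration.integrable_diff integrable_abs
            integrable_translation f g)
      also have "\<dots> = (\<integral>x. \<bar>f (x + w n) - g (x + w n)\<bar> \<partial>lborel) + (\<integral>x. \<bar>g (x + w n) - g x\<bar> \<partial>lborel) + (\<integral>x. \<bar>f x - g x\<bar> \<partial>lborel)"
        by (subst Bochner_Integration.integral_add;
            (intro Bochner_Integration.integrable_add Bochner_Integration.integrable_diff integrable_abs integrable_translation f g)?)+ simp
      also have "(\<integral>x. \<bar>f (x + w n) - g (x + w n)\<bar> \<partial>lborel) = (\<integral>x. \<bar>f x - g x\<bar> \<partial>lborel)"
        by (rule integral_translation) measurable
      finally show ?thesis using N[OF that] g(3) by linarith
    qed
    then show "\<exists>N. \<forall>n\<ge>N. norm ((\<integral>x. \<bar>f (x + w n) - f x\<bar> \<partial>lborel) - 0) < e" by auto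
  qed
qed

text \<open>Openness controls only one half of the difference: the part p of U that leaves U under
  the shift tends to zero pointwise and is dominated by the indicator of U. The other half has the
  same integral, since U and its translate have equal finite measure; this gives the factor
  2.\<close>

lemma L1_continuous_open_indicator:
  fixes U :: "'a::euclidean_space set"
  assumes U: "open U" "emeasure lborel U < \<infinity>"
  shows "L1_continuous (indicator U)"
  unfolding L1_continuous_def
proof (intro allI impI)
  fix w :: "nat \<Rightarrow> 'a" assume w: "w \<longlonglongrightarrow> 0"
  have [measurable]: "U \<in> sets borel" using U by auto
  have int: "integrable lborel (indicator U :: 'a \<Rightarrow> real)" using U by (simp add: integrable_indicator_iff)
  define p where "p n x = max 0 (indicator U x - indicator U (x + w n) :: real)" for n x
  have [measurable]: "p n \<in> borel_measurable borel" for n unfolding p_def by measurable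
  have p0: "(\<lambda>n. p n x) \<longlonglongrightarrow> 0" for x
  proof (cases "x \<in> U")
    case True
    have "(\<lambda>n. x + w n) \<longlonglongrightarrow> x" using tendsto_add[OF tendsto_const w, of x] by simp
    from topological_tendstoD[OF this U(1) True]
    show ?thesis by (intro Lim_transform_eventually[OF tendsto_const])
      (auto simp: p_def elim!: eventually_mono)
  next
    case False
    then have "p n x = 0" for n by (simp add: p_def)
    then show ?thesis by simp
  qed
  have "(\<lambda>n. \<integral>x. p n x \<partial>lborel) \<longlonglongrightarrow> (\<integral>x. (0::real) \<partial>(lborel :: 'a measure))"
    by (rule integral_dominated_convergence[where w = "indicator U"])
      (use int in \<open>auto simp: p0 intro: AE_I2\<close>, auto simp: p_def indicator_def)
  moreover have "(\<integral>x. \<bar>indicator U (x + w n) - indicator U x\<bar> \<partial>lborel) = 2 * (\<integral>x. p n x \<partial>lborel)" for n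
  proof -
    have i: "integrable lborel (\<lambda>x. indicator U (x + w n) :: real)" by (rule integrable_translation[OF int])
    have pi: "integrable lborel (p n)"
      unfolding p_def by (intro integrable_max Bochner_Integration.integrable_diff i int) auto
    have "(\<integral>x. \<bar>indicator U (x + w n) - indicator U x\<bar> \<partial>lborel)
        = (\<integral>x. 2 * p n x + (indicator U (x + w n) - indicator U x) \<partial>lborel)"
      by (intro Bochner_Integration.integral_cong) (auto simp: p_def max_def)
    also have "\<dots> = 2 * (\<integral>x. p n x \<partial>lborel) + ((\<integral>x. indicator U (x + w n) \<partial>lborel) - (\<integral>x. indicator U x \<partial>lborel))"
      using i int pi by simp
    also have "(\<integral>x. indicator U (x + w n) \<partial>lborel) = (\<integral>x. indicator U x \<partial>lborel :: real)"
      by (rule integral_translation) measurable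
    finally show ?thesis by simp
  qed
  ultimately show "(\<lambda>n. \<integral>x. \<bar>indicator U (x + w n) - indicator U x\<bar> \<partial>lborel) \<longlonglongrightarrow> (0::real)"
    by (auto intro: tendsto_mult_right_zero)
qed

lemma L1_continuous_cmult:
  assumes "L1_continuous f" shows "L1_continuous (\<lambda>x. c * f x)"
proof -
  have "\<bar>c * f (x + w) - c * f x\<bar> = \<bar>c\<bar> * \<bar>f (x + w) - f x\<bar>" for x w
    by (simp add: abs_mult[symmetric] algebra_simps)
  then show ?thesis using assms by (auto simp: L1_continuous_def intro: tendsto_mult_right_zero)
qed

lemma L1_continuous_add:
  assumes "L1_continuous f" "L1_continuous g" "integrable lborel f" "integrable lborel g"
  shows "L1_continuous (\<lambda>x. f x + g x)"
  unfolding L1_continuous_def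
proof (intro allI impI)
  fix w :: "nat \<Rightarrow> 'a" assume w: "w \<longlonglongrightarrow> 0"
  have i: "integrable lborel (\<lambda>x. \<bar>f (x + w n) - f x\<bar>)" "integrable lborel (\<lambda>x. \<bar>g (x + w n) - g x\<bar>)" for n
    by (intro integrable_abs Bochner_Integration.integrable_diff integrable_translation assms)+
  have i': "integrable lborel (\<lambda>x. \<bar>f (x + w n) + g (x + w n) - (f x + g x)\<bar>)" for n
    by (intro integrable_abs Bochner_Integration.integrable_add Bochner_Integration.integrable_diff integrable_translation assms)
  let ?B = "\<lambda>n. (\<integral>x. \<bar>f (x + w n) - f x\<bar> \<partial>lborel) + (\<integral>x. \<bar>g (x + w n) - g x\<bar> \<partial>lborel)"
  have B: "?B \<longlonglongrightarrow> 0"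
    using assms w by (auto intro!: tendsto_add_zero simp: L1_continuous_def)
  have le: "(\<integral>x. \<bar>f (x + w n) + g (x + w n) - (f x + g x)\<bar> \<partial>lborel)
      \<le> (\<integral>x. \<bar>f (x + w n) - f x\<bar> \<partial>lborel) + (\<integral>x. \<bar>g (x + w n) - g x\<bar> \<partial>lborel)" for n
  proof -
    have "(\<integral>x. \<bar>f (x + w n) + g (x + w n) - (f x + g x)\<bar> \<partial>lborel)
        \<le> (\<integral>x. \<bar>f (x + w n) - f x\<bar> + \<bar>g (x + w n) - g x\<bar> \<partial>lborel)"
      by (rule integral_mono[OF i' Bochner_Integration.integrable_add[OF i]]) auto
    then show ?thesis by (simp only: Bochner_Integration.integral_add[OF i])
  qed
  show "(\<lambda>n. \<integral>x. \<bar>f (x + w n) + g (x + w n) - (f x + g x)\<bar> \<partial>lborel) \<longlonglongrightarrow> 0"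
    by (rule tendsto_sandwich[OF _ _ tendsto_const B])
      (rule always_eventually, rule allI, rule integral_nonneg_AE, simp, rule always_eventually, rule allI, rule le)
qed

text \<open>Outer regularity approximates a set of finite measure by open supersets, which settles
  indicators; linear combinations and dominated limits then reach every integrable function.\<close>

theorem integrable_imp_L1_continuous:
  fixes f :: "'a::euclidean_space \<Rightarrow> real"
  assumes "integrable lborel f" shows "L1_continuous f"
  using assms
proof (induction rule: integrable_induct)
  case (base A c)
  have A: "A \<in> sets borel" "emeasure lborel A < \<infinity>" using base by auto
  have int: "integrable lborel (\<lambda>x. indicator A x *\<^sub>R c)" using base by simp
  have "L1_continuous (indicator A)"
  proof (rule L1_continuous_approx)
    show "integrable lborel (indicator A :: 'a \<Rightarrow> real)" using A by (simp add: integrable_indicator_iff)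
    fix e :: real assume "e > 0"
    obtain U where U: "open U" "A \<subseteq> U" "emeasure lborel (U - A) < e"
      using outer_regular_lborel[OF A(1) \<open>e > 0\<close>] .
    have [measurable]: "U \<in> sets borel" using U by auto
    have "emeasure lborel U = emeasure lborel A + emeasure lborel (U - A)"
      using U A by (subst plus_emeasure) (auto simp: Un_absorb1)
    also have "\<dots> < \<infinity>"
      using A(2) order.strict_trans[OF U(3) ennreal_less_top] by simp
    finally have fin: "emeasure lborel U < \<infinity>" .
    have "(\<integral>x. \<bar>indicator A x - indicator U x\<bar> \<partial>lborel) = (\<integral>x. indicator (U - A) x \<partial>lborel :: real)"
      using U(2) by (intro Bochner_Integration.integral_cong) (auto simp: indicator_def)
    also have "\<dots> = measure lborel (U - A)" by simp
    also have "\<dots> < e"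
    proof -
      have "emeasure lborel (U - A) \<noteq> \<infinity>" using U(3) by (intro notI) simp
      then have "ennreal (measure lborel (U - A)) < ennreal e" using U(3) by (simp add: emeasure_eq_ennreal_measure)
      then show ?thesis by (subst (asm) ennreal_less_iff) auto
    qed
    finally show "\<exists>g. integrable lborel g \<and> L1_continuous g \<and> (\<integral>x. \<bar>indicator A x - g x\<bar> \<partial>lborel) < e"
      using L1_continuous_open_indicator[OF U(1) fin] fin
      by (intro exI[of _ "indicator U"]) (auto simp: integrable_indicator_iff)
  qed
  from L1_continuous_cmult[OF this, of c] show ?case by (simp add: mult.commute)
next
  case (add f g)
  then show ?case by (intro L1_continuous_add)
next
  case (lim f s)
  show ?case
  proof (rule L1_continuous_approx[OF lim.hyps(4)])
    fix e :: real assume "e > 0"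
    have [measurable]: "f \<in> borel_measurable lborel" "\<And>i. s i \<in> borel_measurable lborel"
      using lim.hyps by auto
    have "(\<lambda>i. \<integral>x. \<bar>f x - s i x\<bar> \<partial>lborel) \<longlonglongrightarrow> (\<integral>x. (0::real) \<partial>(lborel :: 'a measure))"
    proof (rule integral_dominated_convergence[where w = "\<lambda>x. 3 * norm (f x)"])
      show "AE x in lborel. (\<lambda>i. \<bar>f x - s i x\<bar>) \<longlonglongrightarrow> 0"
      proof (rule AE_I2)
        fix x :: 'a
        have "(\<lambda>i. s i x) \<longlonglongrightarrow> f x" using lim.hyps(2)[of x] by simp
        then have "(\<lambda>i. \<bar>f x - s i x\<bar>) \<longlonglongrightarrow> \<bar>f x - f x\<bar>"
          by (intro tendsto_rabs tendsto_diff tendsto_const)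
        then show "(\<lambda>i. \<bar>f x - s i x\<bar>) \<longlonglongrightarrow> 0" by simp
      qed
      \<comment> \<open>The approximants of \<open>integrable_induct\<close> are bounded by
        \<open>2 * norm (f x)\<close>; the third multiple comes from f itself.\<close>
      show "AE x in lborel. norm \<bar>f x - s i x\<bar> \<le> 3 * norm (f x)" for i
      proof (rule AE_I2)
        fix x :: 'a
        show "norm \<bar>f x - s i x\<bar> \<le> 3 * norm (f x)" using lim.hyps(3)[of x i] by simp
      qed
    qed (use lim.hyps in auto)
    from LIMSEQ_D[OF this \<open>e > 0\<close>] obtain N where "(\<integral>x. \<bar>f x - s N x\<bar> \<partial>lborel) < e" by auto
    then show "\<exists>g. integrable lborel g \<and> L1_continuous g \<and> (\<integral>x. \<bar>f x - g x\<bar> \<partial>lborel) < e"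
      using lim by (intro exI[of _ "s N"]) auto
  qed
qed

section \<open>Test functions and the fundamental lemma of the calculus of variations\<close>

lemma test_functionsI:
  fixes K :: "'a::euclidean_space set"
  assumes "\<And>k. C_k k \<phi>" "compact K" "K \<subseteq> \<Omega>" "\<And>x. x \<notin> K \<Longrightarrow> \<phi> x = 0"
  shows "\<phi> \<in> test_functions \<Omega>"
proof -
  have sub: "closure {x. \<phi> x \<noteq> 0} \<subseteq> K"
    by (rule closure_minimal) (use assms in \<open>auto intro: compact_imp_closed\<close>)
  have "compact (closure {x. \<phi> x \<noteq> 0})"
    using bounded_subset[OF compact_imp_bounded[OF assms(2)] sub]
    by (simp only: compact_eq_bounded_closed closed_closure simp_thms)
  then show ?thesis using assms(1,3) sub unfolding test_functions_def by blast
qed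

text \<open>As m grows these functions tend to the indicator of the open box, because
  \<open>1 - box_bump a b x\<close> is in [0, 1) inside the box and equals 1 outside. Indicators of
  boxes thus become bounded limits of test functions without any mollification.\<close>

lemma box_bump_test_function:
  assumes "cbox a b \<subseteq> \<Omega>"
  shows "(\<lambda>x. 1 - (1 - box_bump a b x) ^ m) \<in> test_functions \<Omega>"
proof (rule test_functionsI[OF _ compact_cbox assms])
  show "C_k k (\<lambda>x. 1 - (1 - box_bump a b x) ^ m)" for k
  proof -
    have neg: "bounded_linear (\<lambda>y::real. - y)" by (intro bounded_linear_minus bounded_linear_ident)
    have "C_k k (\<lambda>x. 1 + - ((1 + - box_bump a b x) ^ m))"
      by (intro C_k_add C_k_const C_k_power C_k_linear_image[OF neg] C_k_box_bump)
    then show ?thesis by simp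
  qed
  fix x assume "x \<notin> cbox a b"
  then have "box_bump a b x = 0" using box_subset_cbox[of a b] box_bump_bounds(3)[of a b x] by blast
  then show "1 - (1 - box_bump a b x) ^ m = 0" by simp
qed

text \<open>The positive and the negative part of f are densities of two finite measures. They agree
  on boxes, an intersection-stable generator of the Borel sets, and hence everywhere.\<close>

lemma AE_zero_if_box_integrals_zero:
  fixes f :: "'a::euclidean_space \<Rightarrow> real"
  assumes f: "integrable lborel f" and zero: "\<And>a b. (\<integral>x. f x * indicator (box a b) x \<partial>lborel) = 0"
  shows "AE x in lborel. f x = 0"
proof -
  have fm[measurable]: "f \<in> borel_measurable borel" using f by auto
  define M N where "M = density lborel (\<lambda>x. ennreal (f x))" and "N = density lborel (\<lambda>x. ennreal (- f x))"
  have M: "emeasure M A = (\<integral>\<^sup>+x. ennreal (f x * indicator A x) \<partial>lborel)"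
    and N: "emeasure N A = (\<integral>\<^sup>+x. ennreal (- (f x * indicator A x)) \<partial>lborel)" if "A \<in> sets borel" for A
    using that unfolding M_def N_def
    by (auto simp: emeasure_density intro!: nn_integral_cong split: split_indicator)
  have fi: "integrable lborel (\<lambda>x. f x * indicator A x)" if "A \<in> sets borel" for A
    using that f by (intro integrable_real_mult_indicator) auto
  have MN: "(\<integral>x. f x * indicator A x \<partial>lborel) = enn2real (emeasure M A) - enn2real (emeasure N A)" if "A \<in> sets borel" for A
    using real_lebesgue_integral_def[OF fi[OF that]] M[OF that] N[OF that] by simp
  have fin: "emeasure M A < \<infinity>" "emeasure N A < \<infinity>" if "A \<in> sets borel" for A
  proof -
    have "emeasure M A \<le> (\<integral>\<^sup>+x. ennreal (norm (f x * indicator A x)) \<partial>lborel)"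
      "emeasure N A \<le> (\<integral>\<^sup>+x. ennreal (norm (f x * indicator A x)) \<partial>lborel)"
      unfolding M[OF that] N[OF that] by (intro nn_integral_mono ennreal_leI; simp)+
    moreover have "(\<integral>\<^sup>+x. ennreal (norm (f x * indicator A x)) \<partial>lborel) < \<infinity>"
      using fi[OF that] by (simp add: integrable_iff_bounded)
    ultimately show "emeasure M A < \<infinity>" "emeasure N A < \<infinity>" by (auto intro: order.strict_trans1)
  qed
  have "M = N"
  proof (rule measure_eqI_generator_eq[where E = "range (\<lambda>(a, b). box a b)" and \<Omega> = UNIV
        and A = "\<lambda>i. box (- (real i *\<^sub>R One)) (real i *\<^sub>R One)"])
    show "Int_stable (range (\<lambda>(a, b). box a b :: 'a set))"
      by (auto simp: Int_stable_def box_Int_box)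
    show "sets M = sigma_sets UNIV (range (\<lambda>(a, b). box a b))" "sets N = sigma_sets UNIV (range (\<lambda>(a, b). box a b))"
      unfolding M_def N_def by (simp_all add: borel_eq_box)
    show "(\<Union>i. box (- (real i *\<^sub>R One)) (real i *\<^sub>R One)) = (UNIV :: 'a set)"
      using UN_box_eq_UNIV by simp
    fix X assume "X \<in> range (\<lambda>(a, b). box a b :: 'a set)"
    then obtain a b where X: "X = box a b" by auto
    have "enn2real (emeasure M X) = enn2real (emeasure N X)" using MN[of X] zero[of a b] X by simp
    then show "emeasure M X = emeasure N X"
      using fin[of X] X by (cases "emeasure M X"; cases "emeasure N X") auto
  next
    fix i show "emeasure M (box (- (real i *\<^sub>R One)) (real i *\<^sub>R One)) \<noteq> \<infinity>"
      using fin(1)[of "box (- (real i *\<^sub>R One)) (real i *\<^sub>R One)"] by auto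
  qed auto
  then have z: "(\<integral>x. f x * indicator A x \<partial>lborel) = 0" if "A \<in> sets borel" for A
    using MN[OF that] by simp
  have "AE x in lborel. f x = (\<lambda>x. 0) x"
    by (rule density_unique_real) (use f z in \<open>auto simp: set_lebesgue_integral_def mult.commute\<close>)
  then show ?thesis by simp
qed

text \<open>Open sets are exhausted by closed boxes inside them, while the local arguments run on
  open boxes; the boundary in between is null.\<close>

lemma AE_cbox_imp_box: "AE x in lborel. x \<in> cbox a b \<longrightarrow> x \<in> box a (b :: 'a::euclidean_space)"
proof -
  have "cbox a b - box a b \<in> null_sets lborel"
  proof (cases "cbox a b = {}")
    case False
    then have "\<And>i. i \<in> Basis \<Longrightarrow> a \<bullet> i \<le> b \<bullet> i" by (auto simp: box_ne_empty)
    then have "emeasure lborel (cbox a b - box a b) = 0"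
      using box_subset_cbox[of a b]
      by (subst emeasure_Diff) (auto simp: emeasure_lborel_box_eq emeasure_lborel_cbox_eq)
    then show ?thesis by (simp add: null_setsI)
  qed simp
  then have "AE x in lborel. x \<notin> cbox a b - box a b" by (rule AE_not_in)
  then show ?thesis by eventually_elim auto
qed

lemma AE_open_if_AE_cbox:
  fixes \<Omega> :: "'a::euclidean_space set"
  assumes "open \<Omega>" and ae: "\<And>a b. cbox a b \<subseteq> \<Omega> \<Longrightarrow> AE x in lborel. x \<in> cbox a b \<longrightarrow> P x"
  shows "AE x in lborel. x \<in> \<Omega> \<longrightarrow> P x"
proof -
  obtain \<D> where \<D>: "countable \<D>" "\<D> \<subseteq> Pow \<Omega>" "\<And>X. X \<in> \<D> \<Longrightarrow> \<exists>a b. X = cbox a b" "\<Union>\<D> = \<Omega>"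
    using open_countable_Union_open_cbox[OF assms(1)] by metis
  have "AE x in lborel. \<forall>X\<in>\<D>. x \<in> X \<longrightarrow> P x"
  proof (subst AE_ball_countable[OF \<D>(1)], rule ballI)
    fix X assume X: "X \<in> \<D>"
    then obtain a b where "X = cbox a b" using \<D>(3) by blast
    with X \<D>(2) show "AE x in lborel. x \<in> X \<longrightarrow> P x" using ae[of a b] by auto
  qed
  then show ?thesis by eventually_elim (use \<D>(4) in auto)
qed

text \<open>Dominated convergence along the powers of the bump function turns orthogonality to test
  functions into vanishing integrals over boxes inside \<Omega>.\<close>

theorem AE_zero_if_test_integrals_zero:
  fixes h :: "'a::euclidean_space \<Rightarrow> real"
  assumes \<Omega>: "open \<Omega>" and h: "integrable lborel h"
    and zero: "\<And>\<phi> :: 'a \<Rightarrow> real. \<phi> \<in> test_functions \<Omega> \<Longrightarrow> (\<integral>x. h x * \<phi> x \<partial>lborel) = 0"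
  shows "AE x in lborel. x \<in> \<Omega> \<longrightarrow> h x = 0"
proof -
  have [measurable]: "h \<in> borel_measurable borel" using h by auto
  have Cm: "(\<lambda>x. 1 - (1 - box_bump a b x) ^ m) \<in> borel_measurable borel" for a b :: 'a and m
  proof -
    have "continuous_on UNIV (box_bump a b)" using C_k_box_bump[of 0 a b] by simp
    then have [measurable]: "box_bump a b \<in> borel_measurable borel" by (rule borel_measurable_continuous_onI)
    show ?thesis by measurable
  qed
  have box0: "(\<integral>x. h x * indicator (box a b) x \<partial>lborel) = 0" if sub: "cbox a b \<subseteq> \<Omega>" for a b
  proof -
    define B where "B m x = 1 - (1 - box_bump a b x) ^ m" for m x
    have [measurable]: "B m \<in> borel_measurable borel" for m unfolding B_def by (rule Cm)
    have B1: "\<bar>B m x\<bar> \<le> 1" for m x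
    proof -
      have "0 \<le> (1 - box_bump a b x) ^ m" "(1 - box_bump a b x) ^ m \<le> 1"
        using box_bump_bounds(1,2)[of a b x] by (auto intro!: power_le_one)
      then show ?thesis by (auto simp: B_def)
    qed
    have lim: "(\<lambda>m. B m x) \<longlonglongrightarrow> indicator (box a b) x" for x
    proof (cases "x \<in> box a b")
      case True
      then have "\<bar>1 - box_bump a b x\<bar> < 1"
        using box_bump_bounds[of a b x] by (auto simp: less_le)
      then have "(\<lambda>m. (1 - box_bump a b x) ^ m) \<longlonglongrightarrow> 0"
        using LIMSEQ_power_zero[of "1 - box_bump a b x"] by simp
      from tendsto_diff[OF tendsto_const this, of 1] True show ?thesis by (simp add: B_def)
    next
      case False
      then show ?thesis using box_bump_bounds(3)[of a b x] by (simp add: B_def)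
    qed
    have "(\<lambda>m. \<integral>x. h x * B m x \<partial>lborel) \<longlonglongrightarrow> (\<integral>x. h x * indicator (box a b) x \<partial>lborel)"
    proof (rule integral_dominated_convergence[where w = "\<lambda>x. \<bar>h x\<bar>"])
      show "AE x in lborel. (\<lambda>m. h x * B m x) \<longlonglongrightarrow> h x * indicator (box a b) x"
        by (intro AE_I2 tendsto_mult tendsto_const lim)
      show "AE x in lborel. norm (h x * B m x) \<le> \<bar>h x\<bar>" for m
        using mult_left_mono[OF B1, of "\<bar>h _\<bar>"] by (intro AE_I2) (simp add: abs_mult)
    qed (use h in auto)
    moreover have "(\<integral>x. h x * B m x \<partial>lborel) = 0" for m
      unfolding B_def by (rule zero[OF box_bump_test_function[OF sub]])
    ultimately show ?thesis by (simp add: LIMSEQ_const_iff)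
  qed
  have ae: "AE x in lborel. x \<in> cbox a b \<longrightarrow> h x = 0" if sub: "cbox a b \<subseteq> \<Omega>" for a b
  proof -
    have "AE x in lborel. h x * indicator (box a b) x = 0"
    proof (rule AE_zero_if_box_integrals_zero)
      show "integrable lborel (\<lambda>x. h x * indicator (box a b) x)"
        using h by (intro integrable_real_mult_indicator) auto
      fix c d
      \<comment> \<open>The corners of the intersection. Cutting h off to \<open>box a b\<close>
        reduces a test against an arbitrary box to one against a box whose closure lies in
        \<Omega>.\<close>
      define p q :: 'a where "p = (\<Sum>i\<in>Basis. max (a \<bullet> i) (c \<bullet> i) *\<^sub>R i)" and "q = (\<Sum>i\<in>Basis. min (b \<bullet> i) (d \<bullet> i) *\<^sub>R i)"
      have eq: "box a b \<inter> box c d = box p q" by (simp add: box_Int_box p_def q_def)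
      have "cbox p q \<subseteq> cbox a b" by (auto simp: mem_box p_def q_def)
      with sub have "(\<integral>x. h x * indicator (box p q) x \<partial>lborel) = 0" by (intro box0) auto
      then show "(\<integral>x. h x * indicator (box a b) x * indicator (box c d) x \<partial>lborel) = 0"
        by (simp add: eq[symmetric] indicator_inter_arith mult.assoc)
    qed
    with AE_cbox_imp_box[of a b] show ?thesis by eventually_elim (auto simp: indicator_def)
  qed
  then show ?thesis by (rule AE_open_if_AE_cbox[OF \<Omega>])
qed

section \<open>Weak derivatives and difference quotients\<close>

lemma test_function_basic:
  fixes \<phi> :: "'a::euclidean_space \<Rightarrow> real"
  assumes "\<phi> \<in> test_functions \<Omega>"
  shows test_function_continuous: "continuous_on UNIV \<phi>"
    and test_function_measurable: "\<phi> \<in> borel_measurable borel"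
    and test_function_bounded: "\<exists>B. \<forall>x. \<bar>\<phi> x\<bar> \<le> B"
    and test_function_support: "\<phi> x \<noteq> 0 \<Longrightarrow> x \<in> \<Omega>"
    and test_function_has_derivative: "(\<phi> has_derivative frechet_derivative \<phi> (at x)) (at x)"
proof -
  let ?S = "closure {x. \<phi> x \<noteq> 0}"
  have C: "C_k k \<phi>" for k
    using assms by (auto simp: test_functions_def)
  have S: "compact ?S" "?S \<subseteq> \<Omega>"
    using assms by (auto simp: test_functions_def)
  show c: "continuous_on UNIV \<phi>" using C[of 0] by simp
  then show "\<phi> \<in> borel_measurable borel" by (rule borel_measurable_continuous_onI)
  have out: "x \<in> ?S" if "\<phi> x \<noteq> 0" for x using that closure_subset[of "{x. \<phi> x \<noteq> 0}"] by blast
  have "compact (\<phi> ` ?S)" using S c by (intro compact_continuous_image) (auto intro: continuous_on_subset)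
  from compact_imp_bounded[OF this] obtain B where B: "\<And>x. x \<in> ?S \<Longrightarrow> \<bar>\<phi> x\<bar> \<le> B"
    unfolding bounded_iff by auto
  have "\<bar>\<phi> x\<bar> \<le> max B 0" for x using B[of x] out[of x] by (cases "\<phi> x = 0") auto
  then show "\<exists>B. \<forall>x. \<bar>\<phi> x\<bar> \<le> B" by blast
  show "\<phi> x \<noteq> 0 \<Longrightarrow> x \<in> \<Omega>" using out[of x] S(2) by blast
  show "(\<phi> has_derivative frechet_derivative \<phi> (at x)) (at x)" using C_k_SucD(1)[OF C[of "Suc 0"]] .
qed

lemma test_function_derivative:
  fixes \<phi> :: "'a::euclidean_space \<Rightarrow> real"
  assumes "\<phi> \<in> test_functions \<Omega>"
  shows "(\<lambda>x. frechet_derivative \<phi> (at x) v) \<in> test_functions \<Omega>"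
proof -
  let ?S = "closure {x. \<phi> x \<noteq> 0}"
  have C: "C_k k \<phi>" for k
    using assms by (auto simp: test_functions_def)
  have S: "compact ?S" "?S \<subseteq> \<Omega>"
    using assms by (auto simp: test_functions_def)
  have "frechet_derivative \<phi> (at x) v = 0" if "x \<notin> ?S" for x
  proof -
    have "((\<lambda>x. 0) has_derivative (\<lambda>v. 0)) (at x)" by simp
    then have "(\<phi> has_derivative (\<lambda>v. 0)) (at x)"
    proof (rule has_derivative_transform_within_open[where s = "- ?S"])
      fix y assume "y \<in> - ?S"
      then have "\<phi> y = 0" using closure_subset[of "{x. \<phi> x \<noteq> 0}"] by blast
      then show "0 = \<phi> y" by (rule sym)
    qed (use that in \<open>simp_all add: open_Compl\<close>)
    from fun_cong[OF frechet_derivative_at[OF this], of v] show ?thesis by (rule sym)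
  qed
  then show ?thesis using C_k_SucD(2)[OF C] S by (intro test_functionsI[of _ ?S])
qed

lemma test_function_translate:
  fixes \<phi> :: "'a::euclidean_space \<Rightarrow> real"
  assumes "\<phi> \<in> test_functions U" and "\<And>x. x \<in> U \<Longrightarrow> x + c \<in> \<Omega>"
  shows "(\<lambda>x. \<phi> (x - c)) \<in> test_functions \<Omega>"
    and "frechet_derivative (\<lambda>x. \<phi> (x - c)) (at x) = frechet_derivative \<phi> (at (x - c))"
proof -
  let ?S = "closure {x. \<phi> x \<noteq> 0}"
  have C: "C_k k \<phi>" for k
    using assms by (auto simp: test_functions_def)
  have S: "compact ?S" "?S \<subseteq> U"
    using assms by (auto simp: test_functions_def)
  have K: "compact ((\<lambda>x. c + x) ` ?S)" by (intro compact_translation S)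
  show "(\<lambda>x. \<phi> (x - c)) \<in> test_functions \<Omega>"
  proof (rule test_functionsI[OF _ K])
    show "C_k k (\<lambda>x. \<phi> (x - c))" for k
      using C_k_compose_affine[OF bounded_linear_ident C[of k], of "- c"] by simp
    show "(\<lambda>x. c + x) ` ?S \<subseteq> \<Omega>"
      using S(2) assms(2) by (auto simp: add.commute)
    fix x assume "x \<notin> (\<lambda>x. c + x) ` ?S"
    moreover have "x = c + (x - c)" by simp
    ultimately have "x - c \<notin> ?S" by blast
    then show "\<phi> (x - c) = 0" using closure_subset[of "{x. \<phi> x \<noteq> 0}"] by blast
  qed
  have "((\<lambda>x. x - c) has_derivative (\<lambda>v. v)) (at x)" by (auto intro!: derivative_eq_intros)
  from has_derivative_compose[OF this C_k_SucD(1)[OF C[of "Suc 0"]]]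
  show "frechet_derivative (\<lambda>x. \<phi> (x - c)) (at x) = frechet_derivative \<phi> (at (x - c))"
    by (rule frechet_derivative_at[symmetric])
qed

text \<open>The path runs in direction -v because Fubini's theorem will move a shift of a function
  by s v onto the test function, where it appears with the opposite sign.\<close>

lemma test_function_FTC:
  fixes \<phi> :: "'a::euclidean_space \<Rightarrow> real"
  assumes \<phi>: "\<phi> \<in> test_functions \<Omega>" and "0 \<le> T"
  shows "(\<integral>s. indicator {0..T} s * frechet_derivative \<phi> (at (y - s *\<^sub>R v)) v \<partial>lborel) = \<phi> y - \<phi> (y - T *\<^sub>R v)"
proof -
  have d: "((\<lambda>s. - \<phi> (y - s *\<^sub>R v)) has_vector_derivative frechet_derivative \<phi> (at (y - s *\<^sub>R v)) v) (at s within A)" for s A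
  proof -
    have "((\<lambda>s. y - s *\<^sub>R v) has_derivative (\<lambda>h. - (h *\<^sub>R v))) (at s within A)"
      by (auto intro!: derivative_eq_intros)
    from has_derivative_minus[OF has_derivative_compose[OF this test_function_has_derivative[OF \<phi>]]]
    show ?thesis
      using has_derivative_linear[OF test_function_has_derivative[OF \<phi>, of "y - s *\<^sub>R v"]]
      by (simp add: has_vector_derivative_def linear_neg linear_scale)
  qed
  have c: "continuous_on {0..T} (\<lambda>s. frechet_derivative \<phi> (at (y - s *\<^sub>R v)) v)"
    by (rule continuous_on_compose2[OF test_function_continuous[OF test_function_derivative[OF \<phi>, of v]], of "{0..T}" "\<lambda>s. y - s *\<^sub>R v"])
      (auto intro!: continuous_intros)
  from integral_FTC_atLeastAtMost[OF assms(2) d c] show ?thesis by simp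
qed

text \<open>Integrability is required on the whole space and for the Borel measure, so that
  translations and product integrals need no restriction to \<Omega>; the domain only selects the
  test functions.\<close>

definition weak_deriv ::
  "'a::euclidean_space set \<Rightarrow> 'a \<Rightarrow> ('a \<Rightarrow> real) \<Rightarrow> ('a \<Rightarrow> real) \<Rightarrow> bool" where
  "weak_deriv \<Omega> v f h \<longleftrightarrow> integrable lborel f \<and> integrable lborel h \<and>
     (\<forall>\<phi>\<in>test_functions \<Omega>. (\<integral>x. f x * frechet_derivative \<phi> (at x) v \<partial>lborel) = - (\<integral>x. h x * \<phi> x \<partial>lborel))"

text \<open>By translation invariance the inner integral of the absolute value is the same number
  for every s in [0, T], so it is integrable in s. The direction v = 0 covers the product of h with
  a cut-off in s.\<close>

lemma integrable_shear:
  fixes h :: "'a::euclidean_space \<Rightarrow> real"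
  assumes h: "integrable lborel h"
  shows "integrable (lborel \<Otimes>\<^sub>M lborel) (\<lambda>(s, x). indicator {0..T} s * h (x + s *\<^sub>R v))"
proof -
  have [measurable]: "h \<in> borel_measurable borel" using h by auto
  show ?thesis
  proof (rule lborel_pair.Fubini_integrable)
    have "(\<integral>x. norm (case (s, x) of (s, x) \<Rightarrow> indicator {0..T} s * h (x + s *\<^sub>R v)) \<partial>lborel)
        = indicator {0..T} s * (\<integral>x. \<bar>h x\<bar> \<partial>lborel)" for s
      by (simp add: abs_mult integral_translation[of "\<lambda>x. \<bar>h x\<bar>"])
    then show "integrable lborel (\<lambda>s. \<integral>x. norm (case (s, x) of (s, x) \<Rightarrow> indicator {0..T} s * h (x + s *\<^sub>R v)) \<partial>lborel)"
      by (simp add: integrable_indicator_iff emeasure_lborel_Icc_eq)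
    show "AE s in lborel. integrable lborel (\<lambda>x. case (s, x) of (s, x) \<Rightarrow> indicator {0..T} s * h (x + s *\<^sub>R v))"
      using integrable_translation[OF h] by auto
  qed measurable
qed

lemma integrable_bounded_mult:
  fixes h k :: "'a \<Rightarrow> real"
  assumes "integrable M h" "k \<in> borel_measurable M" "\<And>x. \<bar>k x\<bar> \<le> B"
  shows "integrable M (\<lambda>x. h x * k x)"
proof (rule Bochner_Integration.integrable_bound[where f = "\<lambda>x. B * h x"])
  show "AE x in M. norm (h x * k x) \<le> norm (B * h x)"
  proof (rule AE_I2)
    fix x
    have "0 \<le> B" using assms(3)[of x] by linarith
    then show "norm (h x * k x) \<le> norm (B * h x)"
      using mult_left_mono[OF assms(3)[of x], of "\<bar>h x\<bar>"] by (simp add: abs_mult mult.commute)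
  qed
qed (use assms in auto)

text \<open>Tested against \<phi>, the integral on the right becomes f tested against the
  derivatives of the translates of \<phi> by s v; integrated in s, these add up to a difference of
  two values of \<phi>, and a shift brings that difference back to f. The hypothesis
  \<open>sub\<close> keeps all these translates supported in \<Omega>.\<close>

theorem weak_deriv_increment:
  fixes f h :: "'a::euclidean_space \<Rightarrow> real"
  assumes wd: "weak_deriv \<Omega> v f h" and "0 \<le> T" and U: "open U"
    and sub: "\<And>x s. x \<in> U \<Longrightarrow> 0 \<le> s \<Longrightarrow> s \<le> T \<Longrightarrow> x + s *\<^sub>R v \<in> \<Omega>"
  shows "AE x in lborel. x \<in> U \<longrightarrow> f (x + T *\<^sub>R v) - f x = (\<integral>s. indicator {0..T} s * h (x + s *\<^sub>R v) \<partial>lborel)"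
proof -
  have f: "integrable lborel f" and h: "integrable lborel h" using wd by (auto simp: weak_deriv_def)
  have [measurable]: "f \<in> borel_measurable borel" "h \<in> borel_measurable borel" using f h by auto
  define H where "H x = (\<integral>s. indicator {0..T} s * h (x + s *\<^sub>R v) \<partial>lborel)" for x
  have Hi: "integrable lborel H"
    unfolding H_def using lborel_pair.integrable_snd[OF integrable_shear[OF h, of T v]] .
  have "AE x in lborel. x \<in> U \<longrightarrow> f (x + T *\<^sub>R v) - f x - H x = 0"
  proof (rule AE_zero_if_test_integrals_zero[OF U])
    show "integrable lborel (\<lambda>x. f (x + T *\<^sub>R v) - f x - H x)"
      by (intro Bochner_Integration.integrable_diff integrable_translation f Hi)
    fix \<phi> :: "'a \<Rightarrow> real" assume \<phi>: "\<phi> \<in> test_functions U"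
    define \<psi> where "\<psi> x = frechet_derivative \<phi> (at x) v" for x
    have \<psi>: "\<psi> \<in> test_functions U" unfolding \<psi>_def by (rule test_function_derivative[OF \<phi>])
    obtain B B' where B: "\<And>x. \<bar>\<phi> x\<bar> \<le> B" and B': "\<And>x. \<bar>\<psi> x\<bar> \<le> B'"
      using test_function_bounded[OF \<phi>] test_function_bounded[OF \<psi>] by blast
    note [measurable] = test_function_measurable[OF \<phi>] test_function_measurable[OF \<psi>]
    have i1: "integrable (lborel \<Otimes>\<^sub>M lborel) (\<lambda>(s, x). indicator {0..T} s * h (x + s *\<^sub>R v) * \<phi> x)"
      using integrable_bounded_mult[OF integrable_shear[OF h, of T v], of "\<lambda>(s, x). \<phi> x" B] B
      by (simp add: case_prod_beta')
    \<comment> \<open>Taking the direction 0 in \<open>integrable_shear\<close> leaves f unshifted;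
      the shift in s sits in the bounded factor \<psi>.\<close>
    have i2: "integrable (lborel \<Otimes>\<^sub>M lborel) (\<lambda>(s, y). indicator {0..T} s * f y * \<psi> (y - s *\<^sub>R v))"
      using integrable_bounded_mult[OF integrable_shear[OF f, of T 0], of "\<lambda>(s, y). \<psi> (y - s *\<^sub>R v)" B'] B'
      by (simp add: case_prod_beta')
    have "(\<integral>x. H x * \<phi> x \<partial>lborel) = (\<integral>x. (\<integral>s. indicator {0..T} s * h (x + s *\<^sub>R v) * \<phi> x \<partial>lborel) \<partial>lborel)"
      by (simp add: H_def)
    also have "\<dots> = (\<integral>s. (\<integral>x. indicator {0..T} s * h (x + s *\<^sub>R v) * \<phi> x \<partial>lborel) \<partial>lborel)"
      by (rule lborel_pair.Fubini_integral[OF i1])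
    also have "\<dots> = (\<integral>s. (\<integral>y. - (indicator {0..T} s * f y * \<psi> (y - s *\<^sub>R v)) \<partial>lborel) \<partial>lborel)"
    proof (rule Bochner_Integration.integral_cong[OF refl])
      fix s :: real
      show "(\<integral>x. indicator {0..T} s * h (x + s *\<^sub>R v) * \<phi> x \<partial>lborel) = (\<integral>y. - (indicator {0..T} s * f y * \<psi> (y - s *\<^sub>R v)) \<partial>lborel)"
      proof (cases "s \<in> {0..T}")
        case True
        have tr: "(\<lambda>x. \<phi> (x - s *\<^sub>R v)) \<in> test_functions \<Omega>"
          "frechet_derivative (\<lambda>x. \<phi> (x - s *\<^sub>R v)) (at x) v = \<psi> (x - s *\<^sub>R v)" for x
          using test_function_translate[OF \<phi>, of "s *\<^sub>R v" \<Omega>] sub[of _ s] True by (auto simp: \<psi>_def)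
        have "(\<integral>x. h (x + s *\<^sub>R v) * \<phi> x \<partial>lborel) = (\<integral>x. h x * \<phi> (x - s *\<^sub>R v) \<partial>lborel)"
          using integral_translation[of "\<lambda>x. h x * \<phi> (x - s *\<^sub>R v)" "s *\<^sub>R v"] by simp
        also have "\<dots> = - (\<integral>x. f x * \<psi> (x - s *\<^sub>R v) \<partial>lborel)"
          using wd tr unfolding weak_deriv_def by fastforce
        finally show ?thesis using True by simp
      qed simp
    qed
    also have "\<dots> = - (\<integral>s. (\<integral>y. indicator {0..T} s * f y * \<psi> (y - s *\<^sub>R v) \<partial>lborel) \<partial>lborel)" by simp
    also have "(\<integral>s. (\<integral>y. indicator {0..T} s * f y * \<psi> (y - s *\<^sub>R v) \<partial>lborel) \<partial>lborel)
        = (\<integral>y. (\<integral>s. indicator {0..T} s * f y * \<psi> (y - s *\<^sub>R v) \<partial>lborel) \<partial>lborel)"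
      by (rule lborel_pair.Fubini_integral[OF i2, symmetric])
    also have "\<dots> = (\<integral>y. f y * (\<phi> y - \<phi> (y - T *\<^sub>R v)) \<partial>lborel)"
    proof (rule Bochner_Integration.integral_cong[OF refl])
      fix y
      have "(\<integral>s. indicator {0..T} s * f y * \<psi> (y - s *\<^sub>R v) \<partial>lborel) = (\<integral>s. f y * (indicator {0..T} s * \<psi> (y - s *\<^sub>R v)) \<partial>lborel)"
        by (intro Bochner_Integration.integral_cong) auto
      then show "(\<integral>s. indicator {0..T} s * f y * \<psi> (y - s *\<^sub>R v) \<partial>lborel) = f y * (\<phi> y - \<phi> (y - T *\<^sub>R v))"
        using test_function_FTC[OF \<phi> assms(2), of y v] by (simp add: \<psi>_def)
    qed
    finally have eq: "(\<integral>x. H x * \<phi> x \<partial>lborel) = - (\<integral>y. f y * (\<phi> y - \<phi> (y - T *\<^sub>R v)) \<partial>lborel)" .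
    have j1: "integrable lborel (\<lambda>x. f x * \<phi> x)" "integrable lborel (\<lambda>x. H x * \<phi> x)"
        "integrable lborel (\<lambda>x. f x * \<phi> (x - T *\<^sub>R v))"
      using B f Hi by (auto intro!: integrable_bounded_mult)
    have j2: "integrable lborel (\<lambda>x. f (x + T *\<^sub>R v) * \<phi> x)"
      using integrable_translation[OF j1(3), of "T *\<^sub>R v"] by simp
    have "(\<integral>x. f (x + T *\<^sub>R v) * \<phi> x \<partial>lborel) = (\<integral>x. f x * \<phi> (x - T *\<^sub>R v) \<partial>lborel)"
      using integral_translation[of "\<lambda>x. f x * \<phi> (x - T *\<^sub>R v)" "T *\<^sub>R v"] by simp
    with eq j1 j2 show "(\<integral>x. (f (x + T *\<^sub>R v) - f x - H x) * \<phi> x \<partial>lborel) = 0"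
      by (simp add: algebra_simps)
  qed
  then show ?thesis unfolding H_def by eventually_elim auto
qed

section \<open>Difference quotients converging in mean\<close>

definition diff_quot :: "'a::real_vector \<Rightarrow> nat \<Rightarrow> ('a \<Rightarrow> 'b::real_vector) \<Rightarrow> 'a \<Rightarrow> 'b" where
  "diff_quot v n f x = 2 ^ n *\<^sub>R (f (x + (1 / 2) ^ n *\<^sub>R v) - f x)"

text \<open>The steps \<open>2 ^ - n\<close> are summable, so that convergence of the difference quotients
  in mean forces \<open>f (x + 2 ^ - n v) \<longlonglongrightarrow> f x\<close> almost everywhere.\<close>

definition L1_deriv ::
  "'a::euclidean_space set \<Rightarrow> 'a \<Rightarrow> ('a \<Rightarrow> 'b::euclidean_space) \<Rightarrow> ('a \<Rightarrow> 'b) \<Rightarrow> bool" where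
  "L1_deriv \<Omega> v f h \<longleftrightarrow> integrable lborel f \<and> integrable lborel h \<and>
     (\<forall>K. compact K \<and> K \<subseteq> \<Omega> \<longrightarrow>
       (\<lambda>n. \<integral>x. indicator K x * norm (diff_quot v n f x - h x) \<partial>lborel) \<longlonglongrightarrow> 0)"

lemma integrable_diff_quot:
  fixes f :: "'a::euclidean_space \<Rightarrow> 'b::euclidean_space"
  assumes "integrable lborel f"
  shows "integrable lborel (diff_quot v n f)"
  unfolding diff_quot_def
  by (intro integrable_scaleR_right Bochner_Integration.integrable_diff integrable_translation assms)

lemma half_powers_vanish: "(\<lambda>n. (1 / 2 :: real) ^ n *\<^sub>R (v :: 'a::real_normed_vector)) \<longlonglongrightarrow> 0"
proof -
  have "(\<lambda>n. (1 / 2 :: real) ^ n) \<longlonglongrightarrow> 0" by (rule LIMSEQ_realpow_zero) auto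
  from tendsto_scaleR[OF this tendsto_const[of v]] show ?thesis by simp
qed

text \<open>Half of the distance e goes into the neighbourhood and half into the shift, so that
  their sum stays within \<Omega>.\<close>

lemma thickening:
  fixes K \<Omega> :: "'a::euclidean_space set"
  assumes "compact K" "open \<Omega>" "K \<subseteq> \<Omega>"
  obtains U e where "open U" "K \<subseteq> U" "U \<subseteq> \<Omega>" "0 < e" "\<And>x w. x \<in> U \<Longrightarrow> norm w < e \<Longrightarrow> x + w \<in> \<Omega>"
proof -
  obtain e where e: "0 < e" "(\<Union>x\<in>K. ball x e) \<subseteq> \<Omega>"
    using compact_subset_open_imp_ball_epsilon_subset[OF assms] .
  show ?thesis
  proof (rule that[of "\<Union>x\<in>K. ball x (e / 2)" "e / 2"])
    show "K \<subseteq> (\<Union>x\<in>K. ball x (e / 2))" using e(1) by auto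
    show "(\<Union>x\<in>K. ball x (e / 2)) \<subseteq> \<Omega>" using e by (force simp: subset_iff)
    fix x w :: 'a assume "x \<in> (\<Union>x\<in>K. ball x (e / 2))" and w: "norm w < e / 2"
    then obtain y where y: "y \<in> K" "dist y x < e / 2" by auto
    have "dist y (x + w) \<le> dist y x + norm w" using dist_triangle[of y "x + w" x] by (simp add: dist_norm)
    then have "x + w \<in> ball y e" using y w by simp
    then show "x + w \<in> \<Omega>" using e(2) y(1) by blast
  qed (use e in auto)
qed

lemma L1_translation_bound:
  fixes h :: "'a::euclidean_space \<Rightarrow> real"
  assumes h: "integrable lborel h" and "0 < e"
  obtains d where "0 < d" "\<And>w. norm w < d \<Longrightarrow> (\<integral>x. \<bar>h (x + w) - h x\<bar> \<partial>lborel) < e"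
proof -
  let ?w = "\<lambda>w. \<integral>x. \<bar>h (x + w) - h x\<bar> \<partial>lborel"
  have "continuous (at 0) ?w"
    using integrable_imp_L1_continuous[OF h]
    by (intro continuous_within_sequentiallyI) (simp add: L1_continuous_def)
  then have "(?w \<longlongrightarrow> 0) (at 0)" by (simp add: continuous_within)
  from tendstoD[OF this assms(2)] obtain d where d: "0 < d" "\<And>w. w \<noteq> 0 \<Longrightarrow> dist w 0 < d \<Longrightarrow> dist (?w w) 0 < e"
    unfolding eventually_at by blast
  show ?thesis
  proof (rule that[OF d(1)])
    fix w :: 'a assume "norm w < d"
    then show "?w w < e" using d(2)[of w] assms(2) by (cases "w = 0") auto
  qed
qed

text \<open>This is Minkowski's integral inequality for the family of shifts of h: the mean norm of
  an integral over s is at most the integral of the mean norms. The average is not normalised, hence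
  the factor T on both sides.\<close>

lemma L1_average_bound:
  fixes h :: "'a::euclidean_space \<Rightarrow> real"
  assumes h: "integrable lborel h" and T: "0 < T"
    and e: "\<And>s. 0 \<le> s \<Longrightarrow> s \<le> T \<Longrightarrow> (\<integral>x. \<bar>h (x + s *\<^sub>R v) - h x\<bar> \<partial>lborel) \<le> e"
  shows "(\<integral>x. \<bar>(\<integral>s. indicator {0..T} s * h (x + s *\<^sub>R v) \<partial>lborel) - T * h x\<bar> \<partial>lborel) \<le> T * e"
proof -
  have [measurable]: "h \<in> borel_measurable borel" using h by auto
  define k where "k s x = indicator {0..T} s * (h (x + s *\<^sub>R v) - h x)" for s x
  have k: "integrable (lborel \<Otimes>\<^sub>M lborel) (\<lambda>(s, x). k s x)"
    using Bochner_Integration.integrable_diff[OF integrable_shear[OF h, of T v] integrable_shear[OF h, of T 0]]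
    by (simp add: k_def case_prod_beta' algebra_simps)
  then have ka: "integrable (lborel \<Otimes>\<^sub>M lborel) (\<lambda>(s, x). \<bar>k s x\<bar>)"
    using integrable_abs[OF k] by (simp add: case_prod_beta')
  have eq: "AE x in lborel. \<bar>(\<integral>s. indicator {0..T} s * h (x + s *\<^sub>R v) \<partial>lborel) - T * h x\<bar> \<le> (\<integral>s. \<bar>k s x\<bar> \<partial>lborel)"
    using lborel_pair.AE_integrable_snd[OF integrable_shear[OF h, of T v]]
  proof eventually_elim
    case (elim x)
    have c: "integrable lborel (\<lambda>s. indicator {0..T} s * h x :: real)"
      by (intro integrable_mult_left) (simp add: integrable_indicator_iff emeasure_lborel_Icc_eq)
    have "(\<integral>s. k s x \<partial>lborel) = (\<integral>s. indicator {0..T} s * h (x + s *\<^sub>R v) \<partial>lborel) - (\<integral>s. indicator {0..T} s * h x \<partial>lborel)"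
      unfolding k_def right_diff_distrib using elim c by (rule Bochner_Integration.integral_diff)
    moreover have "(\<integral>s. indicator {0..T} s * h x \<partial>lborel) = T * h x" using T by simp
    moreover have "\<bar>\<integral>s. k s x \<partial>lborel\<bar> \<le> (\<integral>s. \<bar>k s x\<bar> \<partial>lborel)" by (rule integral_abs_bound)
    ultimately show ?case using T by simp
  qed
  have "(\<integral>x. \<bar>(\<integral>s. indicator {0..T} s * h (x + s *\<^sub>R v) \<partial>lborel) - T * h x\<bar> \<partial>lborel)
      \<le> (\<integral>x. (\<integral>s. \<bar>k s x\<bar> \<partial>lborel) \<partial>lborel)"
  proof (rule integral_mono_AE[OF _ _ eq])
    show "integrable lborel (\<lambda>x. \<bar>(\<integral>s. indicator {0..T} s * h (x + s *\<^sub>R v) \<partial>lborel) - T * h x\<bar>)"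
      by (intro integrable_abs Bochner_Integration.integrable_diff integrable_mult_right h
          lborel_pair.integrable_snd[OF integrable_shear[OF h, of T v]])
    show "integrable lborel (\<lambda>x. \<integral>s. \<bar>k s x\<bar> \<partial>lborel)" by (rule lborel_pair.integrable_snd[OF ka])
  qed
  also have "\<dots> = (\<integral>s. (\<integral>x. \<bar>k s x\<bar> \<partial>lborel) \<partial>lborel)"
    by (rule lborel_pair.Fubini_integral[OF ka])
  also have "\<dots> \<le> (\<integral>s. indicator {0..T} s * e \<partial>lborel)"
  proof (rule integral_mono)
    show "integrable lborel (\<lambda>s. \<integral>x. \<bar>k s x\<bar> \<partial>lborel)" by (rule lborel_pair.integrable_fst[OF ka])
    show "integrable lborel (\<lambda>s. indicator {0..T} s * e)"
      by (intro integrable_mult_left) (simp add: integrable_indicator_iff emeasure_lborel_Icc_eq)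
    fix s show "(\<integral>x. \<bar>k s x\<bar> \<partial>lborel) \<le> indicator {0..T} s * e"
      using e[of s] by (cases "s \<in> {0..T}") (auto simp: k_def)
  qed
  also have "\<dots> = T * e" using T by simp
  finally show ?thesis .
qed

lemma L1_derivI:
  fixes f h :: "'a::euclidean_space \<Rightarrow> 'b::euclidean_space"
  assumes f: "integrable lborel f" and h: "integrable lborel h"
    and le: "\<And>K e. compact K \<Longrightarrow> K \<subseteq> \<Omega> \<Longrightarrow> 0 < e \<Longrightarrow>
      \<forall>\<^sub>F n in sequentially. (\<integral>x. indicator K x * norm (diff_quot v n f x - h x) \<partial>lborel) < e"
  shows "L1_deriv \<Omega> v f h"
  unfolding L1_deriv_def
proof (intro conjI f h allI impI)
  fix K assume K: "compact K \<and> K \<subseteq> \<Omega>"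
  show "(\<lambda>n. \<integral>x. indicator K x * norm (diff_quot v n f x - h x) \<partial>lborel) \<longlonglongrightarrow> 0"
  proof (rule tendstoI)
    fix e :: real assume "0 < e"
    moreover have "0 \<le> (\<integral>x. indicator K x * norm (diff_quot v n f x - h x) \<partial>lborel)" for n by simp
    ultimately show "\<forall>\<^sub>F n in sequentially. dist (\<integral>x. indicator K x * norm (diff_quot v n f x - h x) \<partial>lborel) 0 < e"
      using le[of K e] K by (simp add: dist_norm)
  qed
qed

text \<open>By \<open>weak_deriv_increment\<close> the difference quotient is the average of h over
  the segment from x to x + T v, and continuity of translations makes this average close to h in
  mean.\<close>

theorem weak_deriv_imp_L1_deriv:
  fixes f h :: "'a::euclidean_space \<Rightarrow> real"
  assumes wd: "weak_deriv \<Omega> v f h" and \<Omega>: "open \<Omega>"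
  shows "L1_deriv \<Omega> v f h"
proof (rule L1_derivI)
  show f: "integrable lborel f" and h: "integrable lborel h" using wd by (auto simp: weak_deriv_def)
  fix K :: "'a set" and e :: real assume K: "compact K" "K \<subseteq> \<Omega>" and e: "0 < e"
  obtain U \<delta> where U: "open U" "K \<subseteq> U" "U \<subseteq> \<Omega>" "0 < \<delta>" "\<And>x w. x \<in> U \<Longrightarrow> norm w < \<delta> \<Longrightarrow> x + w \<in> \<Omega>"
    by (rule thickening[OF K(1) \<Omega> K(2)]) blast
  obtain d where d: "0 < d" "\<And>w. norm w < d \<Longrightarrow> (\<integral>x. \<bar>h (x + w) - h x\<bar> \<partial>lborel) < e / 2"
    by (rule L1_translation_bound[OF h, of "e / 2"]) (use e in auto)
  \<comment> \<open>The radius d controls the translations of h in mean, while \<delta> keeps the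
    segment inside \<Omega>.\<close>
  have "\<forall>\<^sub>F n in sequentially. dist ((1 / 2) ^ n *\<^sub>R v) 0 < min d \<delta>"
    using tendstoD[OF half_powers_vanish[of v], of "min d \<delta>"] U d by simp
  then show "\<forall>\<^sub>F n in sequentially. (\<integral>x. indicator K x * norm (diff_quot v n f x - h x) \<partial>lborel) < e"
  proof eventually_elim
    case (elim n)
    define T :: real where "T = (1 / 2) ^ n"
    have T: "0 < T" "norm (T *\<^sub>R v) < min d \<delta>" and T2: "2 ^ n = 1 / T"
      using elim by (auto simp: T_def power_one_over)
    have sv: "norm (s *\<^sub>R v) < min d \<delta>" if "0 \<le> s" "s \<le> T" for s
    proof -
      have "norm (s *\<^sub>R v) \<le> norm (T *\<^sub>R v)" using that by (simp add: mult_right_mono)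
      with T show ?thesis by linarith
    qed
    define H where "H x = (\<integral>s. indicator {0..T} s * h (x + s *\<^sub>R v) \<partial>lborel)" for x
    have Hi: "integrable lborel (\<lambda>x. \<bar>H x - T * h x\<bar>)"
      unfolding H_def
      by (intro integrable_abs Bochner_Integration.integrable_diff integrable_mult_right h
          lborel_pair.integrable_snd[OF integrable_shear[OF h, of T v]])
    have "AE x in lborel. x \<in> U \<longrightarrow> f (x + T *\<^sub>R v) - f x = H x"
      unfolding H_def using wd
      by (rule weak_deriv_increment) (use T U sv in auto)
    then have ae: "AE x in lborel. indicator K x * norm (diff_quot v n f x - h x) \<le> (1 / T) * \<bar>H x - T * h x\<bar>"
    proof eventually_elim
      case (elim x)
      show ?case
      proof (cases "x \<in> K")
        case True
        then have "f (x + T *\<^sub>R v) - f x = H x" using elim U(2) by auto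
        then have "diff_quot v n f x - h x = (1 / T) * (H x - T * h x)"
          unfolding diff_quot_def T_def[symmetric] T2 using T by (simp add: field_simps)
        then show ?thesis using True T by (simp add: abs_mult)
      qed (use T in simp)
    qed
    have Ki: "integrable lborel (\<lambda>x. indicator K x * norm (diff_quot v n f x - h x))"
      using integrable_real_mult_indicator[of K lborel "\<lambda>x. norm (diff_quot v n f x - h x)"] K
        integrable_norm[OF Bochner_Integration.integrable_diff[OF integrable_diff_quot[OF f] h]]
      by (simp add: mult.commute borel_compact)
    have "(\<integral>x. indicator K x * norm (diff_quot v n f x - h x) \<partial>lborel) \<le> (\<integral>x. (1 / T) * \<bar>H x - T * h x\<bar> \<partial>lborel)"
      using Ki _ ae by (rule integral_mono_AE) (intro integrable_mult_right Hi)
    also have "\<dots> = (1 / T) * (\<integral>x. \<bar>H x - T * h x\<bar> \<partial>lborel)" by simp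
    also have "\<dots> \<le> (1 / T) * (T * (e / 2))"
      unfolding H_def
    proof (intro mult_left_mono L1_average_bound[OF h T(1)])
      fix s assume "0 \<le> s" "s \<le> T"
      then show "(\<integral>x. \<bar>h (x + s *\<^sub>R v) - h x\<bar> \<partial>lborel) \<le> e / 2" using d(2)[of "s *\<^sub>R v"] sv[of s] by simp
    qed (use T in simp)
    also have "\<dots> < e" using T e by simp
    finally show ?case .
  qed
qed

text \<open>The series of the \<open>a n\<close> has a finite integral, so it converges almost
  everywhere and its terms tend to zero. The whole sequence converges; no subsequence has to be
  chosen.\<close>

lemma AE_tendsto_0_if_summable:
  fixes a :: "nat \<Rightarrow> 'a \<Rightarrow> real"
  assumes int: "\<And>n. integrable M (a n)" and nonneg: "\<And>n x. 0 \<le> a n x"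
    and le: "\<And>n. (\<integral>x. a n x \<partial>M) \<le> b n" and b: "summable b"
  shows "AE x in M. (\<lambda>n. a n x) \<longlonglongrightarrow> 0"
proof -
  have [measurable]: "a n \<in> borel_measurable M" for n using int by auto
  have i0: "0 \<le> (\<integral>x. a n x \<partial>M)" for n using nonneg by simp
  have s: "summable (\<lambda>n. \<integral>x. a n x \<partial>M)"
    by (rule summable_comparison_test'[OF b, of 0]) (use i0 le in simp)
  have "(\<integral>\<^sup>+x. (\<Sum>n. ennreal (a n x)) \<partial>M) = (\<Sum>n. \<integral>\<^sup>+x. ennreal (a n x) \<partial>M)"
    by (rule nn_integral_suminf) measurable
  also have "\<dots> = (\<Sum>n. ennreal (\<integral>x. a n x \<partial>M))"
    by (intro suminf_cong nn_integral_eq_integral int) (simp add: nonneg)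
  also have "\<dots> = ennreal (\<Sum>n. \<integral>x. a n x \<partial>M)" by (rule suminf_ennreal_eq) (use i0 s in \<open>auto intro: summable_sums\<close>)
  finally have "(\<integral>\<^sup>+x. (\<Sum>n. ennreal (a n x)) \<partial>M) \<noteq> \<infinity>" by simp
  then have "AE x in M. (\<Sum>n. ennreal (a n x)) \<noteq> \<infinity>"
    by (intro nn_integral_noteq_infinite) measurable
  then show ?thesis
  proof eventually_elim
    case (elim x)
    then have "summable (\<lambda>n. a n x)"
      using summable_suminf_not_top[of "\<lambda>n. a n x"] nonneg by simp
    then show ?case by (rule summable_LIMSEQ_zero)
  qed
qed

lemma integrable_indicator_norm:
  fixes f :: "'a::euclidean_space \<Rightarrow> 'b::euclidean_space"
  assumes "integrable lborel f" "K \<in> sets borel"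
  shows "integrable lborel (\<lambda>x. indicator K x * norm (f x))"
  using integrable_real_mult_indicator[of K lborel "\<lambda>x. norm (f x)"] assms by (simp add: mult.commute)

lemma L1_deriv_AE_tendsto:
  fixes f h :: "'a::euclidean_space \<Rightarrow> 'b::euclidean_space"
  assumes d: "L1_deriv \<Omega> v f h" and K: "compact K" "K \<subseteq> \<Omega>"
  shows "AE x in lborel. x \<in> K \<longrightarrow> (\<lambda>n. f (x + (1 / 2) ^ n *\<^sub>R v)) \<longlonglongrightarrow> f x"
proof -
  have f: "integrable lborel f" and h: "integrable lborel h" using d by (auto simp: L1_deriv_def)
  note KB = borel_compact[OF K(1)]
  define I where "I n = (\<integral>x. indicator K x * norm (diff_quot v n f x - h x) \<partial>lborel)" for n
  define J where "J = (\<integral>x. indicator K x * norm (h x) \<partial>lborel)"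
  have "I \<longlonglongrightarrow> 0" using d K unfolding L1_deriv_def I_def by blast
  then obtain C where C: "\<And>n. norm (I n) \<le> C" using convergent_imp_Bseq[of I] by (auto simp: convergent_def Bseq_def)
  have Di: "integrable lborel (\<lambda>x. diff_quot v n f x - h x)" for n
    by (intro Bochner_Integration.integrable_diff integrable_diff_quot f h)
  define a where "a n x = indicator K x * norm (f (x + (1 / 2) ^ n *\<^sub>R v) - f x)" for n x
  have a: "a n x = (1 / 2) ^ n * (indicator K x * norm (diff_quot v n f x))" for n x
    by (simp add: a_def diff_quot_def power_one_over)
  have "AE x in lborel. (\<lambda>n. a n x) \<longlonglongrightarrow> 0"
  proof (rule AE_tendsto_0_if_summable)
    show "integrable lborel (a n)" for n
      unfolding a_def
      by (intro integrable_indicator_norm KB Bochner_Integration.integrable_diff integrable_translation f)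
    show "0 \<le> a n x" for n x by (simp add: a_def)
    \<comment> \<open>C + J bounds the mean over K of the difference quotients for every n; the
      increments carry in addition the step size 2^-n.\<close>
    show "summable (\<lambda>n. (1 / 2) ^ n * (C + J))" by (intro summable_mult2 summable_geometric) simp
    fix n
    have "(\<integral>x. indicator K x * norm (diff_quot v n f x) \<partial>lborel)
        \<le> (\<integral>x. indicator K x * norm (diff_quot v n f x - h x) + indicator K x * norm (h x) \<partial>lborel)"
    proof (rule integral_mono)
      show "integrable lborel (\<lambda>x. indicator K x * norm (diff_quot v n f x))"
        by (intro integrable_indicator_norm KB integrable_diff_quot f)
      show "integrable lborel (\<lambda>x. indicator K x * norm (diff_quot v n f x - h x) + indicator K x * norm (h x))"
        by (intro Bochner_Integration.integrable_add integrable_indicator_norm KB Di h)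
      fix x
      have "norm (diff_quot v n f x) \<le> norm (diff_quot v n f x - h x) + norm (h x)"
        using norm_triangle_sub[of "diff_quot v n f x" "h x"] by simp
      then show "indicator K x * norm (diff_quot v n f x) \<le> indicator K x * norm (diff_quot v n f x - h x) + indicator K x * norm (h x)"
        by (cases "x \<in> K") auto
    qed
    also have "\<dots> = I n + J"
      unfolding I_def J_def by (intro Bochner_Integration.integral_add integrable_indicator_norm KB Di h)
    also have "\<dots> \<le> C + J" using C[of n] by simp
    finally show "(\<integral>x. a n x \<partial>lborel) \<le> (1 / 2) ^ n * (C + J)" unfolding a by simp
  qed
  then show ?thesis
  proof eventually_elim
    case (elim x)
    show ?case
    proof
      assume "x \<in> K"
      then have "(\<lambda>n. norm (f (x + (1 / 2) ^ n *\<^sub>R v) - f x)) \<longlonglongrightarrow> 0" using elim by (simp add: a_def)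
      then show "(\<lambda>n. f (x + (1 / 2) ^ n *\<^sub>R v)) \<longlonglongrightarrow> f x"
        by (subst LIM_zero_iff[symmetric]) (simp only: tendsto_norm_zero_iff)
    qed
  qed
qed

section \<open>The chain rule\<close>

text \<open>Continuity is assumed for each fixed direction only. Expanding the direction in the
  finite basis turns this into a uniform operator bound on the compact ball, and convexity of the
  ball into a Lipschitz bound.\<close>

lemma derivative_bound_on_cball:
  fixes F :: "'b::euclidean_space \<Rightarrow> 'c::euclidean_space"
  assumes dF: "\<And>y. (F has_derivative F' y) (at y)" and c: "\<And>k. continuous_on UNIV (\<lambda>y. F' y k)"
  obtains M where "0 \<le> M" "\<And>y k. norm y \<le> R \<Longrightarrow> norm (F' y k) \<le> M * norm k"
    "\<And>y z. norm y \<le> R \<Longrightarrow> norm z \<le> R \<Longrightarrow> norm (F z - F y) \<le> M * norm (z - y)"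
proof -
  have "compact ((\<lambda>y. \<Sum>b\<in>Basis. norm (F' y b)) ` cball 0 R)"
    by (intro compact_continuous_image continuous_intros continuous_on_subset[OF c]) auto
  from compact_imp_bounded[OF this] obtain M0 where "\<forall>y\<in>cball 0 R. \<bar>\<Sum>b\<in>Basis. norm (F' y b)\<bar> \<le> M0"
    unfolding bounded_iff by auto
  then have M0: "\<bar>\<Sum>b\<in>Basis. norm (F' y b)\<bar> \<le> M0" if "norm y \<le> R" for y using that by simp
  define M where "M = max M0 0"
  have b: "norm (F' y k) \<le> M * norm k" if "norm y \<le> R" for y k
  proof -
    have lin: "linear (F' y)" using dF by (rule has_derivative_linear)
    have "F' y k = F' y (\<Sum>b\<in>Basis. (k \<bullet> b) *\<^sub>R b)" by (simp add: euclidean_representation)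
    also have "\<dots> = (\<Sum>b\<in>Basis. (k \<bullet> b) *\<^sub>R F' y b)" by (simp add: linear_sum[OF lin] linear_scale[OF lin])
    also have "norm \<dots> \<le> (\<Sum>b\<in>Basis. norm k * norm (F' y b))"
      by (intro sum_norm_le) (simp add: mult_right_mono Basis_le_norm)
    also have "\<dots> = norm k * (\<Sum>b\<in>Basis. norm (F' y b))" by (simp add: sum_distrib_left)
    also have "\<dots> \<le> norm k * M" using M0[OF that] by (intro mult_left_mono) (auto simp: M_def)
    finally show ?thesis by (simp add: mult.commute)
  qed
  show ?thesis
  proof (rule that[OF _ b])
    show "0 \<le> M" by (simp add: M_def)
    fix y z :: 'b assume yz: "norm y \<le> R" "norm z \<le> R"
    show "norm (F z - F y) \<le> M * norm (z - y)"
    proof (rule differentiable_bound[where S = "cball 0 R" and f' = F'])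
      show "onorm (F' x) \<le> M" if "x \<in> cball 0 R" for x
        using that b by (intro onorm_bound) (auto simp: M_def)
    qed (use yz dF in \<open>auto intro: has_derivative_at_withinI\<close>)
  qed
qed

text \<open>The function is a pointwise limit of difference quotients of F at \<open>f x\<close> in
  direction \<open>k x\<close>, and these are measurable because F is continuous.\<close>

lemma measurable_derivative_apply:
  fixes F :: "'b::euclidean_space \<Rightarrow> 'c::euclidean_space"
  assumes dF: "\<And>y. (F has_derivative F' y) (at y)"
    and [measurable]: "f \<in> borel_measurable M" "k \<in> borel_measurable M"
  shows "(\<lambda>x. F' (f x) (k x)) \<in> borel_measurable M"
proof -
  have "continuous_on UNIV F"
    using dF by (intro continuous_at_imp_continuous_on) (auto intro: has_derivative_continuous)
  then have [measurable]: "F \<in> borel_measurable borel" by (rule borel_measurable_continuous_onI)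
  show ?thesis
  proof (rule borel_measurable_LIMSEQ_metric)
    fix x
    let ?t = "\<lambda>n. (1 / 2 :: real) ^ n"
    have t: "?t \<longlonglongrightarrow> 0" by (rule LIMSEQ_realpow_zero) auto
    have l: "linear (F' (f x))" by (rule has_derivative_linear[OF dF])
    let ?q = "\<lambda>s. (1 / s) *\<^sub>R (F (f x + s *\<^sub>R k x) - F (f x))"
    have "((\<lambda>s. F (f x + s *\<^sub>R k x)) has_derivative (\<lambda>s. s *\<^sub>R F' (f x) (k x))) (at 0)"
    proof -
      have "((\<lambda>s. f x + s *\<^sub>R k x) has_derivative (\<lambda>s. s *\<^sub>R k x)) (at 0)" by (auto intro!: derivative_eq_intros)
      from has_derivative_compose[OF this, of F "F' (f x)"] dF[of "f x"] show ?thesis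
        by (simp add: linear_scale[OF l])
    qed
    then have "((\<lambda>s. norm (F (f x + s *\<^sub>R k x) - F (f x) - s *\<^sub>R F' (f x) (k x)) / norm s) \<longlongrightarrow> 0) (at 0)"
      by (simp add: has_derivative_iff_norm)
    then have "((\<lambda>s. norm (?q s - F' (f x) (k x))) \<longlongrightarrow> 0) (at 0)"
    proof (rule Lim_transform_eventually)
      have eq: "norm (z - s *\<^sub>R w) / norm s = norm ((1 / s) *\<^sub>R z - w)" if "s \<noteq> 0" for s :: real and z w :: 'c
      proof -
        have "(1 / s) *\<^sub>R z - w = (1 / s) *\<^sub>R (z - s *\<^sub>R w)"
          using that by (simp add: scaleR_diff_right)
        then show ?thesis by simp
      qed
      show "\<forall>\<^sub>F s in at 0. norm (F (f x + s *\<^sub>R k x) - F (f x) - s *\<^sub>R F' (f x) (k x)) / norm s = norm (?q s - F' (f x) (k x))"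
        using eventually_neq_at_within by (rule eventually_mono) (rule eq)
    qed
    then have "(?q \<longlongrightarrow> F' (f x) (k x)) (at 0)" by (subst LIM_zero_iff[symmetric]) (simp only: tendsto_norm_zero_iff)
    then show "(\<lambda>n. 2 ^ n *\<^sub>R (F (f x + ?t n *\<^sub>R k x) - F (f x))) \<longlonglongrightarrow> F' (f x) (k x)"
      unfolding tendsto_at_iff_sequentially using t by (auto simp: comp_def power_one_over dest!: spec[of _ ?t])
  qed measurable
qed

text \<open>The error splits into F' applied to the error of the quotient of f and a Taylor
  remainder. The remainder relative to the increment is bounded and tends to zero almost everywhere
  on K, so dominated convergence applies once it is multiplied by the fixed integrable function
  \<open>norm (h x)\<close>. The condition F 0 = 0 bounds \<open>F (f x)\<close> by a multiple of
  \<open>f x\<close> and so makes it integrable over the whole space.\<close>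

theorem L1_deriv_chain:
  fixes f h :: "'a::euclidean_space \<Rightarrow> 'b::euclidean_space" and F :: "'b \<Rightarrow> 'c::euclidean_space"
  assumes d: "L1_deriv \<Omega> v f h" and R: "\<And>x. norm (f x) \<le> R"
    and dF: "\<And>y. (F has_derivative F' y) (at y)" and c: "\<And>k. continuous_on UNIV (\<lambda>y. F' y k)"
    and F0: "F 0 = 0"
  shows "L1_deriv \<Omega> v (\<lambda>x. F (f x)) (\<lambda>x. F' (f x) (h x))"
proof -
  have f: "integrable lborel f" and h: "integrable lborel h" using d by (auto simp: L1_deriv_def)
  have [measurable]: "f \<in> borel_measurable borel" "h \<in> borel_measurable borel" using f h by auto
  have "continuous_on UNIV F"
    using dF by (intro continuous_at_imp_continuous_on) (auto intro: has_derivative_continuous)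
  then have [measurable]: "F \<in> borel_measurable borel" by (rule borel_measurable_continuous_onI)
  obtain M where M: "0 \<le> M" "\<And>y k. norm y \<le> R \<Longrightarrow> norm (F' y k) \<le> M * norm k"
    "\<And>y z. norm y \<le> R \<Longrightarrow> norm z \<le> R \<Longrightarrow> norm (F z - F y) \<le> M * norm (z - y)"
    using derivative_bound_on_cball[OF dF c, of R] by blast
  have R0: "norm (0 :: 'b) \<le> R" using order_trans[OF norm_ge_zero R] by simp
  have Ff: "integrable lborel (\<lambda>x. F (f x))"
  proof (rule Bochner_Integration.integrable_bound[where f = "\<lambda>x. M * norm (f x)"])
    show "AE x in lborel. norm (F (f x)) \<le> norm (M * norm (f x))"
      using M(3)[OF R0 R] M(1) F0 by (intro AE_I2) simp
  qed (use f in auto)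
  have [measurable]: "(\<lambda>x. F' (f x) (k x)) \<in> borel_measurable borel"
    if "k \<in> borel_measurable borel" for k
    by (rule measurable_derivative_apply[OF dF]) (use that in measurable)
  have Fh: "integrable lborel (\<lambda>x. F' (f x) (h x))"
  proof (rule Bochner_Integration.integrable_bound[where f = "\<lambda>x. M * norm (h x)"])
    show "AE x in lborel. norm (F' (f x) (h x)) \<le> norm (M * norm (h x))"
      using M(2)[OF R] M(1) by (intro AE_I2) simp
  qed (use h in auto)
  show ?thesis
    unfolding L1_deriv_def
  proof (intro conjI Ff Fh allI impI)
    fix K assume K: "compact K \<and> K \<subseteq> \<Omega>"
    then have KB[measurable]: "K \<in> sets borel" by (simp add: borel_compact)
    \<comment> \<open>The relative Taylor remainder. Division by zero gives it the value 0 at b = a,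
      which is exactly its limit there, so \<rho> a is continuous at a.\<close>
    define \<rho> where "\<rho> a b = norm (F b - F a - F' a (b - a)) / norm (b - a)" for a b
    define r where "r n x = \<rho> (f x) (f (x + (1 / 2) ^ n *\<^sub>R v))" for n x
    have [measurable]: "r n \<in> borel_measurable borel" for n unfolding r_def \<rho>_def by measurable
    have \<rho>_bound: "\<rho> a b \<le> 2 * M" if "norm a \<le> R" "norm b \<le> R" for a b
    proof (cases "a = b")
      case False
      have "norm (F b - F a - F' a (b - a)) \<le> norm (F b - F a) + norm (F' a (b - a))" by (rule norm_triangle_ineq4)
      also have "\<dots> \<le> 2 * M * norm (b - a)" using M(2)[OF that(1), of "b - a"] M(3)[OF that] by simp
      finally show ?thesis using False by (simp add: \<rho>_def divide_le_eq)
    qed (use M(1) in \<open>simp add: \<rho>_def\<close>)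
    have r0: "0 \<le> r n x" "r n x \<le> 2 * M" for n x unfolding r_def using \<rho>_bound[OF R R] by (auto simp: \<rho>_def)
    \<comment> \<open>Two of the three multiples of M come from \<open>r n x \<le> 2 * M\<close>,
      used when the quotient of f is replaced by h; the third is the bound of F' on the
      ball.\<close>
    have key: "norm (diff_quot v n (\<lambda>x. F (f x)) x - F' (f x) (h x)) \<le> 3 * M * norm (diff_quot v n f x - h x) + r n x * norm (h x)" for n x
    proof -
      let ?D = "diff_quot v n f x" and ?b = "f (x + (1 / 2) ^ n *\<^sub>R v)" and ?a = "f x"
      have l: "linear (F' ?a)" by (rule has_derivative_linear[OF dF])
      have "F' ?a ?D = 2 ^ n *\<^sub>R F' ?a (?b - ?a)"
        unfolding diff_quot_def by (rule linear_scale[OF l])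
      moreover have "diff_quot v n (\<lambda>x. F (f x)) x = 2 ^ n *\<^sub>R (F ?b - F ?a)"
        by (rule diff_quot_def)
      ultimately have e: "diff_quot v n (\<lambda>x. F (f x)) x - F' ?a (h x) = 2 ^ n *\<^sub>R (F ?b - F ?a - F' ?a (?b - ?a)) + F' ?a (?D - h x)"
        by (simp add: linear_diff[OF l] scaleR_diff_right)
      have "norm (2 ^ n *\<^sub>R (F ?b - F ?a - F' ?a (?b - ?a))) = r n x * norm ?D"
      proof (cases "?b = ?a")
        case True then show ?thesis using linear_0[OF l] by (simp add: diff_quot_def)
      qed (simp add: r_def \<rho>_def diff_quot_def)
      also have "\<dots> \<le> r n x * (norm (?D - h x) + norm (h x))"
        using r0 norm_triangle_sub[of ?D "h x"] by (intro mult_left_mono) auto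
      also have "\<dots> \<le> 2 * M * norm (?D - h x) + r n x * norm (h x)"
        using r0 by (simp add: distrib_left mult_right_mono)
      finally have "norm (2 ^ n *\<^sub>R (F ?b - F ?a - F' ?a (?b - ?a))) \<le> 2 * M * norm (?D - h x) + r n x * norm (h x)" .
      moreover have "norm (F' ?a (?D - h x)) \<le> M * norm (?D - h x)" by (rule M(2)[OF R])
      ultimately show ?thesis
        unfolding e using norm_triangle_ineq[of "2 ^ n *\<^sub>R (F ?b - F ?a - F' ?a (?b - ?a))" "F' ?a (?D - h x)"]
        by (simp add: algebra_simps)
    qed
    have lim2: "(\<lambda>n. \<integral>x. indicator K x * (r n x * norm (h x)) \<partial>lborel) \<longlonglongrightarrow> (\<integral>x. (0::real) \<partial>(lborel :: 'a measure))"
    proof (rule integral_dominated_convergence[where w = "\<lambda>x. 2 * M * norm (h x)"])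
      show "AE x in lborel. (\<lambda>n. indicator K x * (r n x * norm (h x))) \<longlonglongrightarrow> 0"
      proof (rule eventually_mono[OF L1_deriv_AE_tendsto[OF d conjunct1[OF K] conjunct2[OF K]]])
        fix x assume x: "x \<in> K \<longrightarrow> (\<lambda>n. f (x + (1 / 2) ^ n *\<^sub>R v)) \<longlonglongrightarrow> f x"
        show "(\<lambda>n. indicator K x * (r n x * norm (h x))) \<longlonglongrightarrow> 0"
        proof (cases "x \<in> K")
          case True
          have "(\<rho> (f x) \<longlongrightarrow> 0) (at (f x))"
            using dF[of "f x"] unfolding has_derivative_iff_norm \<rho>_def by simp
          then have "isCont (\<rho> (f x)) (f x)" by (simp add: isCont_def \<rho>_def)
          then have "(\<lambda>n. r n x) \<longlonglongrightarrow> \<rho> (f x) (f x)"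
            unfolding r_def using x True by (intro isCont_tendsto_compose[of "f x" "\<rho> (f x)"]) simp_all
          then have "(\<lambda>n. r n x) \<longlonglongrightarrow> 0" by (simp add: \<rho>_def)
          then show ?thesis by (intro tendsto_mult_right_zero tendsto_mult_left_zero)
        qed simp
      qed
      show "AE x in lborel. norm (indicator K x * (r n x * norm (h x))) \<le> 2 * M * norm (h x)" for n
        using r0 M(1) by (intro AE_I2) (auto simp: indicator_def abs_mult mult_right_mono)
    qed (use h in auto)
    have Di: "integrable lborel (\<lambda>x. indicator K x * norm (diff_quot v n f x - h x))" for n
      by (intro integrable_indicator_norm KB Bochner_Integration.integrable_diff integrable_diff_quot f h)
    have ri: "integrable lborel (\<lambda>x. indicator K x * (r n x * norm (h x)))" for n
    proof (rule Bochner_Integration.integrable_bound[where f = "\<lambda>x. 2 * M * norm (h x)"])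
      show "AE x in lborel. norm (indicator K x * (r n x * norm (h x))) \<le> norm (2 * M * norm (h x))"
        using r0 M(1) by (intro AE_I2) (auto simp: indicator_def abs_mult mult_right_mono)
    qed (use h in auto)
    let ?B = "\<lambda>n. 3 * M * (\<integral>x. indicator K x * norm (diff_quot v n f x - h x) \<partial>lborel) + (\<integral>x. indicator K x * (r n x * norm (h x)) \<partial>lborel)"
    have "(\<lambda>n. \<integral>x. indicator K x * norm (diff_quot v n f x - h x) \<partial>lborel) \<longlonglongrightarrow> 0"
      using d K unfolding L1_deriv_def by blast
    then have B: "?B \<longlonglongrightarrow> 0" using lim2 by (intro tendsto_add_zero tendsto_mult_right_zero) simp_all
    have le: "(\<integral>x. indicator K x * norm (diff_quot v n (\<lambda>x. F (f x)) x - F' (f x) (h x)) \<partial>lborel) \<le> ?B n" for n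
    proof -
      have "(\<integral>x. indicator K x * norm (diff_quot v n (\<lambda>x. F (f x)) x - F' (f x) (h x)) \<partial>lborel)
        \<le> (\<integral>x. 3 * M * (indicator K x * norm (diff_quot v n f x - h x)) + indicator K x * (r n x * norm (h x)) \<partial>lborel)"
      proof (rule integral_mono)
        show "integrable lborel (\<lambda>x. indicator K x * norm (diff_quot v n (\<lambda>x. F (f x)) x - F' (f x) (h x)))"
          by (intro integrable_indicator_norm KB Bochner_Integration.integrable_diff integrable_diff_quot Ff Fh)
        show "integrable lborel (\<lambda>x. 3 * M * (indicator K x * norm (diff_quot v n f x - h x)) + indicator K x * (r n x * norm (h x)))"
          by (intro Bochner_Integration.integrable_add integrable_mult_right Di ri)
        fix x
        show "indicator K x * norm (diff_quot v n (\<lambda>x. F (f x)) x - F' (f x) (h x))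
          \<le> 3 * M * (indicator K x * norm (diff_quot v n f x - h x)) + indicator K x * (r n x * norm (h x))"
          using key[of n x] by (cases "x \<in> K") auto
      qed
      also have "\<dots> = ?B n"
        by (subst Bochner_Integration.integral_add[OF integrable_mult_right[OF Di] ri]) simp
      finally show ?thesis .
    qed
    show "(\<lambda>n. \<integral>x. indicator K x * norm (diff_quot v n (\<lambda>x. F (f x)) x - F' (f x) (h x)) \<partial>lborel) \<longlonglongrightarrow> 0"
      by (rule tendsto_sandwich[OF always_eventually always_eventually tendsto_const B]) (use le in auto)
  qed
qed

section \<open>From difference quotients back to weak derivatives\<close>

text \<open>Integration by parts for differences, by translation invariance; the minus sign of the
  continuous formula is hidden in the direction -v.\<close>

lemma diff_quot_adjoint:
  fixes f \<phi> :: "'a::euclidean_space \<Rightarrow> real"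
  assumes f: "integrable lborel f" and \<phi>: "\<phi> \<in> test_functions \<Omega>"
  shows "(\<integral>x. diff_quot v n f x * \<phi> x \<partial>lborel) = (\<integral>x. f x * diff_quot (- v) n \<phi> x \<partial>lborel)"
proof -
  let ?t = "(1 / 2) ^ n *\<^sub>R v"
  have [measurable]: "f \<in> borel_measurable borel" using f by auto
  note [measurable] = test_function_measurable[OF \<phi>]
  obtain B where B: "\<And>x. \<bar>\<phi> x\<bar> \<le> B" using test_function_bounded[OF \<phi>] by blast
  have i: "integrable lborel (\<lambda>x. f x * \<phi> x)" "integrable lborel (\<lambda>x. f x * \<phi> (x - ?t))"
    by (rule integrable_bounded_mult[OF f, where B = B]; use B in simp)+
  have i': "integrable lborel (\<lambda>x. f (x + ?t) * \<phi> x)"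
    using integrable_translation[OF i(2), of ?t] by simp
  have tr: "(\<integral>x. f (x + ?t) * \<phi> x \<partial>lborel) = (\<integral>x. f x * \<phi> (x - ?t) \<partial>lborel)"
    using integral_translation[of "\<lambda>x. f x * \<phi> (x - ?t)" ?t] by simp
  have "(\<integral>x. diff_quot v n f x * \<phi> x \<partial>lborel) = (\<integral>x. 2 ^ n * (f (x + ?t) * \<phi> x - f x * \<phi> x) \<partial>lborel)"
    by (simp add: diff_quot_def algebra_simps)
  also have "\<dots> = 2 ^ n * ((\<integral>x. f x * \<phi> (x - ?t) \<partial>lborel) - (\<integral>x. f x * \<phi> x \<partial>lborel))"
    using i i' tr by simp
  also have "\<dots> = (\<integral>x. 2 ^ n * (f x * \<phi> (x - ?t) - f x * \<phi> x) \<partial>lborel)"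
    using i by simp
  also have "\<dots> = (\<integral>x. f x * diff_quot (- v) n \<phi> x \<partial>lborel)"
    by (simp add: diff_quot_def algebra_simps)
  finally show ?thesis .
qed

lemma L1_deriv_test_limit:
  fixes f h :: "'a::euclidean_space \<Rightarrow> real"
  assumes d: "L1_deriv \<Omega> v f h" and \<phi>: "\<phi> \<in> test_functions \<Omega>"
  shows "(\<lambda>n. \<integral>x. diff_quot v n f x * \<phi> x \<partial>lborel) \<longlonglongrightarrow> (\<integral>x. h x * \<phi> x \<partial>lborel)"
proof -
  have f: "integrable lborel f" and h: "integrable lborel h" using d by (auto simp: L1_deriv_def)
  let ?K = "closure {x. \<phi> x \<noteq> 0}"
  have K: "compact ?K" "?K \<subseteq> \<Omega>" using \<phi> by (auto simp: test_functions_def)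
  have KB: "?K \<in> sets borel" using K by (simp add: borel_compact)
  obtain B where B: "\<And>x. \<bar>\<phi> x\<bar> \<le> B" using test_function_bounded[OF \<phi>] by blast
  have m: "\<phi> \<in> borel_measurable lborel" using test_function_measurable[OF \<phi>] by simp
  let ?I = "\<lambda>n. \<integral>x. indicator ?K x * norm (diff_quot v n f x - h x) \<partial>lborel"
  have I: "?I \<longlonglongrightarrow> 0" using d K unfolding L1_deriv_def by blast
  have i: "integrable lborel (\<lambda>x. diff_quot v n f x * \<phi> x)" "integrable lborel (\<lambda>x. h x * \<phi> x)" for n
    by (rule integrable_bounded_mult[OF integrable_diff_quot[OF f] m B] integrable_bounded_mult[OF h m B])+
  have le: "\<bar>(\<integral>x. diff_quot v n f x * \<phi> x \<partial>lborel) - (\<integral>x. h x * \<phi> x \<partial>lborel)\<bar> \<le> B * ?I n" for n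
  proof -
    have Di: "integrable lborel (\<lambda>x. diff_quot v n f x - h x)"
      by (intro Bochner_Integration.integrable_diff integrable_diff_quot f h)
    have "(\<integral>x. diff_quot v n f x * \<phi> x \<partial>lborel) - (\<integral>x. h x * \<phi> x \<partial>lborel) = (\<integral>x. (diff_quot v n f x - h x) * \<phi> x \<partial>lborel)"
      using Bochner_Integration.integral_diff[OF i, of n] by (simp only: left_diff_distrib)
    also have "\<bar>\<dots>\<bar> \<le> (\<integral>x. \<bar>(diff_quot v n f x - h x) * \<phi> x\<bar> \<partial>lborel)" by (rule integral_abs_bound)
    also have "\<dots> \<le> (\<integral>x. B * (indicator ?K x * norm (diff_quot v n f x - h x)) \<partial>lborel)"
    proof (rule integral_mono)
      show "integrable lborel (\<lambda>x. \<bar>(diff_quot v n f x - h x) * \<phi> x\<bar>)"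
        by (intro integrable_abs integrable_bounded_mult[OF Di m B])
      show "integrable lborel (\<lambda>x. B * (indicator ?K x * norm (diff_quot v n f x - h x)))"
        by (intro integrable_mult_right integrable_indicator_norm KB Di)
      fix x
      show "\<bar>(diff_quot v n f x - h x) * \<phi> x\<bar> \<le> B * (indicator ?K x * norm (diff_quot v n f x - h x))"
      proof (cases "x \<in> ?K")
        case True
        then show ?thesis
          using mult_right_mono[OF B, of "\<bar>diff_quot v n f x - h x\<bar>" x] by (simp add: abs_mult mult.commute)
      next
        case False
        then have "\<phi> x = 0" using closure_subset[of "{x. \<phi> x \<noteq> 0}"] by blast
        then show ?thesis using False by simp
      qed
    qed
    also have "\<dots> = B * ?I n" by simp
    finally show ?thesis .
  qed
  have "(\<lambda>n. (\<integral>x. diff_quot v n f x * \<phi> x \<partial>lborel) - (\<integral>x. h x * \<phi> x \<partial>lborel)) \<longlonglongrightarrow> 0"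
    by (rule Lim_null_comparison[OF _ tendsto_mult_right_zero[OF I, of B]]) (use le in simp)
  then show ?thesis by (subst (asm) LIM_zero_iff)
qed

lemma test_function_diff_quot:
  fixes \<phi> :: "'a::euclidean_space \<Rightarrow> real"
  assumes \<phi>: "\<phi> \<in> test_functions \<Omega>"
  shows "(\<lambda>n. diff_quot v n \<phi> x) \<longlonglongrightarrow> frechet_derivative \<phi> (at x) v"
    and "\<exists>B. \<forall>n x. \<bar>diff_quot v n \<phi> x\<bar> \<le> B"
proof -
  let ?\<psi> = "\<lambda>x. frechet_derivative \<phi> (at x) v"
  have \<psi>: "?\<psi> \<in> test_functions \<Omega>" by (rule test_function_derivative[OF \<phi>])
  have q: "diff_quot v n \<phi> x = 2 ^ n * (\<integral>s. indicator {0..(1 / 2) ^ n} s * ?\<psi> (x + (1 / 2) ^ n *\<^sub>R v - s *\<^sub>R v) \<partial>lborel)" for n x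
    using test_function_FTC[OF \<phi>, of "(1 / 2) ^ n" "x + (1 / 2) ^ n *\<^sub>R v" v] by (simp add: diff_quot_def)
  \<comment> \<open>The quotient is an average of the directional derivative over a segment, so it
    is within e of c whenever that derivative is. With c = 0 this gives the uniform bound, with c
    the value at x the limit.\<close>
  have avg: "\<bar>diff_quot v n \<phi> x - c\<bar> \<le> e"
    if c: "\<And>s. 0 \<le> s \<Longrightarrow> s \<le> (1 / 2) ^ n \<Longrightarrow> \<bar>?\<psi> (x + (1 / 2) ^ n *\<^sub>R v - s *\<^sub>R v) - c\<bar> \<le> e" for n x c e
  proof -
    let ?T = "(1 / 2 :: real) ^ n"
    let ?y = "\<lambda>s. x + ?T *\<^sub>R v - s *\<^sub>R v"
    have ci: "integrable lborel (\<lambda>s. indicator {0..?T} s * k)" for k :: real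
      by (intro integrable_mult_left) (simp add: integrable_indicator_iff emeasure_lborel_Icc_eq)
    have cont: "continuous_on {0..?T} (\<lambda>s. ?\<psi> (?y s))"
      by (rule continuous_on_compose2[OF test_function_continuous[OF \<psi>]]) (auto intro!: continuous_intros)
    have \<psi>i: "integrable lborel (\<lambda>s. indicator {0..?T} s * ?\<psi> (?y s))"
      using borel_integrable_compact[OF compact_Icc cont] by simp
    have "\<bar>2 ^ n * (\<integral>s. indicator {0..?T} s * (?\<psi> (?y s) - c) \<partial>lborel)\<bar> \<le> 2 ^ n * (\<integral>s. indicator {0..?T} s * e \<partial>lborel)"
    proof -
      have "\<bar>\<integral>s. indicator {0..?T} s * (?\<psi> (?y s) - c) \<partial>lborel\<bar> \<le> (\<integral>s. \<bar>indicator {0..?T} s * (?\<psi> (?y s) - c)\<bar> \<partial>lborel)"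
        by (rule integral_abs_bound)
      also have "\<dots> \<le> (\<integral>s. indicator {0..?T} s * e \<partial>lborel)"
      proof (rule integral_mono[OF _ ci])
        show "integrable lborel (\<lambda>s. \<bar>indicator {0..?T} s * (?\<psi> (?y s) - c)\<bar>)"
          using Bochner_Integration.integrable_diff[OF \<psi>i ci[of c]] by (intro integrable_abs) (simp only: right_diff_distrib)
        fix s show "\<bar>indicator {0..?T} s * (?\<psi> (?y s) - c)\<bar> \<le> indicator {0..?T} s * e"
          using c[of s] by (cases "s \<in> {0..?T}") auto
      qed
      finally show ?thesis by (simp add: abs_mult)
    qed
    moreover have "(\<integral>s. indicator {0..?T} s * k \<partial>lborel) = ?T * k" for k :: real by simp
    moreover have "(\<integral>s. indicator {0..?T} s * (?\<psi> (?y s) - c) \<partial>lborel) = (\<integral>s. indicator {0..?T} s * ?\<psi> (?y s) \<partial>lborel) - (\<integral>s. indicator {0..?T} s * c \<partial>lborel)"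
      using Bochner_Integration.integral_diff[OF \<psi>i ci[of c]] by (simp only: right_diff_distrib)
    ultimately show ?thesis unfolding q by (simp add: right_diff_distrib power_one_over)
  qed
  obtain B where "\<And>x. \<bar>?\<psi> x\<bar> \<le> B" using test_function_bounded[OF \<psi>] by blast
  then have "\<bar>diff_quot v n \<phi> x - 0\<bar> \<le> B" for n x by (intro avg) simp
  then show "\<exists>B. \<forall>n x. \<bar>diff_quot v n \<phi> x\<bar> \<le> B" by auto
  show "(\<lambda>n. diff_quot v n \<phi> x) \<longlonglongrightarrow> ?\<psi> x"
  proof (rule tendstoI)
    fix e :: real assume e: "0 < e"
    have "isCont ?\<psi> x" using test_function_continuous[OF \<psi>] by (simp add: continuous_on_eq_continuous_at)
    then obtain d where d: "0 < d" "\<And>y. dist y x < d \<Longrightarrow> dist (?\<psi> y) (?\<psi> x) < e / 2"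
      using e unfolding continuous_at_eps_delta by (metis half_gt_zero)
    have "\<forall>\<^sub>F n in sequentially. dist ((1 / 2) ^ n *\<^sub>R v) 0 < d"
      by (rule tendstoD[OF half_powers_vanish d(1)])
    then show "\<forall>\<^sub>F n in sequentially. dist (diff_quot v n \<phi> x) (?\<psi> x) < e"
    proof eventually_elim
      case (elim n)
      have "\<bar>diff_quot v n \<phi> x - ?\<psi> x\<bar> \<le> e / 2"
      proof (rule avg)
        fix s :: real assume s: "0 \<le> s" "s \<le> (1 / 2) ^ n"
        have "dist (x + (1 / 2) ^ n *\<^sub>R v - s *\<^sub>R v) x = ((1 / 2) ^ n - s) * norm v"
          using s by (simp add: dist_norm scaleR_diff_left[symmetric])
        also have "\<dots> \<le> (1 / 2) ^ n * norm v" using s by (intro mult_right_mono) auto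
        also have "\<dots> < d" using elim by simp
        finally show "\<bar>?\<psi> (x + (1 / 2) ^ n *\<^sub>R v - s *\<^sub>R v) - ?\<psi> x\<bar> \<le> e / 2" using d(2) by (fastforce simp: dist_real_def)
      qed
      then show ?case using e by (simp add: dist_real_def)
    qed
  qed
qed

text \<open>Both sides of \<open>diff_quot_adjoint\<close> have limits: one by convergence in mean
  on the support of \<phi>, the other by dominated convergence.\<close>

theorem L1_deriv_imp_weak_deriv:
  fixes f h :: "'a::euclidean_space \<Rightarrow> real"
  assumes d: "L1_deriv \<Omega> v f h"
  shows "weak_deriv \<Omega> v f h"
  unfolding weak_deriv_def
proof (intro conjI ballI)
  show f: "integrable lborel f" and h: "integrable lborel h" using d by (auto simp: L1_deriv_def)
  fix \<phi> :: "'a \<Rightarrow> real" assume \<phi>: "\<phi> \<in> test_functions \<Omega>"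
  have [measurable]: "f \<in> borel_measurable borel" using f by auto
  note [measurable] = test_function_measurable[OF \<phi>] test_function_measurable[OF test_function_derivative[OF \<phi>]]
  have neg: "frechet_derivative \<phi> (at x) (- v) = - frechet_derivative \<phi> (at x) v" for x
    by (rule linear_neg[OF has_derivative_linear[OF test_function_has_derivative[OF \<phi>]]])
  obtain B where B: "\<And>n x. \<bar>diff_quot (- v) n \<phi> x\<bar> \<le> B" using test_function_diff_quot(2)[OF \<phi>] by blast
  have "(\<lambda>n. \<integral>x. f x * diff_quot (- v) n \<phi> x \<partial>lborel) \<longlonglongrightarrow> (\<integral>x. f x * frechet_derivative \<phi> (at x) (- v) \<partial>lborel)"
  proof (rule integral_dominated_convergence[where w = "\<lambda>x. B * \<bar>f x\<bar>"])
    show "AE x in lborel. (\<lambda>n. f x * diff_quot (- v) n \<phi> x) \<longlonglongrightarrow> f x * frechet_derivative \<phi> (at x) (- v)"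
      by (intro AE_I2 tendsto_mult tendsto_const test_function_diff_quot(1)[OF \<phi>])
    show "AE x in lborel. norm (f x * diff_quot (- v) n \<phi> x) \<le> B * \<bar>f x\<bar>" for n
      using mult_right_mono[OF B[of n], of "\<bar>f _\<bar>"] by (intro AE_I2) (simp add: abs_mult mult.commute)
    show "(\<lambda>x. f x * frechet_derivative \<phi> (at x) (- v)) \<in> borel_measurable lborel" unfolding neg by measurable
    show "(\<lambda>x. f x * diff_quot (- v) n \<phi> x) \<in> borel_measurable lborel" for n unfolding diff_quot_def by measurable
  qed (use f in auto)
  then have "(\<lambda>n. \<integral>x. f x * diff_quot (- v) n \<phi> x \<partial>lborel) \<longlonglongrightarrow> - (\<integral>x. f x * frechet_derivative \<phi> (at x) v \<partial>lborel)"
    by (simp add: neg)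
  moreover have "(\<lambda>n. \<integral>x. f x * diff_quot (- v) n \<phi> x \<partial>lborel) \<longlonglongrightarrow> (\<integral>x. h x * \<phi> x \<partial>lborel)"
    using L1_deriv_test_limit[OF d \<phi>] by (simp only: diff_quot_adjoint[OF f \<phi>])
  ultimately have "- (\<integral>x. f x * frechet_derivative \<phi> (at x) v \<partial>lborel) = (\<integral>x. h x * \<phi> x \<partial>lborel)"
    by (rule LIMSEQ_unique)
  then show "(\<integral>x. f x * frechet_derivative \<phi> (at x) v \<partial>lborel) = - (\<integral>x. h x * \<phi> x \<partial>lborel)" by simp
qed

lemma test_function_translate_eventually:
  fixes \<phi> :: "'a::euclidean_space \<Rightarrow> real"
  assumes \<phi>: "\<phi> \<in> test_functions \<Omega>" and \<Omega>: "open \<Omega>"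
  shows "\<forall>\<^sub>F n in sequentially. (\<lambda>x. \<phi> (x - (1 / 2) ^ n *\<^sub>R v)) \<in> test_functions \<Omega>"
proof -
  let ?K = "closure {x. \<phi> x \<noteq> 0}"
  have C: "C_k k \<phi>" for k using \<phi> by (auto simp: test_functions_def)
  have K: "compact ?K" "?K \<subseteq> \<Omega>" using \<phi> by (auto simp: test_functions_def)
  obtain U e where U: "?K \<subseteq> U" "0 < e" "\<And>x w. x \<in> U \<Longrightarrow> norm w < e \<Longrightarrow> x + w \<in> \<Omega>"
    by (rule thickening[OF K(1) \<Omega> K(2)]) blast
  have \<phi>U: "\<phi> \<in> test_functions U" using C K(1) U(1) unfolding test_functions_def by blast
  have "\<forall>\<^sub>F n in sequentially. dist ((1 / 2) ^ n *\<^sub>R v) 0 < e"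
    by (rule tendstoD[OF half_powers_vanish U(2)])
  then show ?thesis
  proof eventually_elim
    case (elim n)
    then show ?case by (intro test_function_translate(1)[OF \<phi>U] U(3)) simp_all
  qed
qed

text \<open>Weak differentiation commutes with translations as long as the translated test function
  is admissible, which holds for small steps and hence for large n only.\<close>

lemma weak_deriv_diff_quot:
  fixes u q \<phi> :: "'a::euclidean_space \<Rightarrow> real"
  assumes wd: "weak_deriv \<Omega> w u q" and \<Omega>: "open \<Omega>" and \<phi>: "\<phi> \<in> test_functions \<Omega>"
  shows "\<forall>\<^sub>F n in sequentially. (\<integral>x. diff_quot v n u x * frechet_derivative \<phi> (at x) w \<partial>lborel) =
    - (\<integral>x. diff_quot v n q x * \<phi> x \<partial>lborel)"
  using test_function_translate_eventually[OF \<phi> \<Omega>, of v]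
proof eventually_elim
  case (elim n)
  let ?t = "(1 / 2) ^ n *\<^sub>R v"
  let ?\<psi> = "\<lambda>x. frechet_derivative \<phi> (at x) w"
  have u: "integrable lborel u" and q: "integrable lborel q" using wd by (auto simp: weak_deriv_def)
  have \<psi>: "?\<psi> \<in> test_functions \<Omega>" by (rule test_function_derivative[OF \<phi>])
  have tr: "frechet_derivative (\<lambda>x. \<phi> (x - ?t)) (at x) w = ?\<psi> (x - ?t)" for x
    using test_function_translate(2)[OF \<phi>, of ?t UNIV x] by simp
  have ti: "integrable lborel (\<lambda>x. g x * k (x - c))"
    if g: "integrable lborel g" and k: "k \<in> test_functions \<Omega>" for g k :: "'a \<Rightarrow> real" and c
  proof -
    note [measurable] = test_function_measurable[OF k]
    obtain B where "\<And>x. \<bar>k x\<bar> \<le> B" using test_function_bounded[OF k] by blast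
    then show ?thesis by (intro integrable_bounded_mult[OF g, where B = B]) simp_all
  qed
  have ex: "(\<integral>x. g x * diff_quot (- v) n k x \<partial>lborel) = 2 ^ n * ((\<integral>x. g x * k (x - ?t) \<partial>lborel) - (\<integral>x. g x * k x \<partial>lborel))"
    if "integrable lborel g" "k \<in> test_functions \<Omega>" for g k :: "'a \<Rightarrow> real"
  proof -
    have "(\<integral>x. g x * diff_quot (- v) n k x \<partial>lborel) = (\<integral>x. 2 ^ n * (g x * k (x - ?t) - g x * k x) \<partial>lborel)"
      by (simp add: diff_quot_def algebra_simps)
    also have "\<dots> = 2 ^ n * ((\<integral>x. g x * k (x - ?t) \<partial>lborel) - (\<integral>x. g x * k x \<partial>lborel))"
      using ti[OF that, of ?t] ti[OF that, of 0] by simp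
    finally show ?thesis .
  qed
  have "(\<integral>x. u x * ?\<psi> (x - ?t) \<partial>lborel) = - (\<integral>x. q x * \<phi> (x - ?t) \<partial>lborel)"
    using wd elim tr unfolding weak_deriv_def by fastforce
  moreover have "(\<integral>x. u x * ?\<psi> x \<partial>lborel) = - (\<integral>x. q x * \<phi> x \<partial>lborel)"
    using wd \<phi> unfolding weak_deriv_def by blast
  ultimately show ?case
    unfolding diff_quot_adjoint[OF u \<psi>] diff_quot_adjoint[OF q \<phi>] ex[OF u \<psi>] ex[OF q \<phi>]
    by (simp add: algebra_simps)
qed

lemma AE_eq_if_test_integrals_eq:
  fixes r s :: "'a::euclidean_space \<Rightarrow> real"
  assumes "open \<Omega>" and r: "integrable lborel r" and s: "integrable lborel s"
    and eq: "\<And>\<phi> :: 'a \<Rightarrow> real. \<phi> \<in> test_functions \<Omega> \<Longrightarrow> (\<integral>x. r x * \<phi> x \<partial>lborel) = (\<integral>x. s x * \<phi> x \<partial>lborel)"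
  shows "AE x in lborel. x \<in> \<Omega> \<longrightarrow> r x = s x"
proof -
  have "AE x in lborel. x \<in> \<Omega> \<longrightarrow> r x - s x = 0"
  proof (rule AE_zero_if_test_integrals_zero[OF assms(1)])
    show "integrable lborel (\<lambda>x. r x - s x)" using r s by (rule Bochner_Integration.integrable_diff)
    fix \<phi> :: "'a \<Rightarrow> real" assume \<phi>: "\<phi> \<in> test_functions \<Omega>"
    note [measurable] = test_function_measurable[OF \<phi>]
    obtain B where "\<And>x. \<bar>\<phi> x\<bar> \<le> B" using test_function_bounded[OF \<phi>] by blast
    then have "integrable lborel (\<lambda>x. r x * \<phi> x)" "integrable lborel (\<lambda>x. s x * \<phi> x)"
      by (auto intro!: integrable_bounded_mult r s)
    with eq[OF \<phi>] show "(\<integral>x. (r x - s x) * \<phi> x \<partial>lborel) = 0" by (simp add: left_diff_distrib)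
  qed
  then show ?thesis by eventually_elim simp
qed

text \<open>Difference quotients in direction \<open>v\<close> commute with the weak derivative in direction
  \<open>w\<close>; this replaces the symmetry of the second derivatives of the test functions.\<close>

theorem weak_derivs_commute:
  fixes u p q r s :: "'a::euclidean_space \<Rightarrow> real"
  assumes \<Omega>: "open \<Omega>" and up: "weak_deriv \<Omega> v u p" and uq: "weak_deriv \<Omega> w u q"
    and pr: "weak_deriv \<Omega> w p r" and qs: "weak_deriv \<Omega> v q s"
  shows "AE x in lborel. x \<in> \<Omega> \<longrightarrow> r x = s x"
proof (rule AE_eq_if_test_integrals_eq[OF \<Omega>])
  show "integrable lborel r" "integrable lborel s" using pr qs by (auto simp: weak_deriv_def)
  fix \<phi> :: "'a \<Rightarrow> real" assume \<phi>: "\<phi> \<in> test_functions \<Omega>"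
  have "(\<lambda>n. \<integral>x. diff_quot v n u x * frechet_derivative \<phi> (at x) w \<partial>lborel) \<longlonglongrightarrow> (\<integral>x. p x * frechet_derivative \<phi> (at x) w \<partial>lborel)"
    by (rule L1_deriv_test_limit[OF weak_deriv_imp_L1_deriv[OF up \<Omega>] test_function_derivative[OF \<phi>]])
  then have "(\<lambda>n. - (\<integral>x. diff_quot v n q x * \<phi> x \<partial>lborel)) \<longlonglongrightarrow> (\<integral>x. p x * frechet_derivative \<phi> (at x) w \<partial>lborel)"
    by (rule Lim_transform_eventually) (rule weak_deriv_diff_quot[OF uq \<Omega> \<phi>])
  moreover have "(\<lambda>n. - (\<integral>x. diff_quot v n q x * \<phi> x \<partial>lborel)) \<longlonglongrightarrow> - (\<integral>x. s x * \<phi> x \<partial>lborel)"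
    by (rule tendsto_minus[OF L1_deriv_test_limit[OF weak_deriv_imp_L1_deriv[OF qs \<Omega>] \<phi>]])
  ultimately have "(\<integral>x. p x * frechet_derivative \<phi> (at x) w \<partial>lborel) = - (\<integral>x. s x * \<phi> x \<partial>lborel)"
    by (rule LIMSEQ_unique)
  moreover have "(\<integral>x. p x * frechet_derivative \<phi> (at x) w \<partial>lborel) = - (\<integral>x. r x * \<phi> x \<partial>lborel)"
    using pr \<phi> unfolding weak_deriv_def by blast
  ultimately show "(\<integral>x. r x * \<phi> x \<partial>lborel) = (\<integral>x. s x * \<phi> x \<partial>lborel)" by simp
qed

text \<open>On a closed box in \<Omega> the quotients are eventually at most L in absolute value, so
  the excess of |h| over L is bounded by the distance of h from the quotient, whose mean tends to
  zero.\<close>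

lemma L1_deriv_lipschitz_bound:
  fixes f h :: "'a::euclidean_space \<Rightarrow> real"
  assumes d: "L1_deriv \<Omega> v f h" and \<Omega>: "open \<Omega>" and v: "norm v \<le> 1" and "0 \<le> L"
    and lip: "\<And>x y. x \<in> \<Omega> \<Longrightarrow> y \<in> \<Omega> \<Longrightarrow> \<bar>f x - f y\<bar> \<le> L * norm (x - y)"
  shows "AE x in lborel. x \<in> \<Omega> \<longrightarrow> \<bar>h x\<bar> \<le> L"
proof (rule AE_open_if_AE_cbox[OF \<Omega>])
  have f: "integrable lborel f" and h: "integrable lborel h" using d by (auto simp: L1_deriv_def)
  have [measurable]: "h \<in> borel_measurable borel" using h by auto
  fix a b :: 'a assume K: "cbox a b \<subseteq> \<Omega>"
  let ?K = "cbox a b"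
  define m where "m x = indicator ?K x * max 0 (\<bar>h x\<bar> - L)" for x
  have mi: "integrable lborel m"
  proof (rule Bochner_Integration.integrable_bound[OF integrable_abs[OF h]])
    show "m \<in> borel_measurable lborel" unfolding m_def by measurable
    show "AE x in lborel. norm (m x) \<le> norm \<bar>h x\<bar>"
      using assms(4) by (intro AE_I2) (auto simp: m_def indicator_def)
  qed
  have I: "(\<lambda>n. \<integral>x. indicator ?K x * norm (diff_quot v n f x - h x) \<partial>lborel) \<longlonglongrightarrow> 0"
    using d K compact_cbox unfolding L1_deriv_def by blast
  obtain e where e: "0 < e" "(\<Union>x\<in>?K. ball x e) \<subseteq> \<Omega>"
    using compact_subset_open_imp_ball_epsilon_subset[OF compact_cbox \<Omega> K] .
  have "\<forall>\<^sub>F n in sequentially. (\<integral>x. m x \<partial>lborel) \<le> (\<integral>x. indicator ?K x * norm (diff_quot v n f x - h x) \<partial>lborel)"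
    using tendstoD[OF half_powers_vanish[of v] e(1)]
  proof eventually_elim
    case (elim n)
    show ?case
    proof (rule integral_mono[OF mi])
      show "integrable lborel (\<lambda>x. indicator ?K x * norm (diff_quot v n f x - h x))"
        by (intro integrable_indicator_norm Bochner_Integration.integrable_diff integrable_diff_quot f h) simp
      fix x
      show "m x \<le> indicator ?K x * norm (diff_quot v n f x - h x)"
      proof (cases "x \<in> ?K")
        case True
        let ?y = "x + (1 / 2) ^ n *\<^sub>R v"
        have "?y \<in> ball x e" using elim by (simp add: dist_norm)
        then have "?y \<in> \<Omega>" "x \<in> \<Omega>" using e(2) K True by blast+
        then have "\<bar>f ?y - f x\<bar> \<le> L * norm (?y - x)" by (rule lip)
        also have "\<dots> \<le> L * (1 / 2) ^ n"
          using v assms(4) by (intro mult_left_mono) (auto simp: mult_left_le)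
        finally have "2 ^ n * \<bar>f ?y - f x\<bar> \<le> 2 ^ n * (L * (1 / 2) ^ n)" by (intro mult_left_mono) auto
        then have "\<bar>diff_quot v n f x\<bar> \<le> L" by (simp add: diff_quot_def abs_mult power_one_over)
        then show ?thesis using True by (simp add: m_def)
      qed (simp add: m_def)
    qed
  qed
  then have "(\<integral>x. m x \<partial>lborel) \<le> 0" by (rule tendsto_lowerbound[OF I]) simp
  moreover have m0: "AE x in lborel. 0 \<le> m x" by (simp add: m_def)
  then have "0 \<le> (\<integral>x. m x \<partial>lborel)" by (rule integral_nonneg_AE)
  ultimately have "(\<integral>x. m x \<partial>lborel) = 0" by simp
  then have "AE x in lborel. m x = 0" using integral_nonneg_eq_0_iff_AE[OF mi m0] by simp
  then show "AE x in lborel. x \<in> ?K \<longrightarrow> \<bar>h x\<bar> \<le> L"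
    by eventually_elim (auto simp: m_def max_def split: if_splits)
qed

text \<open>Weak derivatives are real-valued, whereas the chain rule for the determinant takes the
  whole matrix as its argument.\<close>

lemma L1_deriv_componentwise:
  fixes f h :: "'a::euclidean_space \<Rightarrow> 'b::euclidean_space"
  assumes d: "\<And>b. b \<in> Basis \<Longrightarrow> L1_deriv \<Omega> v (\<lambda>x. f x \<bullet> b) (\<lambda>x. h x \<bullet> b)"
  shows "L1_deriv \<Omega> v f h"
proof -
  have int: "integrable lborel g" if "\<And>b. b \<in> Basis \<Longrightarrow> integrable lborel (\<lambda>x. g x \<bullet> b)" for g :: "'a \<Rightarrow> 'b"
  proof -
    have "integrable lborel (\<lambda>x. \<Sum>b\<in>Basis. (g x \<bullet> b) *\<^sub>R b)"
      using that by (intro Bochner_Integration.integrable_sum integrable_scaleR_left) auto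
    then show ?thesis by (simp add: euclidean_representation)
  qed
  have f: "integrable lborel f" and h: "integrable lborel h"
    using d by (auto intro!: int simp: L1_deriv_def)
  show ?thesis
    unfolding L1_deriv_def
  proof (intro conjI f h allI impI)
    fix K assume K: "compact K \<and> K \<subseteq> \<Omega>"
    have KB: "K \<in> sets borel" using K by (simp add: borel_compact)
    let ?I = "\<lambda>b n. \<integral>x. indicator K x * norm (diff_quot v n (\<lambda>x. f x \<bullet> b) x - h x \<bullet> b) \<partial>lborel"
    have lim: "(\<lambda>n. \<Sum>b\<in>Basis. ?I b n) \<longlonglongrightarrow> 0"
      using d K unfolding L1_deriv_def by (intro tendsto_null_sum) blast
    have Bi: "integrable lborel (\<lambda>x. indicator K x * norm (diff_quot v n (\<lambda>x. f x \<bullet> b) x - h x \<bullet> b))"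
      if "b \<in> Basis" for b n
      using d[OF that] unfolding L1_deriv_def
      by (intro integrable_indicator_norm KB Bochner_Integration.integrable_diff integrable_diff_quot) auto
    have le: "(\<integral>x. indicator K x * norm (diff_quot v n f x - h x) \<partial>lborel) \<le> (\<Sum>b\<in>Basis. ?I b n)" for n
    proof -
      have "(\<integral>x. indicator K x * norm (diff_quot v n f x - h x) \<partial>lborel)
        \<le> (\<integral>x. (\<Sum>b\<in>Basis. indicator K x * norm (diff_quot v n (\<lambda>x. f x \<bullet> b) x - h x \<bullet> b)) \<partial>lborel)"
      proof (rule integral_mono)
        show "integrable lborel (\<lambda>x. indicator K x * norm (diff_quot v n f x - h x))"
          by (intro integrable_indicator_norm KB Bochner_Integration.integrable_diff integrable_diff_quot f h)
        show "integrable lborel (\<lambda>x. \<Sum>b\<in>Basis. indicator K x * norm (diff_quot v n (\<lambda>x. f x \<bullet> b) x - h x \<bullet> b))"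
          by (rule Bochner_Integration.integrable_sum) (rule Bi)
        fix x
        have "norm (diff_quot v n f x - h x) \<le> (\<Sum>b\<in>Basis. \<bar>(diff_quot v n f x - h x) \<bullet> b\<bar>)" by (rule norm_le_l1)
        also have "\<dots> = (\<Sum>b\<in>Basis. norm (diff_quot v n (\<lambda>x. f x \<bullet> b) x - h x \<bullet> b))"
          by (simp add: diff_quot_def inner_diff_left)
        finally show "indicator K x * norm (diff_quot v n f x - h x)
            \<le> (\<Sum>b\<in>Basis. indicator K x * norm (diff_quot v n (\<lambda>x. f x \<bullet> b) x - h x \<bullet> b))"
          by (cases "x \<in> K") auto
      qed
      also have "\<dots> = (\<Sum>b\<in>Basis. ?I b n)" by (rule Bochner_Integration.integral_sum) (rule Bi)
      finally show ?thesis .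
    qed
    show "(\<lambda>n. \<integral>x. indicator K x * norm (diff_quot v n f x - h x) \<partial>lborel) \<longlonglongrightarrow> 0"
      by (rule tendsto_sandwich[OF always_eventually always_eventually tendsto_const lim]) (use le in auto)
  qed
qed

section \<open>Functions with vanishing weak gradient\<close>

lemma AE_open_nonempty:
  fixes U :: "'a::euclidean_space set"
  assumes "open U" "U \<noteq> {}" and "AE x in lborel. x \<in> U \<longrightarrow> P x"
  obtains x where "x \<in> U" "P x"
proof (rule ccontr)
  assume "\<not> thesis"
  with that have "\<And>x. x \<in> U \<Longrightarrow> \<not> P x" by blast
  with assms(3) have "AE x in lborel. x \<notin> U" by (auto elim!: eventually_mono)
  then have "U \<in> null_sets lborel"
    using assms(1) by (subst (asm) AE_iff_null_sets[symmetric]) auto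
  then have "negligible U" by (simp add: negligible_iff_null_sets null_sets_completionI)
  then show False using open_not_negligible[OF assms(1,2)] by blast
qed

lemma box_add_Basis:
  fixes x :: "'a::euclidean_space"
  assumes "x \<in> box a b" "x + c *\<^sub>R i \<in> box a b" "i \<in> Basis" "0 \<le> s" "s \<le> c"
  shows "x + s *\<^sub>R i \<in> box a b"
proof -
  have "a \<bullet> j < (x + s *\<^sub>R i) \<bullet> j \<and> (x + s *\<^sub>R i) \<bullet> j < b \<bullet> j" if "j \<in> Basis" for j
    using assms that by (cases "i = j") (auto simp: mem_box inner_add_left inner_Basis dest!: bspec[of _ _ j])
  then show ?thesis by (simp add: mem_box)
qed

lemma weak_deriv_zero_shift:
  fixes f :: "'a::euclidean_space \<Rightarrow> real"
  assumes wd: "weak_deriv \<Omega> i f (\<lambda>x. 0)" and i: "i \<in> Basis" and sub: "box a b \<subseteq> \<Omega>"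
  shows "AE x in lborel. x \<in> box a b \<longrightarrow> x + c *\<^sub>R i \<in> box a b \<longrightarrow> f (x + c *\<^sub>R i) = f x"
proof -
  have pos: "AE x in lborel. x \<in> box a b \<longrightarrow> x + c *\<^sub>R i \<in> box a b \<longrightarrow> f (x + c *\<^sub>R i) = f x"
    if c: "0 \<le> c" for c
  proof -
    have "open ((\<lambda>x. x + c *\<^sub>R i) -` box a b)"
      by (intro open_vimage continuous_intros open_box)
    then have U: "open (box a b \<inter> (\<lambda>x. x + c *\<^sub>R i) -` box a b)" by (intro open_Int open_box)
    have "AE x in lborel. x \<in> box a b \<inter> (\<lambda>x. x + c *\<^sub>R i) -` box a b \<longrightarrow>
        f (x + c *\<^sub>R i) - f x = (\<integral>s. indicator {0..c} s * 0 \<partial>lborel)"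
      by (rule weak_deriv_increment[OF wd c U]) (use sub box_add_Basis[OF _ _ i] in blast)
    then show ?thesis by eventually_elim auto
  qed
  show ?thesis
  proof (cases "0 \<le> c")
    case False
    \<comment> \<open>For c < 0 the statement for the shift -c, read at the point x + c i, is the
      required equation with its sides exchanged.\<close>
    from AE_translation[OF pos[of "- c"], of "c *\<^sub>R i"] False show ?thesis
      by (auto elim!: eventually_mono)
  qed (rule pos)
qed

text \<open>The shift is carried out one coordinate at a time. Each coordinate of an intermediate
  point is that of x or of x + w, so these points stay in the box.\<close>

lemma weak_gradient_zero_shift:
  fixes f :: "'a::euclidean_space \<Rightarrow> real"
  assumes wd: "\<And>i. i \<in> Basis \<Longrightarrow> weak_deriv \<Omega> i f (\<lambda>x. 0)" and sub: "box a b \<subseteq> \<Omega>"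
  shows "AE x in lborel. x \<in> box a b \<longrightarrow> x + w \<in> box a b \<longrightarrow> f (x + w) = f x"
proof -
  define part where "part S = (\<Sum>i\<in>S. (w \<bullet> i) *\<^sub>R i)" for S :: "'a set"
  have inner_part: "part S \<bullet> j = (if j \<in> S then w \<bullet> j else 0)" if "S \<subseteq> Basis" "j \<in> Basis" for S j
  proof -
    have "finite S" using that finite_Basis finite_subset by blast
    have "part S \<bullet> j = (\<Sum>i\<in>S. if i = j then w \<bullet> j else 0)"
      unfolding part_def inner_sum_left using that by (intro sum.cong) (auto simp: inner_Basis)
    then show ?thesis using \<open>finite S\<close> by simp
  qed
  have "AE x in lborel. x \<in> box a b \<longrightarrow> x + part S \<in> box a b \<longrightarrow> f (x + part S) = f x"
    if "finite S" "S \<subseteq> Basis" for S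
    using that
  proof (induction S rule: finite_induct)
    case empty
    show ?case by (simp add: part_def)
  next
    case (insert i S)
    then have i: "i \<in> Basis" and S: "S \<subseteq> Basis" by auto
    have p: "part (insert i S) = part S + (w \<bullet> i) *\<^sub>R i"
      using insert by (simp add: part_def add.commute)
    have mid: "x + part S \<in> box a b" if x: "x \<in> box a b" "x + part (insert i S) \<in> box a b" for x
      unfolding mem_box
    proof
      fix j :: 'a assume j: "j \<in> Basis"
      show "a \<bullet> j < (x + part S) \<bullet> j \<and> (x + part S) \<bullet> j < b \<bullet> j"
      proof (cases "j \<in> S")
        case True
        then have "(x + part S) \<bullet> j = (x + part (insert i S)) \<bullet> j"
          using inner_part[OF S j] inner_part[OF insert.prems j] by (simp add: inner_add_left)
        then show ?thesis using x(2) j by (simp add: mem_box)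
      next
        case False
        then have "(x + part S) \<bullet> j = x \<bullet> j" using inner_part[OF S j] by (simp add: inner_add_left)
        then show ?thesis using x(1) j by (simp add: mem_box)
      qed
    qed
    from insert.IH[OF S] AE_translation[OF weak_deriv_zero_shift[OF wd[OF i] i sub, of "w \<bullet> i"], of "part S"]
    show ?case
    proof eventually_elim
      case (elim x)
      show ?case
      proof (intro impI)
        assume x: "x \<in> box a b" "x + part (insert i S) \<in> box a b"
        from mid[OF x] elim x show "f (x + part (insert i S)) = f x" unfolding p by (simp add: add.assoc)
      qed
    qed
  qed
  from this[OF finite_Basis subset_refl] show ?thesis
    by (simp add: part_def euclidean_representation)
qed

text \<open>The null set of exceptional x depends on the shift w. Fubini's theorem exchanges the two
  quantifiers, and one good point x then determines f at almost every other point of the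
  box.\<close>

lemma weak_gradient_zero_box:
  fixes f :: "'a::euclidean_space \<Rightarrow> real"
  assumes f: "integrable lborel f"
    and wd: "\<And>i. i \<in> Basis \<Longrightarrow> weak_deriv \<Omega> i f (\<lambda>x. 0)" and sub: "box a b \<subseteq> \<Omega>"
  shows "\<exists>c. AE x in lborel. x \<in> box a b \<longrightarrow> f x = c"
proof (cases "box a b = {}")
  case False
  have [measurable]: "f \<in> borel_measurable borel" using f by auto
  have meas: "{z \<in> space (lborel \<Otimes>\<^sub>M lborel). fst z \<in> box a b \<longrightarrow> fst z + snd z \<in> box a b \<longrightarrow> f (fst z + snd z) = f (fst z)}
      \<in> sets (lborel \<Otimes>\<^sub>M (lborel :: 'a measure))" (is "{z \<in> _. ?P (fst z) (snd z)} \<in> _")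
    by measurable
  have "AE w in lborel. AE x in lborel. ?P x w"
    by (intro AE_I2 weak_gradient_zero_shift[OF wd sub])
  then have "AE x in lborel. AE w in lborel. ?P x w"
    using lborel_pair.AE_commute[OF meas] by simp
  then have "AE x in lborel. x \<in> box a b \<longrightarrow> (AE w in lborel. ?P x w)"
    by eventually_elim simp
  then obtain x where x: "x \<in> box a b" "AE w in lborel. ?P x w"
    by (rule AE_open_nonempty[OF open_box False])
  from AE_translation[OF x(2), of "- x"] x(1) have "AE y in lborel. y \<in> box a b \<longrightarrow> f y = f x"
    by (auto elim!: eventually_mono)
  then show ?thesis by blast
qed simp

text \<open>The value of f near a point is well defined, since two neighbourhoods of it meet in a
  nonempty open set, which is not null. It is therefore an honest function k on \<Omega>, locally
  constant at every point, to which connectedness applies; a countable cover by boxes leads back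
  from k to f.\<close>

theorem weak_gradient_zero_imp_constant:
  fixes f :: "'a::euclidean_space \<Rightarrow> real"
  assumes \<Omega>: "open \<Omega>" "connected \<Omega>" and f: "integrable lborel f"
    and wd: "\<And>i. i \<in> Basis \<Longrightarrow> weak_deriv \<Omega> i f (\<lambda>x. 0)"
  shows "\<exists>c. AE x in lborel. x \<in> \<Omega> \<longrightarrow> f x = c"
proof -
  define Q where "Q x c U \<longleftrightarrow> open U \<and> x \<in> U \<and> U \<subseteq> \<Omega> \<and> (AE y in lborel. y \<in> U \<longrightarrow> f y = c)" for x c U
  have box: "\<exists>a b. x \<in> box a b \<and> box a b \<subseteq> \<Omega>" if x: "x \<in> \<Omega>" for x
  proof -
    obtain e where e: "0 < e" "ball x e \<subseteq> \<Omega>" using \<Omega>(1) x unfolding open_contains_ball by blast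
    show ?thesis using rational_boxes[OF e(1), of x] e(2) by blast
  qed
  have ex: "\<exists>c U. Q x c U" if "x \<in> \<Omega>" for x
    using box[OF that] weak_gradient_zero_box[OF f wd] unfolding Q_def by (metis open_box)
  define k where "k x = (SOME c. \<exists>U. Q x c U)" for x
  have k: "\<exists>U. Q x (k x) U" if "x \<in> \<Omega>" for x
    unfolding k_def using ex[OF that] by (rule someI_ex)
  have uniq: "c = c'" if "Q x c U" "Q x c' U'" for x c c' U U'
  proof -
    have "open (U \<inter> U')" "U \<inter> U' \<noteq> {}" using that by (auto simp: Q_def)
    moreover have "AE y in lborel. y \<in> U \<inter> U' \<longrightarrow> f y = c \<and> f y = c'"
    proof -
      from that have "AE y in lborel. y \<in> U \<longrightarrow> f y = c" "AE y in lborel. y \<in> U' \<longrightarrow> f y = c'"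
        by (simp_all add: Q_def)
      then show ?thesis by eventually_elim blast
    qed
    ultimately show ?thesis by (rule AE_open_nonempty) simp
  qed
  have loc: "k y = c" if "Q x c U" "y \<in> U" for x y c U
  proof -
    have "Q y c U" using that by (simp add: Q_def)
    moreover have "y \<in> \<Omega>" using that by (auto simp: Q_def)
    ultimately show ?thesis using k[of y] uniq by blast
  qed
  have const: "k x = k y" if "x \<in> \<Omega>" "y \<in> \<Omega>" for x y
  proof (rule connected_local_const[OF \<Omega>(2) that], rule ballI)
    fix z assume "z \<in> \<Omega>"
    then obtain U where U: "Q z (k z) U" using k by blast
    have "k z = k y" if "y \<in> U" for y using loc[OF U that] by simp
    then show "\<forall>\<^sub>F y in at z within \<Omega>. k z = k y"
      unfolding eventually_at_topological using U by (auto simp: Q_def intro!: exI[of _ U])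
  qed
  show ?thesis
  proof (cases "\<Omega> = {}")
    case False
    then obtain x0 where x0: "x0 \<in> \<Omega>" by blast
    obtain \<D> where \<D>: "countable \<D>" "\<D> \<subseteq> Pow \<Omega>" "\<And>X. X \<in> \<D> \<Longrightarrow> \<exists>a b. X = box a b" "\<Union>\<D> = \<Omega>"
      using open_countable_Union_open_box[OF \<Omega>(1)] by metis
    have "AE x in lborel. \<forall>X\<in>\<D>. x \<in> X \<longrightarrow> f x = k x0"
    proof (subst AE_ball_countable[OF \<D>(1)], rule ballI)
      fix X assume X: "X \<in> \<D>"
      then obtain a b where ab: "X = box a b" "box a b \<subseteq> \<Omega>" using \<D>(2,3) by blast
      obtain c where c: "AE x in lborel. x \<in> X \<longrightarrow> f x = c"
        using weak_gradient_zero_box[OF f wd ab(2)] ab(1) by blast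
      show "AE x in lborel. x \<in> X \<longrightarrow> f x = k x0"
      proof (cases "X = {}")
        case False
        then obtain x where x: "x \<in> X" by blast
        then have "Q x c X" using ab c open_box[of a b] by (simp add: Q_def)
        from loc[OF this x] have "c = k x0" using const[of x x0] x0 x ab by auto
        then show ?thesis using c by simp
      qed simp
    qed
    then have "AE x in lborel. x \<in> \<Omega> \<longrightarrow> f x = k x0" by eventually_elim (use \<D>(4) in auto)
    then show ?thesis by blast
  qed simp
qed

section \<open>Cofactors and the Piola identity\<close>

lemma bij_betw_index_pos: "bij_betw (index_pos :: 'n::{finite,wellorder} \<Rightarrow> nat) UNIV {0..<CARD('n)}"
proof -
  have mono: "index_pos i < index_pos j" if "i < j" for i j :: 'n
    unfolding index_pos_def using that by (intro psubset_card_mono) auto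
  have inj: "inj (index_pos :: 'n \<Rightarrow> nat)"
    by (rule linorder_injI) (use mono in \<open>auto simp: neq_iff\<close>)
  have "index_pos i < CARD('n)" for i :: 'n
    unfolding index_pos_def by (intro psubset_card_mono) auto
  then have sub: "range (index_pos :: 'n \<Rightarrow> nat) \<subseteq> {0..<CARD('n)}" by auto
  have "range (index_pos :: 'n \<Rightarrow> nat) = {0..<CARD('n)}"
    by (rule card_subset_eq[OF _ sub]) (simp_all add: card_image[OF inj])
  with inj show ?thesis by (simp add: bij_betw_def)
qed

lemma index_pos_less: "index_pos (i :: 'n::{finite,wellorder}) < CARD('n)"
  using bij_betwE[OF bij_betw_index_pos] by fastforce

lemma inv_index_pos [simp]: "inv_into UNIV index_pos (index_pos (i :: 'n::{finite,wellorder})) = i"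
  by (rule bij_betw_inv_into_left[OF bij_betw_index_pos]) simp

lemma index_pos_inv: "k < CARD('n::{finite,wellorder}) \<Longrightarrow> index_pos (inv_into UNIV index_pos k :: 'n) = k"
  by (rule bij_betw_inv_into_right[OF bij_betw_index_pos]) simp

text \<open>Conjugation by \<open>index_pos\<close> is a sign-preserving bijection between the
  permutations of the index type and those of the first n numbers, so the two Leibniz sums agree
  term by term.\<close>

lemma det_jnf_mat:
  fixes X :: "real ^ 'n::{finite,wellorder} ^ 'n::_"
  shows "Determinant.det (jnf_mat X) = Determinants.det X"
proof -
  let ?n = "CARD('n)" and ?f = "index_pos :: 'n \<Rightarrow> nat"
  let ?\<Phi> = "map_permutation (UNIV :: 'n set) ?f"
  have bij: "bij_betw ?f UNIV {0..<?n}" by (rule bij_betw_index_pos)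
  have inj: "inj_on ?f UNIV" using bij by (simp add: bij_betw_def)
  have \<Phi>: "?\<Phi> = (\<lambda>\<pi> x. if x \<in> {0..<?n} then ?f (\<pi> (inv_into UNIV ?f x)) else x)"
    using bij by (auto simp: map_permutation_def restrict_id_def bij_betw_def fun_eq_iff)
  have b\<Phi>: "bij_betw ?\<Phi> {\<pi>. \<pi> permutes UNIV} {\<pi>. \<pi> permutes {0..<?n}}"
    unfolding \<Phi> by (rule bij_betw_permutations[OF bij])
  have "Determinant.det (jnf_mat X) = (\<Sum>p\<in>{p. p permutes {0..<?n}}. of_int (sign p) * (\<Prod>i = 0..<?n. jnf_mat X $$ (i, p i)))"
    by (rule Determinant.det_def') (simp add: jnf_mat_def)
  also have "\<dots> = (\<Sum>\<pi>\<in>{\<pi>. \<pi> permutes UNIV}. of_int (sign (?\<Phi> \<pi>)) * (\<Prod>i = 0..<?n. jnf_mat X $$ (i, ?\<Phi> \<pi> i)))"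
    by (rule sum.reindex_bij_betw[OF b\<Phi>, symmetric])
  also have "\<dots> = (\<Sum>\<pi>\<in>{\<pi>. \<pi> permutes UNIV}. of_int (sign \<pi>) * (\<Prod>i\<in>UNIV. X $ i $ \<pi> i))"
  proof (rule sum.cong[OF refl])
    fix \<pi> :: "'n \<Rightarrow> 'n" assume "\<pi> \<in> {\<pi>. \<pi> permutes UNIV}"
    then have \<pi>: "\<pi> permutes UNIV" by simp
    have "(\<Prod>i = 0..<?n. jnf_mat X $$ (i, ?\<Phi> \<pi> i)) = (\<Prod>k\<in>UNIV. jnf_mat X $$ (?f k, ?\<Phi> \<pi> (?f k)))"
      by (rule prod.reindex_bij_betw[OF bij, symmetric])
    also have "\<dots> = (\<Prod>k\<in>UNIV. X $ k $ \<pi> k)"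
      by (intro prod.cong refl) (simp add: jnf_mat_def \<Phi> index_pos_less)
    finally show "of_int (sign (?\<Phi> \<pi>)) * (\<Prod>i = 0..<?n. jnf_mat X $$ (i, ?\<Phi> \<pi> i)) = (of_int (sign \<pi>) * (\<Prod>i\<in>UNIV. X $ i $ \<pi> i) :: real)"
      by (simp add: sign_map_permutation[OF inj \<pi> finite])
  qed
  also have "\<dots> = Determinants.det X" by (simp add: Determinants.det_def)
  finally show ?thesis .
qed

text \<open>Cofactors are treated as determinants with one row replaced by a basis vector.
  Multilinearity and antisymmetry in the rows then apply directly, and minors of smaller size occur
  only in \<open>transpose_cof\<close>.\<close>

definition replace_row :: "'n \<Rightarrow> real ^ 'n \<Rightarrow> real ^ 'n ^ 'n \<Rightarrow> real ^ 'n ^ 'n" where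
  "replace_row i v X = (\<chi> r. if r = i then v else X $ r)"

text \<open>Laplace expansion along the replaced row has a single nonzero term, and deleting that
  row removes the only trace of the replacement.\<close>

lemma transpose_cof:
  fixes X :: "real ^ 'n::{finite,wellorder} ^ 'n::_"
  shows "Finite_Cartesian_Product.transpose (cof X) $ i $ j = Determinants.det (replace_row i (axis j 1) X)"
proof -
  let ?n = "CARD('n)" and ?i = "index_pos i" and ?j = "index_pos j"
  let ?A = "jnf_mat (replace_row i (axis j 1) X)"
  have A: "?A \<in> carrier_mat ?n ?n" by (simp add: jnf_mat_def)
  have del: "mat_delete ?A ?i ?j = mat_delete (jnf_mat X) ?i ?j"
  proof (rule eq_matI)
    fix r c assume "r < dim_row (mat_delete (jnf_mat X) ?i ?j)" "c < dim_col (mat_delete (jnf_mat X) ?i ?j)"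
    then have rc: "r < ?n - 1" "c < ?n - 1" by (simp_all add: jnf_mat_def)
    define r' where "r' = (if r < ?i then r else Suc r)"
    have r': "r' < ?n" "r' \<noteq> ?i" using rc by (auto simp: r'_def)
    then have "(inv_into UNIV index_pos r' :: 'n) \<noteq> i" using index_pos_inv[of r'] by metis
    then show "mat_delete ?A ?i ?j $$ (r, c) = mat_delete (jnf_mat X) ?i ?j $$ (r, c)"
      using rc r' by (auto simp: mat_delete_def jnf_mat_def replace_row_def r'_def split: if_splits)
  qed (simp_all add: jnf_mat_def)
  have entry: "?A $$ (?i, k) = (if k = ?j then 1 else 0)" if "k < ?n" for k
  proof -
    have "(inv_into UNIV index_pos k = j) = (k = ?j)" using index_pos_inv[OF that] by auto
    then show ?thesis using that by (auto simp: jnf_mat_def replace_row_def index_pos_less axis_def)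
  qed
  have "Determinants.det (replace_row i (axis j 1) X) = Determinant.det ?A" by (simp add: det_jnf_mat)
  also have "\<dots> = (\<Sum>k<?n. ?A $$ (?i, k) * cofactor ?A ?i k)"
    by (rule laplace_expansion_row[OF A index_pos_less])
  also have "\<dots> = (\<Sum>k<?n. if k = ?j then cofactor ?A ?i ?j else 0)"
    by (intro sum.cong) (auto simp: entry)
  also have "\<dots> = cofactor ?A ?i ?j" using index_pos_less[of j] by simp
  also have "\<dots> = (-1) ^ (?j + ?i) * Determinant.det (mat_delete (jnf_mat X) ?i ?j)"
    by (simp add: cofactor_def del add.commute)
  finally show ?thesis by (simp add: Finite_Cartesian_Product.transpose_def cof_def)
qed

lemma det_replace_row_expand:
  "Determinants.det (replace_row i v X) = (\<Sum>j\<in>UNIV. v $ j * Determinants.det (replace_row i (axis j 1) X))"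
proof -
  have "replace_row i v X = (\<chi> r. if r = i then (\<Sum>j\<in>UNIV. v $ j *s axis j 1) else X $ r)"
    unfolding replace_row_def basis_expansion ..
  also have "Determinants.det \<dots> = (\<Sum>j\<in>UNIV. Determinants.det (\<chi> r. if r = i then v $ j *s axis j 1 else X $ r))"
    by (rule Determinants.det_linear_row_sum) simp
  also have "\<dots> = (\<Sum>j\<in>UNIV. v $ j * Determinants.det (replace_row i (axis j 1) X))"
    unfolding replace_row_def by (intro sum.cong refl Determinants.det_row_mul)
  finally show ?thesis .
qed

text \<open>The sum expands the determinant in which row i is overwritten by row k; for k different
  from i two rows coincide.\<close>

lemma mult_cofactors:
  "(\<Sum>j\<in>UNIV. X $ k $ j * Determinants.det (replace_row i (axis j 1) X)) = (if k = i then Determinants.det X else 0)"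
proof -
  have "Determinants.det (replace_row i (X $ k) X) = (if k = i then Determinants.det X else 0)"
  proof (cases "k = i")
    case True
    then have "replace_row i (X $ k) X = X" by (simp add: replace_row_def Finite_Cartesian_Product.vec_eq_iff)
    then show ?thesis using True by simp
  next
    case False
    then have "Finite_Cartesian_Product.row k (replace_row i (X $ k) X) = Finite_Cartesian_Product.row i (replace_row i (X $ k) X)"
      by (simp add: replace_row_def Finite_Cartesian_Product.row_def)
    then show ?thesis using False Determinants.det_identical_rows[OF False] by simp
  qed
  then show ?thesis unfolding det_replace_row_expand[of i "X $ k"] .
qed

text \<open>The cofactors divided by the determinant form a right inverse of X, hence also a left
  inverse, and the latter lets y be recovered from its image under the cofactors.\<close>

lemma cofactors_kernel:
  fixes X :: "real ^ 'n ^ 'n"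
  assumes d: "Determinants.det X \<noteq> 0"
    and y: "\<And>i. (\<Sum>j\<in>UNIV. Determinants.det (replace_row i (axis j 1) X) * y j) = 0"
  shows "y k = 0"
proof -
  let ?C = "\<lambda>i j. Determinants.det (replace_row i (axis j 1) X)" and ?d = "Determinants.det X"
  define B :: "real ^ 'n ^ 'n" where "B = (\<chi> j i. ?C i j / ?d)"
  have "X ** B = Finite_Cartesian_Product.mat 1"
    using d mult_cofactors[of X]
    by (simp add: B_def matrix_matrix_mult_def Finite_Cartesian_Product.mat_def Finite_Cartesian_Product.vec_eq_iff sum_divide_distrib[symmetric])
  then have BX: "B ** X = Finite_Cartesian_Product.mat 1" by (simp add: matrix_left_right_inverse)
  have B: "(\<Sum>i\<in>UNIV. B $ j $ i * X $ i $ k) = (if j = k then 1 else 0)" for j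
    using arg_cong[OF BX, of "\<lambda>A. A $ j $ k"] by (simp add: matrix_matrix_mult_def Finite_Cartesian_Product.mat_def)
  have "(\<Sum>j\<in>UNIV. (if j = k then 1 else 0) * y j) = (\<Sum>j\<in>UNIV. if j = k then y j else 0)"
    by (intro sum.cong) auto
  then have "y k = (\<Sum>j\<in>UNIV. (if j = k then 1 else 0) * y j)" by simp
  also have "\<dots> = (\<Sum>j\<in>UNIV. \<Sum>i\<in>UNIV. X $ i $ k / ?d * (?C i j * y j))"
    unfolding B[symmetric] sum_distrib_right by (intro sum.cong refl) (simp add: B_def)
  also have "\<dots> = (\<Sum>i\<in>UNIV. \<Sum>j\<in>UNIV. X $ i $ k / ?d * (?C i j * y j))" by (rule sum.swap)
  also have "\<dots> = (\<Sum>i\<in>UNIV. X $ i $ k / ?d * (\<Sum>j\<in>UNIV. ?C i j * y j))" by (simp add: sum_distrib_left)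
  also have "\<dots> = 0" by (simp add: y)
  finally show ?thesis .
qed

text \<open>In \<open>q r m j\<close> the indices \<open>m\<close>, \<open>j\<close> belong to the second derivatives of the \<open>r\<close>-th component;
  their symmetry meets the antisymmetry of the determinant in its rows \<open>r\<close> and \<open>i\<close>.\<close>

lemma piola_sum:
  fixes X :: "real ^ 'n ^ 'n"
  assumes sym: "\<And>r m j. q r m j = q r j m"
  shows "(\<Sum>j\<in>UNIV. \<Sum>r\<in>UNIV. Determinants.det
    (replace_row r (if r = i then 0 else (\<chi> m. q r m j)) (replace_row i (axis j 1) X))) = 0"
proof (subst sum.swap, rule sum.neutral, rule ballI)
  fix r :: 'n
  show "(\<Sum>j\<in>UNIV. Determinants.det (replace_row r (if r = i then 0 else (\<chi> m. q r m j)) (replace_row i (axis j 1) X))) = 0"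
  proof (cases "r = i")
    case True
    \<comment> \<open>Row i holds the constant basis vector, so its derivative contributes a zero
      row.\<close>
    have "Determinants.det (replace_row i 0 Y) = 0" for Y
      unfolding replace_row_def by (rule Determinants.det_row_0)
    then show ?thesis using True by simp
  next
    case False
    define B where "B m j = Determinants.det (replace_row r (axis m 1) (replace_row i (axis j 1) X))" for m j
    have anti: "B m j = - B j m" for m j
    proof -
      have "replace_row r (axis m 1) (replace_row i (axis j 1) X)
          = (\<chi> s. replace_row r (axis j 1) (replace_row i (axis m 1) X) $ Transposition.transpose r i s)"
        using False by (auto simp: replace_row_def Finite_Cartesian_Product.vec_eq_iff Transposition.transpose_def)
      then have "B m j = of_int (sign (Transposition.transpose r i)) * B j m"
        unfolding B_def using Determinants.det_permute_rows[of "Transposition.transpose r i" "replace_row r (axis j 1) (replace_row i (axis m 1) X)"]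
        by (simp add: permutes_swap_id)
      then show ?thesis using False by (simp add: sign_swap_id)
    qed
    let ?S = "\<Sum>j\<in>UNIV. \<Sum>m\<in>UNIV. q r m j * B m j"
    have "?S = (\<Sum>m\<in>UNIV. \<Sum>j\<in>UNIV. q r m j * B m j)" by (rule sum.swap)
    also have "\<dots> = (\<Sum>m\<in>UNIV. \<Sum>j\<in>UNIV. - (q r j m * B j m))"
      by (intro sum.cong refl) (metis sym anti mult_minus_right)
    also have "\<dots> = - ?S" by (simp add: sum_negf)
    finally have "?S = 0" by simp
    moreover have "Determinants.det (replace_row r (\<chi> m. q r m j) (replace_row i (axis j 1) X)) = (\<Sum>m\<in>UNIV. q r m j * B m j)" for j
      unfolding B_def by (subst det_replace_row_expand) simp
    ultimately show ?thesis using False by simp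
  qed
qed

section \<open>Differentiation of determinants and cofactors\<close>

text \<open>Jacobi's formula, row by row: the product rule in each term of the Leibniz sum
  differentiates one row at a time.\<close>

lemma has_derivative_det:
  fixes X :: "real ^ 'n ^ 'n"
  shows "(Determinants.det has_derivative (\<lambda>H. \<Sum>r\<in>UNIV. Determinants.det (replace_row r (H $ r) X))) (at X)"
proof -
  have e: "((\<lambda>X :: real ^ 'n ^ 'n. X $ i $ j) has_derivative (\<lambda>H. H $ i $ j)) (at X)" for i j
    by (rule bounded_linear_imp_has_derivative)
      (rule bounded_linear_compose[OF bounded_linear_vec_nth bounded_linear_vec_nth])
  have "(Determinants.det has_derivative (\<lambda>H. \<Sum>p | p permutes UNIV.
      of_int (sign p) * (\<Sum>r\<in>UNIV. H $ r $ p r * (\<Prod>i\<in>UNIV - {r}. X $ i $ p i)))) (at X)"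
    unfolding Determinants.det_def[abs_def]
    by (intro has_derivative_sum has_derivative_mult_right has_derivative_prod e)
  moreover have "(\<Sum>p | p permutes UNIV. of_int (sign p) * (\<Sum>r\<in>UNIV. H $ r $ p r * (\<Prod>i\<in>UNIV - {r}. X $ i $ p i)))
      = (\<Sum>r\<in>UNIV. Determinants.det (replace_row r (H $ r) X))" for H
  proof -
    have "(\<Prod>i\<in>UNIV. replace_row r (H $ r) X $ i $ p i) = H $ r $ p r * (\<Prod>i\<in>UNIV - {r}. X $ i $ p i)" for r p
      by (subst prod.remove[of UNIV r]) (auto simp: replace_row_def intro!: prod.cong)
    then show ?thesis
      unfolding Determinants.det_def sum_distrib_left by (subst sum.swap) simp
  qed
  ultimately show ?thesis by simp
qed

text \<open>Replacing a row is an affine map whose linear part puts zero into row i. The derivative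
  is written with a zero row in order to fit \<open>piola_sum\<close>.\<close>

lemma has_derivative_cofactor:
  fixes X :: "real ^ 'n ^ 'n"
  shows "((\<lambda>X. Determinants.det (replace_row i v X)) has_derivative
    (\<lambda>H. \<Sum>r\<in>UNIV. Determinants.det (replace_row r (if r = i then 0 else H $ r) (replace_row i v X)))) (at X)"
proof -
  have lin: "bounded_linear (\<lambda>H. replace_row i 0 H)"
    by (rule linear_conv_bounded_linear[THEN iffD1]) (auto intro!: linearI simp: replace_row_def Finite_Cartesian_Product.vec_eq_iff)
  have "((\<lambda>X. replace_row i 0 X + replace_row i v 0) has_derivative (\<lambda>H. replace_row i 0 H)) (at X)"
    using has_derivative_add[OF bounded_linear_imp_has_derivative[OF lin] has_derivative_const] by simp
  moreover have "replace_row i 0 X + replace_row i v 0 = replace_row i v X" for X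
    by (simp add: replace_row_def Finite_Cartesian_Product.vec_eq_iff)
  ultimately have "((\<lambda>X. replace_row i v X) has_derivative (\<lambda>H. replace_row i 0 H)) (at X)" by simp
  from has_derivative_compose[OF this has_derivative_det] show ?thesis
    by (simp add: replace_row_def[of i 0] if_distrib cong: if_cong)
qed

lemma continuous_on_det: "continuous_on UNIV (Determinants.det :: real ^ 'n ^ 'n \<Rightarrow> real)"
  by (intro continuous_at_imp_continuous_on ballI has_derivative_continuous[OF has_derivative_det])

lemma continuous_on_replace_row:
  assumes "continuous_on S X" shows "continuous_on S (\<lambda>x. replace_row i v (X x))"
proof -
  have "continuous_on S (\<lambda>x. \<chi> r c. if r = i then v $ c else X x $ r $ c)"
  proof (intro continuous_on_vec_lambda)
    fix r c show "continuous_on S (\<lambda>x. if r = i then v $ c else X x $ r $ c)"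
      using assms by (cases "r = i") (auto intro!: continuous_intros)
  qed
  moreover have "replace_row i v (X x) = (\<chi> r c. if r = i then v $ c else X x $ r $ c)" for x
    by (simp add: replace_row_def Finite_Cartesian_Product.vec_eq_iff)
  ultimately show ?thesis by simp
qed

section \<open>Borel representatives\<close>

text \<open>Functions in the hypotheses are Lebesgue measurable and arbitrary off \<Omega>. Borel
  functions extended by zero make integrals over \<Omega> into integrals over the whole space, where
  the product measure is available.\<close>

definition borel_rep :: "'a::euclidean_space set \<Rightarrow> ('a \<Rightarrow> real) \<Rightarrow> ('a \<Rightarrow> real) \<Rightarrow> bool" where
  "borel_rep \<Omega> h h' \<longleftrightarrow> integrable lborel h' \<and> (\<forall>x. x \<notin> \<Omega> \<longrightarrow> h' x = 0) \<and>
     (AE x in lborel. x \<in> \<Omega> \<longrightarrow> h' x = h x)"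

lemma borel_rep_exists:
  fixes h :: "'a::euclidean_space \<Rightarrow> real"
  assumes \<Omega>: "open \<Omega>" and h: "set_integrable lebesgue \<Omega> h"
  shows "\<exists>h'. borel_rep \<Omega> h h'"
proof -
  define g where "g x = indicator \<Omega> x * h x" for x
  have g: "integrable lebesgue g" using h by (simp add: set_integrable_def g_def[abs_def])
  then obtain g' where g'[measurable]: "g' \<in> borel_measurable lborel" and ae: "AE x in lborel. g x = g' x"
    using completion_ex_borel_measurable_real[of g lborel] by auto
  have [measurable]: "\<Omega> \<in> sets borel" using \<Omega> by simp
  define h' where "h' x = indicator \<Omega> x * g' x" for x
  have m: "h' \<in> borel_measurable lborel" unfolding h'_def by measurable
  have ae': "AE x in lborel. g x = h' x"
    using ae by eventually_elim (auto simp: g_def h'_def indicator_def)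
  have "integrable lebesgue h'"
    by (rule integrable_cong_AE_imp[OF g measurable_completion[OF m] AE_completion[OF ae']])
  then have "integrable lborel h'" using m by (simp add: integrable_completion)
  moreover have "AE x in lborel. x \<in> \<Omega> \<longrightarrow> h' x = h x"
    using ae' by eventually_elim (auto simp: g_def)
  ultimately show ?thesis unfolding borel_rep_def by (intro exI[of _ h']) (simp add: h'_def)
qed

text \<open>Completeness of Lebesgue measure passes the measurability of G on to F, so F may be
  built from an arbitrary weak Jacobian.\<close>

lemma set_integral_eq_lborel:
  fixes F G :: "'a::euclidean_space \<Rightarrow> real"
  assumes G: "G \<in> borel_measurable borel" "\<And>x. x \<notin> \<Omega> \<Longrightarrow> G x = 0"
    and ae: "AE x in lborel. x \<in> \<Omega> \<longrightarrow> G x = F x"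
  shows "(LINT x:\<Omega>|lebesgue. F x) = (\<integral>x. G x \<partial>lborel)"
proof -
  let ?F = "\<lambda>x. indicator \<Omega> x *\<^sub>R F x"
  have Gm: "G \<in> borel_measurable lebesgue" using G(1) by (intro measurable_completion) simp
  have "AE x in lborel. G x = ?F x"
    using ae by eventually_elim (simp add: G(2) indicator_def)
  then have ae': "AE x in lebesgue. G x = ?F x" by (rule AE_completion)
  have "(LINT x:\<Omega>|lebesgue. F x) = (\<integral>x. ?F x \<partial>lebesgue)" by (simp add: set_lebesgue_integral_def)
  also have "\<dots> = (\<integral>x. G x \<partial>lebesgue)"
  proof (rule integral_cong_AE[OF borel_measurable_AE[OF Gm ae'] Gm])
    show "AE x in lebesgue. ?F x = G x" using ae' by eventually_elim (rule sym)
  qed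
  also have "\<dots> = (\<integral>x. G x \<partial>lborel)" using G(1) by (intro integral_completion) simp
  finally show ?thesis .
qed

lemma set_integral_borel_rep:
  assumes rep: "borel_rep \<Omega> h h'" and k: "k \<in> borel_measurable borel"
  shows "(LINT x:\<Omega>|lebesgue. h x * k x) = (\<integral>x. h' x * k x \<partial>lborel)"
proof (rule set_integral_eq_lborel)
  have "h' \<in> borel_measurable borel" using rep by (auto simp: borel_rep_def)
  then show "(\<lambda>x. h' x * k x) \<in> borel_measurable borel" using k by measurable
  show "AE x in lborel. x \<in> \<Omega> \<longrightarrow> h' x * k x = h x * k x"
  proof -
    have "AE x in lborel. x \<in> \<Omega> \<longrightarrow> h' x = h x" using rep by (simp add: borel_rep_def)
    then show ?thesis by eventually_elim simp
  qed
qed (use rep in \<open>simp add: borel_rep_def\<close>)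

lemma weak_partial_imp_weak_deriv:
  fixes \<Omega> :: "(real ^ 'n) set"
  assumes wp: "weak_partial \<Omega> j f h" and f: "borel_rep \<Omega> f f'" and h: "borel_rep \<Omega> h h'"
  shows "weak_deriv \<Omega> (axis j 1) f' h'"
  unfolding weak_deriv_def
proof (intro conjI ballI)
  show "integrable lborel f'" "integrable lborel h'" using f h by (auto simp: borel_rep_def)
  fix \<phi> :: "real ^ 'n \<Rightarrow> real" assume \<phi>: "\<phi> \<in> test_functions \<Omega>"
  have "(LINT x:\<Omega>|lebesgue. f x * frechet_derivative \<phi> (at x) (axis j 1)) = - (LINT x:\<Omega>|lebesgue. h x * \<phi> x)"
    using wp \<phi> unfolding weak_partial_def by blast
  then show "(\<integral>x. f' x * frechet_derivative \<phi> (at x) (axis j 1) \<partial>lborel) = - (\<integral>x. h' x * \<phi> x \<partial>lborel)"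
    by (simp only: set_integral_borel_rep[OF f test_function_measurable[OF test_function_derivative[OF \<phi>]]]
        set_integral_borel_rep[OF h test_function_measurable[OF \<phi>]])
qed

lemma test_functions_mono: "U \<subseteq> \<Omega> \<Longrightarrow> test_functions U \<subseteq> test_functions \<Omega>"
  by (auto simp: test_functions_def)

text \<open>Weak partial derivatives are only locally integrable, so the comparison takes place on
  boxes with closure in \<Omega>, where integrable representatives exist.\<close>

lemma weak_partial_unique:
  fixes \<Omega> :: "(real ^ 'n) set"
  assumes \<Omega>: "open \<Omega>" and h: "weak_partial \<Omega> j f h" and k: "weak_partial \<Omega> j f k"
  shows "AE x in lborel. x \<in> \<Omega> \<longrightarrow> h x = k x"
proof (rule AE_open_if_AE_cbox[OF \<Omega>])
  fix a b assume ab: "cbox a b \<subseteq> \<Omega>"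
  let ?B = "box a b"
  have B: "?B \<subseteq> \<Omega>" using ab box_subset_cbox[of a b] by (rule order_trans[rotated])
  have rep: "\<exists>g'. borel_rep ?B g g'" if g: "weak_partial \<Omega> j f g" for g
  proof (rule borel_rep_exists[OF open_box])
    have "set_integrable lebesgue (cbox a b) g"
      using g ab compact_cbox[of a b] by (simp add: weak_partial_def locally_integrable_on_def)
    then show "set_integrable lebesgue ?B g"
      by (rule set_integrable_subset[OF _ _ box_subset_cbox]) simp
  qed
  obtain h' k' where h': "borel_rep ?B h h'" and k': "borel_rep ?B k k'" using rep[OF h] rep[OF k] by blast
  have "AE x in lborel. x \<in> ?B \<longrightarrow> h' x = k' x"
  proof (rule AE_eq_if_test_integrals_eq[OF open_box])
    show "integrable lborel h'" "integrable lborel k'" using h' k' by (auto simp: borel_rep_def)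
    fix \<phi> :: "real ^ 'n \<Rightarrow> real" assume \<phi>: "\<phi> \<in> test_functions ?B"
    have \<phi>': "\<phi> \<in> test_functions \<Omega>" using \<phi> test_functions_mono[OF B] by blast
    have restr: "(LINT x:\<Omega>|lebesgue. g x * \<phi> x) = (LINT x:?B|lebesgue. g x * \<phi> x)" for g
      unfolding set_lebesgue_integral_def
    proof (rule Bochner_Integration.integral_cong[OF refl])
      fix x
      show "indicator \<Omega> x *\<^sub>R (g x * \<phi> x) = indicator ?B x *\<^sub>R (g x * \<phi> x)"
        using test_function_support[OF \<phi>, of x] B by (cases "\<phi> x = 0") (auto simp: indicator_def)
    qed
    have "- (LINT x:\<Omega>|lebesgue. h x * \<phi> x) = (LINT x:\<Omega>|lebesgue. f x * frechet_derivative \<phi> (at x) (axis j 1))"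
      using h \<phi>' unfolding weak_partial_def by fastforce
    also have "\<dots> = - (LINT x:\<Omega>|lebesgue. k x * \<phi> x)"
      using k \<phi>' unfolding weak_partial_def by blast
    finally have "- (LINT x:\<Omega>|lebesgue. h x * \<phi> x) = - (LINT x:\<Omega>|lebesgue. k x * \<phi> x)" .
    then show "(\<integral>x. h' x * \<phi> x \<partial>lborel) = (\<integral>x. k' x * \<phi> x \<partial>lborel)"
      unfolding restr set_integral_borel_rep[OF h' test_function_measurable[OF \<phi>]]
        set_integral_borel_rep[OF k' test_function_measurable[OF \<phi>]] by simp
  qed
  moreover have "AE x in lborel. x \<in> ?B \<longrightarrow> h' x = h x" "AE x in lborel. x \<in> ?B \<longrightarrow> k' x = k x"
    using h' k' by (simp_all add: borel_rep_def)
  ultimately show "AE x in lborel. x \<in> cbox a b \<longrightarrow> h x = k x"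
    using AE_cbox_imp_box[of a b]
  proof eventually_elim
    case (elim x)
    then show ?case by simp
  qed
qed

text \<open>It serves to truncate the first derivatives on a null set and to write the zero function
  for a derivative that vanishes almost everywhere in \<Omega>.\<close>

lemma weak_deriv_cong_AE:
  assumes wd: "weak_deriv \<Omega> v f h" and f': "f' \<in> borel_measurable borel" and h': "integrable lborel h'"
    and ff': "AE x in lborel. f' x = f x" and hh': "AE x in lborel. x \<in> \<Omega> \<longrightarrow> h' x = h x"
  shows "weak_deriv \<Omega> v f' h'"
  unfolding weak_deriv_def
proof (intro conjI ballI)
  have f: "integrable lborel f" and h: "integrable lborel h" using wd by (auto simp: weak_deriv_def)
  have [measurable]: "f \<in> borel_measurable borel" "h \<in> borel_measurable borel" "h' \<in> borel_measurable borel"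
    using f h h' by auto
  note [measurable] = f'
  show "integrable lborel f'"
  proof (rule integrable_cong_AE_imp[OF f])
    show "AE x in lborel. f x = f' x" using ff' by eventually_elim (rule sym)
  qed (use f' in simp)
  show "integrable lborel h'" by (rule h')
  fix \<phi> :: "'a \<Rightarrow> real" assume \<phi>: "\<phi> \<in> test_functions \<Omega>"
  note [measurable] = test_function_measurable[OF \<phi>] test_function_measurable[OF test_function_derivative[OF \<phi>]]
  have "(\<integral>x. f' x * frechet_derivative \<phi> (at x) v \<partial>lborel) = (\<integral>x. f x * frechet_derivative \<phi> (at x) v \<partial>lborel)"
  proof (rule integral_cong_AE)
    show "AE x in lborel. f' x * frechet_derivative \<phi> (at x) v = f x * frechet_derivative \<phi> (at x) v"
      using ff' by eventually_elim simp
  qed measurable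
  also have "\<dots> = - (\<integral>x. h x * \<phi> x \<partial>lborel)" using wd \<phi> by (simp add: weak_deriv_def)
  also have "(\<integral>x. h x * \<phi> x \<partial>lborel) = (\<integral>x. h' x * \<phi> x \<partial>lborel)"
  proof (rule integral_cong_AE)
    show "AE x in lborel. h x * \<phi> x = h' x * \<phi> x"
      using hh' by eventually_elim (use test_function_support[OF \<phi>] in auto)
  qed measurable
  finally show "(\<integral>x. f' x * frechet_derivative \<phi> (at x) v \<partial>lborel) = - (\<integral>x. h' x * \<phi> x \<partial>lborel)" .
qed

section \<open>Constancy of the determinant\<close>

lemma det_zero_matrix: "Determinants.det (0 :: real ^ 'n ^ 'n) = 0"
  \<comment> \<open>Here \<open>undefined\<close> is just some row index: the expansion along a row
    of zeros has only zero terms.\<close>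
  using mult_cofactors[of "0 :: real ^ 'n ^ 'n" undefined undefined] by simp

lemma continuous_on_det_replace_rows:
  "continuous_on UNIV (\<lambda>X :: real ^ 'n ^ 'n. Determinants.det (replace_row r v X))"
  "continuous_on UNIV (\<lambda>X :: real ^ 'n ^ 'n. Determinants.det (replace_row r v (replace_row i w X)))"
  by (rule continuous_on_compose2[OF continuous_on_det]; (intro continuous_on_replace_row continuous_on_id)?; simp)+

text \<open>The map u has disappeared: p stands for a bounded representative of Du and
  \<open>q k\<close> for its derivative in direction k. Only the symmetry \<open>sym\<close> recalls
  that the rows of p are gradients, and it is what the Piola identity needs.\<close>

theorem det_weak_jacobian_constant:
  fixes \<Omega> :: "(real ^ 'n) set" and p :: "real ^ 'n \<Rightarrow> real ^ 'n ^ 'n"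
    and q :: "'n \<Rightarrow> real ^ 'n \<Rightarrow> real ^ 'n ^ 'n" and g' g'' :: "real \<Rightarrow> real"
  assumes \<Omega>: "open \<Omega>" "connected \<Omega>" and R: "\<And>x. norm (p x) \<le> R"
    and q: "\<And>k. L1_deriv \<Omega> (axis k 1) p (q k)"
    and sym: "AE x in lborel. x \<in> \<Omega> \<longrightarrow> (\<forall>i j k. q k x $ i $ j = q j x $ i $ k)"
    and g'': "\<And>t. (g' has_real_derivative g'' t) (at t)" "continuous_on UNIV g''" "\<And>t. 0 < g'' t"
    and g'0: "g' 0 = 0"
    and eq: "\<And>i \<phi>. \<phi> \<in> test_functions \<Omega> \<Longrightarrow> (\<integral>x. (\<Sum>m\<in>UNIV. g' (Determinants.det (p x)) *
      Determinants.det (replace_row i (axis m 1) (p x)) * frechet_derivative \<phi> (at x) (axis m 1)) \<partial>lborel) = 0"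
  shows "\<exists>c. AE x in lborel. x \<in> \<Omega> \<longrightarrow> Determinants.det (p x) = c"
proof -
  let ?det = "Determinants.det :: real ^ 'n ^ 'n \<Rightarrow> real"
  define D where "D i m X = ?det (replace_row i (axis m 1) X)" for i m X
  define ddet where "ddet X H = (\<Sum>r\<in>UNIV. ?det (replace_row r (H $ r) X))" for X H
  define dD where "dD i m X H = (\<Sum>r\<in>UNIV. ?det (replace_row r (if r = i then 0 else H $ r) (replace_row i (axis m 1) X)))" for i m X H
  define G where "G i m X = g' (?det X) * D i m X" for i m X
  define dG where "dG i m X H = g' (?det X) * dD i m X H + g'' (?det X) * ddet X H * D i m X" for i m X H
  have hdet: "(?det has_derivative ddet X) (at X)" for X
    using has_derivative_det[of X] by (simp add: ddet_def[abs_def])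
  have hD: "(D i m has_derivative dD i m X) (at X)" for i m X
    using has_derivative_cofactor[of i "axis m 1" X] by (simp add: D_def[abs_def] dD_def[abs_def])
  have hG: "(G i m has_derivative dG i m X) (at X)" for i m X
  proof -
    have "((\<lambda>X. g' (?det X)) has_derivative (\<lambda>H. g'' (?det X) * ddet X H)) (at X)"
      using has_derivative_compose[OF hdet[of X] has_field_derivative_imp_has_derivative[OF g''(1)[of "?det X"]]] by simp
    from has_derivative_mult[OF this hD[of i m X]] show ?thesis
      by (simp add: G_def[abs_def] dG_def[abs_def])
  qed
  have cddet: "continuous_on UNIV (\<lambda>X. ddet X H)" for H
    unfolding ddet_def by (intro continuous_on_sum continuous_on_det_replace_rows)
  have cdD: "continuous_on UNIV (\<lambda>X. dD i m X H)" for i m H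
    unfolding dD_def by (intro continuous_on_sum continuous_on_det_replace_rows)
  have cD: "continuous_on UNIV (D i m)" for i m
    unfolding D_def[abs_def] by (rule continuous_on_det_replace_rows)
  have cg': "continuous_on UNIV (\<lambda>X. g' (?det X))"
    by (rule continuous_on_compose2[OF _ continuous_on_det, of UNIV])
      (use DERIV_isCont[OF g''(1)] in \<open>auto intro: continuous_at_imp_continuous_on\<close>)
  have cg'': "continuous_on UNIV (\<lambda>X. g'' (?det X))"
    by (rule continuous_on_compose2[OF g''(2) continuous_on_det]) simp
  have cdG: "continuous_on UNIV (\<lambda>X. dG i m X H)" for i m H
    unfolding dG_def by (intro continuous_on_add continuous_on_mult cg' cg'' cdD cddet cD)
  \<comment> \<open>The flux vanishes at the zero matrix because g' 0 = 0, as the chain rule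
    demands.\<close>
  have LG: "L1_deriv \<Omega> (axis m 1) (\<lambda>x. G i m (p x)) (\<lambda>x. dG i m (p x) (q m x))" for i m
    by (rule L1_deriv_chain[OF q R hG cdG]) (simp add: G_def det_zero_matrix g'0)
  have wG: "weak_deriv \<Omega> (axis m 1) (\<lambda>x. G i m (p x)) (\<lambda>x. dG i m (p x) (q m x))" for i m
    by (rule L1_deriv_imp_weak_deriv[OF LG])
  have div0: "AE x in lborel. x \<in> \<Omega> \<longrightarrow> (\<Sum>m\<in>UNIV. dG i m (p x) (q m x)) = 0" for i
  proof (rule AE_zero_if_test_integrals_zero[OF \<Omega>(1)])
    have dGi: "integrable lborel (\<lambda>x. dG i m (p x) (q m x))" for m
      using wG by (simp add: weak_deriv_def)
    then show "integrable lborel (\<lambda>x. \<Sum>m\<in>UNIV. dG i m (p x) (q m x))"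
      by (rule Bochner_Integration.integrable_sum)
    fix \<phi> :: "real ^ 'n \<Rightarrow> real" assume \<phi>: "\<phi> \<in> test_functions \<Omega>"
    note [measurable] = test_function_measurable[OF \<phi>]
    obtain B where B: "\<And>x. \<bar>\<phi> x\<bar> \<le> B" using test_function_bounded[OF \<phi>] by blast
    have i\<phi>: "integrable lborel (\<lambda>x. dG i m (p x) (q m x) * \<phi> x)" for m
      by (rule integrable_bounded_mult[OF dGi _ B]) simp
    have "(\<integral>x. (\<Sum>m\<in>UNIV. dG i m (p x) (q m x)) * \<phi> x \<partial>lborel) = (\<Sum>m\<in>UNIV. \<integral>x. dG i m (p x) (q m x) * \<phi> x \<partial>lborel)"
      unfolding sum_distrib_right by (rule Bochner_Integration.integral_sum) (rule i\<phi>)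
    also have "\<dots> = (\<Sum>m\<in>UNIV. - (\<integral>x. G i m (p x) * frechet_derivative \<phi> (at x) (axis m 1) \<partial>lborel))"
      using wG \<phi> by (intro sum.cong refl) (simp add: weak_deriv_def)
    also have "\<dots> = - (\<Sum>m\<in>UNIV. \<integral>x. G i m (p x) * frechet_derivative \<phi> (at x) (axis m 1) \<partial>lborel)"
      by (rule sum_negf)
    also have "(\<Sum>m\<in>UNIV. \<integral>x. G i m (p x) * frechet_derivative \<phi> (at x) (axis m 1) \<partial>lborel)
        = (\<integral>x. (\<Sum>m\<in>UNIV. G i m (p x) * frechet_derivative \<phi> (at x) (axis m 1)) \<partial>lborel)"
    proof (rule Bochner_Integration.integral_sum[symmetric])
      fix m
      have \<psi>: "(\<lambda>x. frechet_derivative \<phi> (at x) (axis m 1)) \<in> test_functions \<Omega>"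
        by (rule test_function_derivative[OF \<phi>])
      note [measurable] = test_function_measurable[OF \<psi>]
      obtain B where "\<And>x. \<bar>frechet_derivative \<phi> (at x) (axis m 1)\<bar> \<le> B" using test_function_bounded[OF \<psi>] by blast
      then show "integrable lborel (\<lambda>x. G i m (p x) * frechet_derivative \<phi> (at x) (axis m 1))"
        using wG[of m i] by (intro integrable_bounded_mult[where B = B]) (auto simp: weak_deriv_def)
    qed
    also have "- \<dots> = 0"
      using eq[OF \<phi>, of i] by (simp add: G_def D_def)
    finally show "(\<integral>x. (\<Sum>m\<in>UNIV. dG i m (p x) (q m x)) * \<phi> x \<partial>lborel) = 0" .
  qed
  have "AE x in lborel. \<forall>i. x \<in> \<Omega> \<longrightarrow> (\<Sum>m\<in>UNIV. dG i m (p x) (q m x)) = 0"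
    using div0 by (subst AE_all_countable) (auto intro: countable_finite)
  with sym have grad: "AE x in lborel. x \<in> \<Omega> \<longrightarrow> ?det (p x) \<noteq> 0 \<longrightarrow> (\<forall>m. ddet (p x) (q m x) = 0)"
  proof eventually_elim
    case (elim x)
    show ?case
    proof (intro impI allI)
      fix m assume x: "x \<in> \<Omega>" and d: "?det (p x) \<noteq> 0"
      show "ddet (p x) (q m x) = 0"
      proof (rule cofactors_kernel[OF d])
        fix i
        have "(\<Sum>m\<in>UNIV. dD i m (p x) (q m x)) = 0"
        proof -
          have "dD i m (p x) (q m x) = (\<Sum>r\<in>UNIV. ?det (replace_row r (if r = i then 0 else (\<chi> l. q m x $ r $ l)) (replace_row i (axis m 1) (p x))))" for m
            unfolding dD_def Finite_Cartesian_Product.vec_lambda_eta ..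
          then show ?thesis using piola_sum[of "\<lambda>r l m. q m x $ r $ l" i "p x"] elim x by simp
        qed
        moreover have "(\<Sum>m\<in>UNIV. dG i m (p x) (q m x))
            = g' (?det (p x)) * (\<Sum>m\<in>UNIV. dD i m (p x) (q m x)) + g'' (?det (p x)) * (\<Sum>m\<in>UNIV. D i m (p x) * ddet (p x) (q m x))"
          by (simp add: dG_def sum.distrib sum_distrib_left mult_ac)
        moreover have "(\<Sum>m\<in>UNIV. dG i m (p x) (q m x)) = 0" using elim x by simp
        ultimately have "(\<Sum>m\<in>UNIV. D i m (p x) * ddet (p x) (q m x)) = 0"
          using g''(3)[of "?det (p x)"] by simp
        then show "(\<Sum>m\<in>UNIV. ?det (replace_row i (axis m 1) (p x)) * ddet (p x) (q m x)) = 0"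
          by (simp add: D_def)
      qed
    qed
  qed
  \<comment> \<open>A general F is allowed because the argument runs twice, for the square of the
    determinant and for the determinant.\<close>
  have const: "\<exists>c. AE x in lborel. x \<in> \<Omega> \<longrightarrow> F (p x) = c"
    if hF: "\<And>X. (F has_derivative dF X) (at X)" and cF: "\<And>H. continuous_on UNIV (\<lambda>X. dF X H)" and F0: "F 0 = 0"
      and z: "\<And>m. AE x in lborel. x \<in> \<Omega> \<longrightarrow> dF (p x) (q m x) = 0"
    for F :: "real ^ 'n ^ 'n \<Rightarrow> real" and dF
  proof (rule weak_gradient_zero_imp_constant[OF \<Omega>])
    have L: "L1_deriv \<Omega> (axis m 1) (\<lambda>x. F (p x)) (\<lambda>x. dF (p x) (q m x))" for m
      by (rule L1_deriv_chain[OF q R hF cF F0])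
    then show i: "integrable lborel (\<lambda>x. F (p x))" by (auto simp: L1_deriv_def)
    fix b :: "real ^ 'n" assume "b \<in> Basis"
    then obtain m where b: "b = axis m 1" by (auto simp: Basis_vec_def)
    show "weak_deriv \<Omega> b (\<lambda>x. F (p x)) (\<lambda>x. 0)"
      unfolding b
    proof (rule weak_deriv_cong_AE[OF L1_deriv_imp_weak_deriv[OF L[of m]]])
      show "AE x in lborel. x \<in> \<Omega> \<longrightarrow> 0 = dF (p x) (q m x)"
        using z[of m] by eventually_elim simp
    qed (use i in auto)
  qed
  have "\<exists>c. AE x in lborel. x \<in> \<Omega> \<longrightarrow> (?det (p x))\<^sup>2 = c"
  proof (rule const[of "\<lambda>X. (?det X)\<^sup>2" "\<lambda>X H. 2 * ?det X * ddet X H"])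
    show "((\<lambda>X. (?det X)\<^sup>2) has_derivative (\<lambda>H. 2 * ?det X * ddet X H)) (at X)" for X
      using has_derivative_mult[OF hdet[of X] hdet[of X]] by (simp add: power2_eq_square algebra_simps)
    show "continuous_on UNIV (\<lambda>X. 2 * ?det X * ddet X H)" for H
      by (intro continuous_on_mult continuous_on_const continuous_on_det cddet)
    show "AE x in lborel. x \<in> \<Omega> \<longrightarrow> 2 * ?det (p x) * ddet (p x) (q m x) = 0" for m
      using grad by eventually_elim auto
  qed (simp add: det_zero_matrix)
  then obtain c where c: "AE x in lborel. x \<in> \<Omega> \<longrightarrow> (?det (p x))\<^sup>2 = c" by blast
  show ?thesis
  proof (cases "c = 0")
    case True
    have "AE x in lborel. x \<in> \<Omega> \<longrightarrow> ?det (p x) = 0"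
      using c by eventually_elim (simp add: True)
    then show ?thesis by blast
  next
    case False
    \<comment> \<open>Now the determinant is nonzero almost everywhere in \<Omega>, so
      \<open>grad\<close> holds without exception, and applying \<open>const\<close> to the
      determinant itself fixes its sign.\<close>
    show ?thesis
    proof (rule const[OF hdet cddet det_zero_matrix])
      show "AE x in lborel. x \<in> \<Omega> \<longrightarrow> ddet (p x) (q m x) = 0" for m
        using c grad by eventually_elim (use False in auto)
    qed
  qed
qed

text \<open>The first derivatives known to have second derivatives come from the Sobolev hypothesis,
  whereas the equation is written with \<open>Du\<close>; \<open>weak_partial_unique\<close>
  identifies them. Both are then represented by a Borel field that is zero off \<Omega> and bounded
  at every point.\<close>

theorem corollary3p7:
  fixes \<Omega> :: "(real ^ 'n::{finite,wellorder}) set"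
    and g g' g'' :: "real \<Rightarrow> real"
    and u :: "real ^ 'n::_ \<Rightarrow> real ^ 'n::_"
    and Du :: "real ^ 'n::_ \<Rightarrow> real ^ 'n::_ ^ 'n::_"
  assumes "open \<Omega>" and "connected \<Omega>"
    and "\<And>t. (g has_real_derivative g' t) (at t)"
    and "\<And>t. (g' has_real_derivative g'' t) (at t)"
    and "continuous_on UNIV g''"
    and "\<And>t. g'' t > 0"
    and "g 0 = 0" and "g' 0 = 0"
    and "\<exists>L. L-lipschitz_on \<Omega> u"
    and "\<And>i. (\<lambda>x. u x $ i) \<in> sobolev_1 2 \<Omega>"
    and "weak_jacobian \<Omega> u Du"
    and "\<And>\<eta> :: real ^ 'n::_ \<Rightarrow> real ^ 'n::_. \<eta> \<in> test_functions \<Omega> \<Longrightarrow>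
      (LINT x:\<Omega>|lebesgue. g' (Determinants.det (Du x)) *
         (Finite_Cartesian_Product.transpose (cof (Du x)) \<bullet> jacobian \<eta> (at x))) = 0"
  shows "\<exists>c. AE x in lebesgue. x \<in> \<Omega> \<longrightarrow> Determinants.det (Du x) = c"
proof -
  note \<Omega> = assms(1) and conn = assms(2) and g'' = assms(4,5,6) and g'0 = assms(8) and weak_eq = assms(12)
  obtain L where L: "L-lipschitz_on \<Omega> u" using assms(9) by blast
  have L0: "0 \<le> L" using L by (rule lipschitz_on_nonneg)
  have \<Omega>B[measurable]: "\<Omega> \<in> sets borel" using \<Omega> by simp
  have ui: "set_integrable lebesgue \<Omega> (\<lambda>x. u x $ i)"
    and ui': "\<forall>j. \<exists>p\<in>sobolev_1 1 \<Omega>. weak_partial \<Omega> j (\<lambda>x. u x $ i) p" for i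
    using assms(10)[of i] by (simp_all add: numeral_2_eq_2)
  \<comment> \<open>The choice fixes, among all versions of the derivative, one that belongs to the
    Sobolev space of order one and so can be differentiated again.\<close>
  define p where "p i j = (SOME p. p \<in> sobolev_1 1 \<Omega> \<and> weak_partial \<Omega> j (\<lambda>x. u x $ i) p)" for i j
  have p: "p i j \<in> sobolev_1 1 \<Omega> \<and> weak_partial \<Omega> j (\<lambda>x. u x $ i) (p i j)" for i j
    unfolding p_def using spec[OF ui'[of i], of j] unfolding Bex_def by (rule someI_ex)
  then have pi: "set_integrable lebesgue \<Omega> (p i j)"
    and pi': "\<forall>k. \<exists>q. set_integrable lebesgue \<Omega> q \<and> weak_partial \<Omega> k (p i j) q" for i j
    by (simp_all add: Bex_def)
  define q where "q i j k = (SOME q. set_integrable lebesgue \<Omega> q \<and> weak_partial \<Omega> k (p i j) q)" for i j k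
  have q: "set_integrable lebesgue \<Omega> (q i j k) \<and> weak_partial \<Omega> k (p i j) (q i j k)" for i j k
    unfolding q_def using spec[OF pi'[of i j], of k] by (rule someI_ex)
  \<comment> \<open>The zero extension of u itself rather than a modification of it: u is
    continuous, hence Borel on \<Omega>, and the Lipschitz estimate is used pointwise.\<close>
  define U where "U i x = indicator \<Omega> x *\<^sub>R u x $ i" for i x
  have U: "borel_rep \<Omega> (\<lambda>x. u x $ i) (U i)" for i
  proof -
    have "continuous_on \<Omega> (\<lambda>x. u x $ i)"
      by (intro continuous_intros lipschitz_on_continuous_on[OF L])
    then have "U i \<in> borel_measurable borel"
      unfolding U_def[abs_def] by (rule borel_measurable_continuous_on_indicator[OF \<Omega>B])
    moreover have "integrable lebesgue (U i)" using ui[of i] by (simp add: U_def[abs_def] set_integrable_def)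
    ultimately have "integrable lborel (U i)" by (subst integrable_completion[symmetric]) simp_all
    then show ?thesis by (simp add: borel_rep_def U_def)
  qed
  define P where "P i j = (SOME P'. borel_rep \<Omega> (p i j) P')" for i j
  have P: "borel_rep \<Omega> (p i j) (P i j)" for i j
    unfolding P_def by (rule someI_ex[OF borel_rep_exists[OF \<Omega> pi]])
  define Q where "Q i j k = (SOME Q'. borel_rep \<Omega> (q i j k) Q')" for i j k
  have Q: "borel_rep \<Omega> (q i j k) (Q i j k)" for i j k
    unfolding Q_def by (rule someI_ex[OF borel_rep_exists[OF \<Omega> conjunct1[OF q]]])
  have wU: "weak_deriv \<Omega> (axis j 1) (U i) (P i j)" for i j
    by (rule weak_partial_imp_weak_deriv[OF conjunct2[OF p] U P])
  have wP: "weak_deriv \<Omega> (axis k 1) (P i j) (Q i j k)" for i j k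
    by (rule weak_partial_imp_weak_deriv[OF conjunct2[OF q] P Q])
  have Pi: "integrable lborel (P i j)" and P_out: "x \<notin> \<Omega> \<Longrightarrow> P i j x = 0" for i j x
    using P[of i j] by (simp_all add: borel_rep_def)
  have [measurable]: "P i j \<in> borel_measurable borel" for i j using Pi[of i j] by simp
  have P_bound: "AE x in lborel. x \<in> \<Omega> \<longrightarrow> \<bar>P i j x\<bar> \<le> L" for i j
  proof (rule L1_deriv_lipschitz_bound[OF weak_deriv_imp_L1_deriv[OF wU \<Omega>] \<Omega> _ L0])
    fix x y assume xy: "x \<in> \<Omega>" "y \<in> \<Omega>"
    have "\<bar>(u x - u y) $ i\<bar> \<le> norm (u x - u y)" by (rule component_le_norm_cart)
    also have "\<dots> \<le> L * norm (x - y)" using lipschitz_onD[OF L xy] by (simp add: dist_norm)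
    finally show "\<bar>U i x - U i y\<bar> \<le> L * norm (x - y)" using xy by (simp add: U_def)
  qed simp
  \<comment> \<open>The chain rule asks for a bound at every point, but the Lipschitz estimate holds
    almost everywhere; the entries are set to zero on the exceptional null set.\<close>
  define Pb where "Pb i j x = (if \<bar>P i j x\<bar> \<le> L then P i j x else 0)" for i j x
  have Pb_eq: "AE x in lborel. Pb i j x = P i j x" for i j
    using P_bound[of i j] by eventually_elim (use P_out in \<open>auto simp: Pb_def\<close>)
  have wPb: "weak_deriv \<Omega> (axis k 1) (Pb i j) (Q i j k)" for i j k
  proof (rule weak_deriv_cong_AE[OF wP _ _ Pb_eq])
    show "Pb i j \<in> borel_measurable borel" unfolding Pb_def[abs_def] by measurable
    show "integrable lborel (Q i j k)" using Q[of i j k] by (simp add: borel_rep_def)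
  qed simp
  define pm :: "real ^ 'n::_ \<Rightarrow> real ^ 'n::_ ^ 'n::_" where "pm x = (\<chi> i j. Pb i j x)" for x
  define qm :: "'n \<Rightarrow> real ^ 'n::_ \<Rightarrow> real ^ 'n::_ ^ 'n::_" where "qm k x = (\<chi> i j. Q i j k x)" for k x
  have pm_out: "pm x = 0" if "x \<notin> \<Omega>" for x
    using P_out[OF that] by (simp add: pm_def Pb_def Finite_Cartesian_Product.vec_eq_iff)
  have q_L1: "L1_deriv \<Omega> (axis k 1) pm (qm k)" for k
  proof (rule L1_deriv_componentwise)
    fix b :: "real ^ 'n::_ ^ 'n::_" assume "b \<in> Basis"
    then obtain i j where b: "b = axis i (axis j 1)" by (auto simp: Basis_vec_def)
    have "(\<lambda>x. pm x \<bullet> b) = Pb i j" "(\<lambda>x. qm k x \<bullet> b) = Q i j k"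
      by (simp_all add: b pm_def qm_def inner_axis fun_eq_iff)
    then show "L1_deriv \<Omega> (axis k 1) (\<lambda>x. pm x \<bullet> b) (\<lambda>x. qm k x \<bullet> b)"
      using weak_deriv_imp_L1_deriv[OF wPb \<Omega>] by simp
  qed
  have bound: "norm (pm x) \<le> (\<Sum>b\<in>(Basis :: (real ^ 'n::_ ^ 'n::_) set). L)" for x
  proof (rule order_trans[OF norm_le_l1 sum_mono])
    fix b :: "real ^ 'n::_ ^ 'n::_" assume "b \<in> Basis"
    then obtain i j where b: "b = axis i (axis j 1)" by (auto simp: Basis_vec_def)
    show "\<bar>pm x \<bullet> b\<bar> \<le> L" using L0 by (simp add: b pm_def inner_axis Pb_def)
  qed
  \<comment> \<open>In \<open>Q i j k\<close> the component i is differentiated in direction j and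
    then in direction k, so the symmetry concerns the last two indices.\<close>
  have "AE x in lborel. \<forall>i j k. x \<in> \<Omega> \<longrightarrow> Q i j k x = Q i k j x"
    by (simp only: AE_all_countable) (intro allI weak_derivs_commute[OF \<Omega> wU wU wP wP])
  then have sym: "AE x in lborel. x \<in> \<Omega> \<longrightarrow> (\<forall>i j k. qm k x $ i $ j = qm j x $ i $ k)"
    by eventually_elim (simp add: qm_def)
  have "AE x in lborel. x \<in> \<Omega> \<longrightarrow> Du x $ i $ j = pm x $ i $ j" for i j
  proof -
    have "weak_partial \<Omega> j (\<lambda>x. u x $ i) (\<lambda>x. Du x $ i $ j)" using assms(11) by (simp add: weak_jacobian_def)
    moreover have "weak_partial \<Omega> j (\<lambda>x. u x $ i) (p i j)" by (rule conjunct2[OF p])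
    ultimately have "AE x in lborel. x \<in> \<Omega> \<longrightarrow> Du x $ i $ j = p i j x" by (rule weak_partial_unique[OF \<Omega>])
    moreover have "AE x in lborel. x \<in> \<Omega> \<longrightarrow> P i j x = p i j x" using P[of i j] by (simp add: borel_rep_def)
    ultimately show ?thesis using Pb_eq[of i j] by eventually_elim (simp add: pm_def)
  qed
  then have "AE x in lborel. \<forall>i j. x \<in> \<Omega> \<longrightarrow> Du x $ i $ j = pm x $ i $ j"
    by (simp only: AE_all_countable) blast
  then have Du: "AE x in lborel. x \<in> \<Omega> \<longrightarrow> pm x = Du x"
    by eventually_elim (simp add: Finite_Cartesian_Product.vec_eq_iff)
  have pm_meas[measurable]: "pm \<in> borel_measurable borel" using q_L1[of undefined] by (auto simp: L1_deriv_def)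
  have [measurable]: "g' \<in> borel_measurable borel"
    using DERIV_isCont[OF g''(1)] by (intro borel_measurable_continuous_onI continuous_at_imp_continuous_on) auto
  note [measurable] = borel_measurable_continuous_onI[OF continuous_on_det]
    borel_measurable_continuous_onI[OF continuous_on_det_replace_rows(1)]
  have eq: "(\<integral>x. (\<Sum>m\<in>UNIV. g' (Determinants.det (pm x)) * Determinants.det (replace_row i (axis m 1) (pm x)) *
      frechet_derivative \<phi> (at x) (axis m 1)) \<partial>lborel) = 0" if \<phi>: "\<phi> \<in> test_functions \<Omega>" for i \<phi>
  proof -
    \<comment> \<open>A test field along one coordinate axis isolates row i of the equation.\<close>
    define \<eta> :: "real ^ 'n::_ \<Rightarrow> real ^ 'n::_" where "\<eta> x = \<phi> x *\<^sub>R axis i 1" for x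
    have \<eta>: "\<eta> \<in> test_functions \<Omega>"
    proof (rule test_functionsI[of _ "closure {x. \<phi> x \<noteq> 0}"])
      show "C_k k \<eta>" for k
        unfolding \<eta>_def[abs_def] using \<phi>
        by (intro C_k_linear_image[OF bounded_linear_scaleR_left]) (simp add: test_functions_def)
      show "\<eta> x = 0" if "x \<notin> closure {x. \<phi> x \<noteq> 0}" for x
        using that closure_subset[of "{x. \<phi> x \<noteq> 0}"] by (auto simp: \<eta>_def)
    qed (use \<phi> in \<open>simp_all add: test_functions_def\<close>)
    note [measurable] = test_function_measurable[OF test_function_derivative[OF \<phi>]]
    have jac: "jacobian \<eta> (at x) $ l $ m = frechet_derivative \<phi> (at x) (axis m 1) * axis i 1 $ l" for x l m
    proof -
      have "(\<eta> has_derivative (\<lambda>v. frechet_derivative \<phi> (at x) v *\<^sub>R axis i 1)) (at x)"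
        unfolding \<eta>_def[abs_def]
        by (rule bounded_linear.has_derivative[OF bounded_linear_scaleR_left test_function_has_derivative[OF \<phi>]])
      from frechet_derivative_at[OF this, symmetric] show ?thesis
        by (simp add: jacobian_def matrix_def)
    qed
    have inner: "A \<bullet> jacobian \<eta> (at x) = (\<Sum>m\<in>UNIV. A $ i $ m * frechet_derivative \<phi> (at x) (axis m 1))"
      for A :: "real ^ 'n::_ ^ 'n::_" and x
    proof -
      have "A \<bullet> jacobian \<eta> (at x) = (\<Sum>l\<in>UNIV. \<Sum>m\<in>UNIV. A $ l $ m * (frechet_derivative \<phi> (at x) (axis m 1) * axis i 1 $ l))"
        by (simp add: inner_vec_def jac)
      also have "\<dots> = (\<Sum>l\<in>UNIV. if l = i then \<Sum>m\<in>UNIV. A $ i $ m * frechet_derivative \<phi> (at x) (axis m 1) else 0)"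
        by (intro sum.cong) (auto simp: axis_def)
      finally show ?thesis by simp
    qed
    let ?G = "\<lambda>x. \<Sum>m\<in>UNIV. g' (Determinants.det (pm x)) * Determinants.det (replace_row i (axis m 1) (pm x)) *
      frechet_derivative \<phi> (at x) (axis m 1)"
    have "(LINT x:\<Omega>|lebesgue. g' (Determinants.det (Du x)) *
         (Finite_Cartesian_Product.transpose (cof (Du x)) \<bullet> jacobian \<eta> (at x))) = (\<integral>x. ?G x \<partial>lborel)"
    proof (rule set_integral_eq_lborel)
      show "?G \<in> borel_measurable borel" by measurable
      \<comment> \<open>Off \<Omega> the field \<open>pm\<close> is zero, so its determinant is zero
        and g' 0 = 0 removes the integrand.\<close>
      show "?G x = 0" if "x \<notin> \<Omega>" for x by (simp add: pm_out[OF that] det_zero_matrix g'0)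
      show "AE x in lborel. x \<in> \<Omega> \<longrightarrow> ?G x = g' (Determinants.det (Du x)) *
         (Finite_Cartesian_Product.transpose (cof (Du x)) \<bullet> jacobian \<eta> (at x))"
        using Du by eventually_elim (simp add: inner transpose_cof sum_distrib_left mult.assoc)
    qed
    with weak_eq[OF \<eta>] show ?thesis by simp
  qed
  obtain c where "AE x in lborel. x \<in> \<Omega> \<longrightarrow> Determinants.det (pm x) = c"
    using det_weak_jacobian_constant[OF \<Omega> conn bound q_L1 sym g'' g'0 eq] by blast
  with Du have "AE x in lborel. x \<in> \<Omega> \<longrightarrow> Determinants.det (Du x) = c" by eventually_elim auto
  then have "AE x in lebesgue. x \<in> \<Omega> \<longrightarrow> Determinants.det (Du x) = c" by (rule AE_completion)
  then show ?thesis by blast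
qed

end
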